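(* Let $X$ be a polynomially stable sequence class and $Y$ be a linearly stable sequence class such that $X(\mathbb{K})^n\hookrightarrow Y(\mathbb{K})$ for every $n\in\mathbb{N}$. Then $(\mathcal{P}_{X;Y},\|\cdot\|_{X;Y;1})$ is a polynomial Banach hyper-ideal.
   Context: All Banach spaces are over $\mathbb{K} = \mathbb{R}$ or $\mathbb{C}$. $\mathcal{L}(E;F)$ is the Banach space of bounded linear operators and $\mathcal{P}(^nE;F)$ the Banach space of continuous $n$-homogeneous polynomials from $E$ to $F$, with their usual sup norms. **Sequence class.** $E \hookrightarrow F$ means that the Banach space $E$ is a linear subspace of the Banach space $F$ and $\|x\|_F \le \|x\|_E$ for all $x\in E$. $c_{00}(E)$ is the space of eventually null $E$-valued sequences, $\ell_\infty(E)$ the Banach space of bounded $E$-valued sequences with the sup norm, and $e_j$ the $j$-th canonical scalar sequence. A sequence class is a rule $E\mapsto X(E)$ assigning to each Banach space $E$ a Banach space $X(E)$ of $E$-valued sequences (coordinatewise operations) such that $c_{00}(E)\subseteq X(E)$, $X(E)\hookrightarrow \ell_\infty(E)$ and $\|e_j\|_{X(\mathbb{K})}=1$ for every $j\in\mathbb{N}$. **Linearly stable.** $Y$ is linearly stable if for all Banach spaces $E,F$ and every $u\in\mathcal{L}(E;F)$, $(u(x_j))_{j=1}^\infty\in Y(F)$ whenever $(x_j)_{j=1}^\infty\in Y(E)$, and the induced linear operator $\widetilde u\colon Y(E)\to Y(F)$, $\widetilde u((x_j)_j)=(u(x_j))_j$, is continuous with $\|\widetilde u\|=\|u\|$. **Polynomially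 stable.** $X$ is polynomially stable if for all $n\in\mathbb{N}$, Banach spaces $E,F$ and $P\in\mathcal{P}(^nE;F)$, $(P(x_j))_{j=1}^\infty\in X(F)$ whenever $(x_j)_{j=1}^\infty\in X(E)$, and $\widetilde P\colon X(E)\to X(F)$, $\widetilde P((x_j)_j)=(P(x_j))_j$, is an $n$-homogeneous polynomial with $\|\widetilde P\|=\|P\|$. **Compatibility.** $X(\mathbb{K})^n\hookrightarrow Y(\mathbb{K})$ means: whenever $(\lambda_j^m)_{j=1}^\infty\in X(\mathbb{K})$, $m=1,\ldots,n$, one has $(\lambda_j^1\cdots\lambda_j^n)_{j=1}^\infty\in Y(\mathbb{K})$ and $\|(\lambda_j^1\cdots\lambda_j^n)_j\|_{Y(\mathbb{K})}\le\prod_{m=1}^n\|(\lambda_j^m)_j\|_{X(\mathbb{K})}$. **$(X;Y)$-summing polynomials.** $P\in\mathcal{P}(^nE;F)$ belongs to $\mathcal{P}_{X;Y}(^nE;F)$ if $(P(x_j))_j\in Y(F)$ whenever $(x_j)_j\in X(E)$; equivalently, $\widetilde P\colon X(E)\to Y(F)$, $\widetilde P((x_j)_j)=(P(x_j))_j$, is a well defined continuous $n$-homogeneous polynomial. In this case $\|P\|_{X;Y;1}:=\|\widetilde P\colon X(E)\to Y(F)\|$. **Polynomial Banach hyper-ideal.** Let $\mathcal{Q}$ be a subclass of the class of continuous homogeneous polynomials between Banach spaces and $\|\cdot\|_{\mathcal{Q}}\colon\mathcal{Q}\to\mathbb{R}$ such that, for all $n$ and Banach spaces $E,F$, the component $\mathcal{Q}(^nE;F):=\mathcal{P}(^nE;F)\cap\mathcal{Q}$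 is a linear subspace of $\mathcal{P}(^nE;F)$ containing the polynomials of finite type (linear combinations of $x\mapsto\varphi(x)^nb$, $\varphi\in E^*$, $b\in F$), on which $\|\cdot\|_{\mathcal{Q}}$ is a complete norm, and $\widehat I_n\colon\mathbb{K}\to\mathbb{K}$, $\widehat I_n(\lambda)=\lambda^n$, satisfies $\|\widehat I_n\|_{\mathcal{Q}}=1$. The pair $(\mathcal{Q},\|\cdot\|_{\mathcal{Q}})$ is a polynomial Banach hyper-ideal if for all $n,m\in\mathbb{N}$, Banach spaces $E,F,G,H$, $P\in\mathcal{Q}(^nE;F)$, $Q\in\mathcal{P}(^mG;E)$ and $t\in\mathcal{L}(F;H)$, one has $t\circ P\circ Q\in\mathcal{Q}(^{mn}G;H)$ and $\|t\circ P\circ Q\|_{\mathcal{Q}}\le\|t\|\cdot\|P\|_{\mathcal{Q}}\cdot\|Q\|^n$. *)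

theory Defs
  imports "HOL-Analysis.Analysis" "HOL-Algebra.Module"
begin

text \<open>
  The scalar field \<open>K\<close> is a type of class \<open>{real_normed_field, banach}\<close>; by the theorem of
  Gelfand and Mazur \<^typ>\<open>real\<close> and \<^typ>\<open>complex\<close> are, up to isometric isomorphism, its only instances.

  A sequence class is a rule on all Banach spaces, so Banach spaces have to be values and not
  types: they are carrier-based structures, namely modules over the ring of scalars with a norm.
  The fields \<^const>\<open>mult\<close> and \<^const>\<open>one\<close> that these records inherit from rings carry no meaning.
\<close>

definition scalar_ring :: "'k::{real_normed_field,banach} ring" where
  "scalar_ring = \<lparr>carrier = UNIV, monoid.mult = (*), one = 1, zero = 0, add = (+)\<rparr>"

record ('k, 'v) nspace = "('k, 'v) module" +
  vnorm :: "'v \<Rightarrow> real"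

text \<open>The locale \<^locale>\<open>Metric_space\<close> wants a distance that is symmetric and nonnegative also outside
  of the carrier.\<close>

definition vdist :: "('k, 'v, 'm) nspace_scheme \<Rightarrow> 'v \<Rightarrow> 'v \<Rightarrow> real" where
  "vdist E x y = (if x \<in> carrier E \<and> y \<in> carrier E then vnorm E (x \<ominus>\<^bsub>E\<^esub> y) else 0)"

abbreviation vtopology :: "('k, 'v, 'm) nspace_scheme \<Rightarrow> 'v topology" where
  "vtopology E \<equiv> Metric_space.mtopology (carrier E) (vdist E)"

locale normed_module =
  module "scalar_ring :: 'k::{real_normed_field,banach} ring" E
  for E :: "('k::{real_normed_field,banach}, 'v, 'm) nspace_scheme" (structure) +
  assumes vnorm_nonneg: "x \<in> carrier E \<Longrightarrow> 0 \<le> vnorm E x"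
    and vnorm_eq_0: "x \<in> carrier E \<Longrightarrow> vnorm E x = 0 \<longleftrightarrow> x = \<zero>\<^bsub>E\<^esub>"
    and vnorm_smult: "x \<in> carrier E \<Longrightarrow> vnorm E (a \<odot>\<^bsub>E\<^esub> x) = norm a * vnorm E x"
    and vnorm_triangle:
      "x \<in> carrier E \<Longrightarrow> y \<in> carrier E \<Longrightarrow> vnorm E (x \<oplus>\<^bsub>E\<^esub> y) \<le> vnorm E x + vnorm E y"

lemma (in normed_module) Metric_space_vdist: "Metric_space (carrier E) (vdist E)"
proof
  fix x y z
  show "0 \<le> vdist E x y"
    by (simp add: vdist_def vnorm_nonneg)
  have neg: "\<ominus>\<^bsub>E\<^esub> u = (- 1) \<odot>\<^bsub>E\<^esub> u" if u: "u \<in> carrier E" for u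
  proof (rule M.minus_equality[OF _ u])
    have "(- 1) \<odot>\<^bsub>E\<^esub> u \<oplus>\<^bsub>E\<^esub> u = ((- 1) \<odot>\<^bsub>E\<^esub> u) \<oplus>\<^bsub>E\<^esub> (1 \<odot>\<^bsub>E\<^esub> u)"
      using smult_one[OF u] by (simp add: scalar_ring_def)
    also have "\<dots> = ((- 1) + 1) \<odot>\<^bsub>E\<^esub> u"
      using smult_l_distr[of "- 1" 1 u] u by (simp add: scalar_ring_def)
    also have "\<dots> = \<zero>\<^bsub>E\<^esub>"
      using smult_l_null[OF u] by (simp add: scalar_ring_def)
    finally show "(- 1) \<odot>\<^bsub>E\<^esub> u \<oplus>\<^bsub>E\<^esub> u = \<zero>\<^bsub>E\<^esub>" .
    show "(- 1) \<odot>\<^bsub>E\<^esub> u \<in> carrier E"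
      using u by (simp add: scalar_ring_def)
  qed
  have "vnorm E (y \<ominus>\<^bsub>E\<^esub> x) = vnorm E (x \<ominus>\<^bsub>E\<^esub> y)" if "x \<in> carrier E" "y \<in> carrier E"
  proof -
    have "y \<ominus>\<^bsub>E\<^esub> x = \<ominus>\<^bsub>E\<^esub> (x \<ominus>\<^bsub>E\<^esub> y)"
      using that by (simp add: a_minus_def M.minus_add M.a_comm)
    then show ?thesis
      using that neg[of "x \<ominus>\<^bsub>E\<^esub> y"] vnorm_smult[of "x \<ominus>\<^bsub>E\<^esub> y" "- 1"] by simp
  qed
  then show "vdist E x y = vdist E y x"
    by (simp add: vdist_def)
  show "vdist E x y = 0 \<longleftrightarrow> x = y" if "x \<in> carrier E" "y \<in> carrier E"
    using that by (auto simp: vdist_def vnorm_eq_0 a_minus_def M.r_neg dest: M.minus_equality)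
  show "vdist E x z \<le> vdist E x y + vdist E y z"
    if "x \<in> carrier E" "y \<in> carrier E" "z \<in> carrier E"
  proof -
    have "x \<ominus>\<^bsub>E\<^esub> z = (x \<ominus>\<^bsub>E\<^esub> y) \<oplus>\<^bsub>E\<^esub> (y \<ominus>\<^bsub>E\<^esub> z)"
      using that by (simp add: a_minus_def M.a_assoc M.r_neg1)
    then show ?thesis
      using that vnorm_triangle[of "x \<ominus>\<^bsub>E\<^esub> y" "y \<ominus>\<^bsub>E\<^esub> z"] by (simp add: vdist_def)
  qed
qed

locale banach_module = normed_module E
  for E :: "('k::{real_normed_field,banach}, 'v, 'm) nspace_scheme" (structure) +
  assumes complete: "Metric_space.mcomplete (carrier E) (vdist E)"

text \<open>The relation \<open>E \<hookrightarrow> F\<close>, for Banach spaces \<open>E\<close> and \<open>F\<close>.\<close>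

definition norm_embedded :: "('k::{real_normed_field,banach}, 'v) nspace \<Rightarrow> ('k, 'v) nspace \<Rightarrow> bool" where
  "norm_embedded E F \<longleftrightarrow>
     carrier E \<subseteq> carrier F \<and>
     (\<forall>x\<in>carrier E. \<forall>y\<in>carrier E. x \<oplus>\<^bsub>E\<^esub> y = x \<oplus>\<^bsub>F\<^esub> y) \<and>
     (\<forall>a. \<forall>x\<in>carrier E. a \<odot>\<^bsub>E\<^esub> x = a \<odot>\<^bsub>F\<^esub> x) \<and>
     (\<forall>x\<in>carrier E. vnorm F x \<le> vnorm E x)"


section \<open>Linear operators and homogeneous polynomials\<close>

text \<open>Maps between spaces are extensional, i.e. \<^const>\<open>undefined\<close> outside the carrier of their domain,
  so that equality of maps is equality on the carrier.\<close>

definition sup_norm ::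
  "('k::{real_normed_field,banach}, 'v) nspace \<Rightarrow> ('k, 'w) nspace \<Rightarrow> ('v \<Rightarrow> 'w) \<Rightarrow> real" where
  "sup_norm E F f = (SUP x\<in>{x \<in> carrier E. vnorm E x \<le> 1}. vnorm F (f x))"

definition bounded_ops ::
  "('k::{real_normed_field,banach}, 'v) nspace \<Rightarrow> ('k, 'w) nspace \<Rightarrow> ('v \<Rightarrow> 'w) set" where
  "bounded_ops E F = {u \<in> carrier E \<rightarrow>\<^sub>E carrier F.
     (\<forall>x\<in>carrier E. \<forall>y\<in>carrier E. u (x \<oplus>\<^bsub>E\<^esub> y) = u x \<oplus>\<^bsub>F\<^esub> u y) \<and>
     (\<forall>a. \<forall>x\<in>carrier E. u (a \<odot>\<^bsub>E\<^esub> x) = a \<odot>\<^bsub>F\<^esub> u x) \<and>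
     (\<exists>C. \<forall>x\<in>carrier E. vnorm F (u x) \<le> C * vnorm E x)}"

text \<open>Elements of \<open>E\<^sup>n\<close> are functions in \<open>{..<n} \<rightarrow>\<^sub>E carrier E\<close>.\<close>

definition multilinear ::
  "nat \<Rightarrow> ('k::{real_normed_field,banach}, 'v) nspace \<Rightarrow> ('k, 'w) nspace \<Rightarrow> ((nat \<Rightarrow> 'v) \<Rightarrow> 'w) \<Rightarrow> bool" where
  "multilinear n E F A \<longleftrightarrow>
     A \<in> ({..<n} \<rightarrow>\<^sub>E carrier E) \<rightarrow> carrier F \<and>
     (\<forall>x\<in>{..<n} \<rightarrow>\<^sub>E carrier E. \<forall>i<n. \<forall>y\<in>carrier E.
        (\<forall>z\<in>carrier E. A (x(i := y \<oplus>\<^bsub>E\<^esub> z)) = A (x(i := y)) \<oplus>\<^bsub>F\<^esub> A (x(i := z))) \<and>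
        (\<forall>a. A (x(i := a \<odot>\<^bsub>E\<^esub> y)) = a \<odot>\<^bsub>F\<^esub> A (x(i := y))))"

definition homogeneous_poly ::
  "nat \<Rightarrow> ('k::{real_normed_field,banach}, 'v) nspace \<Rightarrow> ('k, 'w) nspace \<Rightarrow> ('v \<Rightarrow> 'w) \<Rightarrow> bool" where
  "homogeneous_poly n E F P \<longleftrightarrow>
     (\<exists>A. multilinear n E F A \<and> (\<forall>x\<in>carrier E. P x = A (\<lambda>i\<in>{..<n}. x)))"

definition cont_polys ::
  "nat \<Rightarrow> ('k::{real_normed_field,banach}, 'v) nspace \<Rightarrow> ('k, 'w) nspace \<Rightarrow> ('v \<Rightarrow> 'w) set" where
  "cont_polys n E F = {P \<in> carrier E \<rightarrow>\<^sub>E carrier F.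
     homogeneous_poly n E F P \<and> continuous_map (vtopology E) (vtopology F) P}"

definition poly_space ::
  "nat \<Rightarrow> ('k::{real_normed_field,banach}, 'v) nspace \<Rightarrow> ('k, 'w) nspace \<Rightarrow> ('k, 'v \<Rightarrow> 'w) nspace" where
  "poly_space n E F = \<lparr>
     carrier = cont_polys n E F,
     monoid.mult = undefined, one = undefined,
     zero = (\<lambda>x\<in>carrier E. \<zero>\<^bsub>F\<^esub>),
     add = (\<lambda>P Q. \<lambda>x\<in>carrier E. P x \<oplus>\<^bsub>F\<^esub> Q x),
     smult = (\<lambda>a P. \<lambda>x\<in>carrier E. a \<odot>\<^bsub>F\<^esub> P x),
     vnorm = sup_norm E F\<rparr>"


section \<open>The class of Banach spaces\<close>

text \<open>
  ``All Banach spaces'' are all Banach spaces carried by a subset of the type \<open>'k + 'a\<close>. The type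
  variable \<open>'a\<close> is arbitrary, so isometric copies of the members of any given family of Banach
  spaces are found in a suitable instance, while the summand \<open>'k\<close> accommodates \<open>K\<close> itself.
\<close>

type_synonym ('k, 'a) bspace = "('k, 'k + 'a) nspace"

definition scalar_space :: "('k::{real_normed_field,banach}, 'a) bspace" where
  "scalar_space = \<lparr>
     carrier = range Inl,
     monoid.mult = (\<lambda>x y. Inl (projl x * projl y)), one = Inl 1,
     zero = Inl 0,
     add = (\<lambda>x y. Inl (projl x + projl y)),
     smult = (\<lambda>a x. Inl (a * projl x)),
     vnorm = (\<lambda>x. norm (projl x))\<rparr>"

lemma banach_module_scalar_space:
  "banach_module (scalar_space :: ('k::{real_normed_field,banach}, 'a) bspace)"
proof -
  let ?K = "scalar_space :: ('k, 'a) bspace"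
  have cr: "cring (scalar_ring :: 'k ring)"
    by (rule cringI, rule abelian_groupI)
      (auto simp: scalar_ring_def algebra_simps intro!: comm_monoidI exI[of _ "- _"])
  have ag: "abelian_group ?K"
  proof (rule abelian_groupI)
    fix x assume "x \<in> carrier ?K"
    then show "\<exists>y\<in>carrier ?K. y \<oplus>\<^bsub>?K\<^esub> x = \<zero>\<^bsub>?K\<^esub>"
      by (intro bexI[of _ "Inl (- projl x)"]) (auto simp: scalar_space_def)
  qed (auto simp: scalar_space_def)
  have md: "module scalar_ring ?K"
    by (rule moduleI[OF cr ag]) (auto simp: scalar_space_def scalar_ring_def algebra_simps)
  have nm: "normed_module ?K"
    by (intro normed_module.intro normed_module_axioms.intro md)
      (auto simp: scalar_space_def norm_mult norm_triangle_ineq)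
  interpret K: abelian_group ?K by (rule ag)
  have minus: "Inl x \<ominus>\<^bsub>?K\<^esub> Inl y = Inl (x - y)" for x y
  proof -
    have "\<ominus>\<^bsub>?K\<^esub> Inl y = Inl (- y)"
      by (rule K.minus_equality) (auto simp: scalar_space_def)
    then show ?thesis by (simp add: a_minus_def) (simp add: scalar_space_def)
  qed
  have d: "vdist ?K (Inl x) (Inl y) = dist x y" for x y
    by (simp add: vdist_def minus) (simp add: scalar_space_def dist_norm)
  have car: "carrier ?K = range Inl" by (simp add: scalar_space_def)
  interpret M: Metric_space "carrier ?K" "vdist ?K"
    by (rule normed_module.Metric_space_vdist[OF nm])
  have "M.mcomplete"
    unfolding M.mcomplete_def
  proof (intro allI impI)
    fix s assume s: "M.MCauchy s"
    then have "range s \<subseteq> range Inl"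
      unfolding M.MCauchy_def by (simp add: car)
    then have "\<forall>j. \<exists>a. s j = Inl a"
      by blast
    then obtain a where a: "s = (\<lambda>j. Inl (a j))"
      by metis
    have "Cauchy a"
      using s unfolding M.MCauchy_def by (simp add: a d Cauchy_def)
    then obtain l where "a \<longlonglongrightarrow> l"
      using Cauchy_convergent convergent_def by blast
    then have "limitin M.mtopology s (Inl l) sequentially"
      unfolding M.limitin_metric tendsto_iff by (simp add: a d) (simp add: car)
    then show "\<exists>x. limitin M.mtopology s x sequentially" by blast
  qed
  then show ?thesis
    by (intro banach_module.intro banach_module_axioms.intro nm)
qed


section \<open>Sequence classes\<close>

definition null_seqs :: "('k::{real_normed_field,banach}, 'v) nspace \<Rightarrow> (nat \<Rightarrow> 'v) set" where
  "null_seqs E = {x. range x \<subseteq> carrier E \<and> (\<exists>N. \<forall>j\<ge>N. x j = \<zero>\<^bsub>E\<^esub>)}"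

definition bounded_seqs :: "('k::{real_normed_field,banach}, 'v) nspace \<Rightarrow> ('k, nat \<Rightarrow> 'v) nspace" where
  "bounded_seqs E = \<lparr>
     carrier = {x. range x \<subseteq> carrier E \<and> bdd_above (range (\<lambda>j. vnorm E (x j)))},
     monoid.mult = undefined, one = undefined,
     zero = (\<lambda>j. \<zero>\<^bsub>E\<^esub>),
     add = (\<lambda>x y j. x j \<oplus>\<^bsub>E\<^esub> y j),
     smult = (\<lambda>a x j. a \<odot>\<^bsub>E\<^esub> x j),
     vnorm = (\<lambda>x. SUP j. vnorm E (x j))\<rparr>"

type_synonym ('k, 'a) seq_rule = "('k, 'a) bspace \<Rightarrow> ('k, nat \<Rightarrow> 'k + 'a) nspace"

definition scalar_seq :: "(nat \<Rightarrow> 'k) \<Rightarrow> nat \<Rightarrow> 'k + 'a" where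
  "scalar_seq l = (\<lambda>j. Inl (l j))"

text \<open>That \<open>X(E)\<close> consists of \<open>E\<close>-valued sequences with coordinatewise operations is part of
  \<open>X(E) \<hookrightarrow> \<ell>\<^sub>\<infinity>(E)\<close>.\<close>

definition sequence_class :: "('k::{real_normed_field,banach}, 'a) seq_rule \<Rightarrow> bool" where
  "sequence_class X \<longleftrightarrow>
     (\<forall>E. banach_module E \<longrightarrow>
        banach_module (X E) \<and> null_seqs E \<subseteq> carrier (X E) \<and> norm_embedded (X E) (bounded_seqs E)) \<and>
     (\<forall>j. vnorm (X scalar_space) (scalar_seq (\<lambda>i. if i = j then 1 else 0)) = 1)"

definition induced_map ::
  "('k::{real_normed_field,banach}, 'a) seq_rule \<Rightarrow> ('k, 'a) bspace \<Rightarrow> ('k + 'a \<Rightarrow> 'k + 'a)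
     \<Rightarrow> (nat \<Rightarrow> 'k + 'a) \<Rightarrow> (nat \<Rightarrow> 'k + 'a)" where
  "induced_map X E f = (\<lambda>x\<in>carrier (X E). \<lambda>j. f (x j))"

definition linearly_stable :: "('k::{real_normed_field,banach}, 'a) seq_rule \<Rightarrow> bool" where
  "linearly_stable Y \<longleftrightarrow>
     (\<forall>E F. banach_module E \<longrightarrow> banach_module F \<longrightarrow> (\<forall>u\<in>bounded_ops E F.
        (\<forall>x\<in>carrier (Y E). (\<lambda>j. u (x j)) \<in> carrier (Y F)) \<and>
        induced_map Y E u \<in> bounded_ops (Y E) (Y F) \<and>
        sup_norm (Y E) (Y F) (induced_map Y E u) = sup_norm E F u))"

text \<open>Degrees of homogeneity range over \<open>n \<ge> 1\<close> throughout. Continuity of the induced polynomial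
  is the finiteness of the norm in the norm equality.\<close>

definition polynomially_stable :: "('k::{real_normed_field,banach}, 'a) seq_rule \<Rightarrow> bool" where
  "polynomially_stable X \<longleftrightarrow>
     (\<forall>n\<ge>1. \<forall>E F. banach_module E \<longrightarrow> banach_module F \<longrightarrow> (\<forall>P\<in>cont_polys n E F.
        (\<forall>x\<in>carrier (X E). (\<lambda>j. P (x j)) \<in> carrier (X F)) \<and>
        induced_map X E P \<in> cont_polys n (X E) (X F) \<and>
        sup_norm (X E) (X F) (induced_map X E P) = sup_norm E F P))"

text \<open>The relation \<open>X(K)\<^sup>n \<hookrightarrow> Y(K)\<close>.\<close>

definition power_embedded ::
  "nat \<Rightarrow> ('k::{real_normed_field,banach}, 'a) seq_rule \<Rightarrow> ('k, 'a) seq_rule \<Rightarrow> bool" where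
  "power_embedded n X Y \<longleftrightarrow>
     (\<forall>l :: nat \<Rightarrow> nat \<Rightarrow> 'k.
        (\<forall>m\<in>{1..n}. scalar_seq (l m) \<in> carrier (X scalar_space)) \<longrightarrow>
        scalar_seq (\<lambda>j. \<Prod>m=1..n. l m j) \<in> carrier (Y scalar_space) \<and>
        vnorm (Y scalar_space) (scalar_seq (\<lambda>j. \<Prod>m=1..n. l m j))
          \<le> (\<Prod>m=1..n. vnorm (X scalar_space) (scalar_seq (l m))))"


section \<open>Classes of polynomials and hyper-ideals\<close>

text \<open>A class of continuous homogeneous polynomials is given by the set \<open>Q E F\<close> of its members from
  \<open>E\<close> to \<open>F\<close>, of any degree.\<close>

type_synonym ('k, 'a) poly_class = "('k, 'a) bspace \<Rightarrow> ('k, 'a) bspace \<Rightarrow> ('k + 'a \<Rightarrow> 'k + 'a) set"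

type_synonym ('k, 'a) poly_class_norm = "('k, 'a) bspace \<Rightarrow> ('k, 'a) bspace \<Rightarrow> ('k + 'a \<Rightarrow> 'k + 'a) \<Rightarrow> real"

definition summing_polys ::
  "('k::{real_normed_field,banach}, 'a) seq_rule \<Rightarrow> ('k, 'a) seq_rule \<Rightarrow> ('k, 'a) poly_class" where
  "summing_polys X Y E F =
     {P \<in> (\<Union>n\<in>{1..}. cont_polys n E F). \<forall>x\<in>carrier (X E). (\<lambda>j. P (x j)) \<in> carrier (Y F)}"

definition summing_norm ::
  "('k::{real_normed_field,banach}, 'a) seq_rule \<Rightarrow> ('k, 'a) seq_rule \<Rightarrow> ('k, 'a) poly_class_norm" where
  "summing_norm X Y E F P = sup_norm (X E) (Y F) (induced_map X E P)"

definition component ::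
  "('k::{real_normed_field,banach}, 'a) poly_class \<Rightarrow> nat \<Rightarrow> ('k, 'a) bspace \<Rightarrow> ('k, 'a) bspace
     \<Rightarrow> ('k + 'a \<Rightarrow> 'k + 'a) set" where
  "component Q n E F = cont_polys n E F \<inter> Q E F"

definition finite_type_polys ::
  "nat \<Rightarrow> ('k::{real_normed_field,banach}, 'a) bspace \<Rightarrow> ('k, 'a) bspace \<Rightarrow> ('k + 'a \<Rightarrow> 'k + 'a) set" where
  "finite_type_polys n E F =
     {\<lambda>x\<in>carrier E. \<Oplus>\<^bsub>F\<^esub>i\<in>{..<m::nat}. c i \<odot>\<^bsub>F\<^esub> (projl (\<phi> i x) ^ n \<odot>\<^bsub>F\<^esub> b i) | m c \<phi> b.
        (\<forall>i<m. \<phi> i \<in> bounded_ops E (scalar_space :: ('k, 'a) bspace) \<and> b i \<in> carrier F)}"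

definition polynomial_banach_hyper_ideal ::
  "('k::{real_normed_field,banach}, 'a) poly_class \<Rightarrow> ('k, 'a) poly_class_norm \<Rightarrow> bool" where
  "polynomial_banach_hyper_ideal Q N \<longleftrightarrow>
     (\<forall>E F. banach_module E \<longrightarrow> banach_module F \<longrightarrow> Q E F \<subseteq> (\<Union>n\<in>{1..}. cont_polys n E F)) \<and>
     (\<forall>n\<ge>1. \<forall>E F. banach_module E \<longrightarrow> banach_module F \<longrightarrow>
        submodule (component Q n E F) scalar_ring (poly_space n E F) \<and>
        finite_type_polys n E F \<subseteq> component Q n E F \<and>
        banach_module (poly_space n E F \<lparr>carrier := component Q n E F, vnorm := N E F\<rparr>)) \<and>
     (\<forall>n\<ge>1. N scalar_space scalar_space (\<lambda>z\<in>carrier scalar_space. Inl (projl z ^ n)) = 1) \<and>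
     (\<forall>n\<ge>1. \<forall>m\<ge>1. \<forall>E F G H.
        banach_module E \<longrightarrow> banach_module F \<longrightarrow> banach_module G \<longrightarrow> banach_module H \<longrightarrow>
        (\<forall>P\<in>component Q n E F. \<forall>R\<in>cont_polys m G E. \<forall>t\<in>bounded_ops F H.
           compose (carrier G) t (compose (carrier G) P R) \<in> component Q (m * n) G H \<and>
           N G H (compose (carrier G) t (compose (carrier G) P R))
             \<le> sup_norm F H t * N E F P * sup_norm G E R ^ n))"

end

(* Polarization turns a continuous n-homogeneous polynomial P into a multilinear map that depends on
   P only through finitely many of its values. It therefore passes from P to the induced map
   X(E) -> Y(F), which is separately closed because convergence in X(E) and Y(F) is finer than
   coordinatewise convergence; the closed graph theorem and uniform boundedness, both consequences of
   Zabreiko's lemma, then bound the induced map, so that the norm is finite. For the same reason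
   pointwise limits of polynomials are polynomials. Stability of X under scalar lines K -> E shows
   that the sequence (x, 0, 0, ...) has norm at most that of x, whence the sup norm is at most the
   summing norm and the components are complete. A polynomial of finite type is a sum of compositions
   E -> K -> K -> F of a functional, a power and a line; the power is summing by compatibility of X
   and Y. *)
theory Submission
  imports Defs
begin

section \<open>Normed modules\<close>

text \<open>Membership in \<open>summing_polys\<close> only demands that the induced map lands in
  Y(F). Nothing in it says that this map is bounded, and the real supremum in
  \<open>sup_norm\<close> carries no information for an unbounded set, so every inequality for the
  summing norm rests on a result of automatic continuity. In degree above 1 the induced map is not
  linear, and the closed graph theorem applies only to its polarization, in one argument at a time.
  The bounds so obtained depend on the arguments held fixed; uniform boundedness over the unit ball
  removes this dependence. Both principles are merged into one statement about families of linear
  maps, so that a single induction on the number of free arguments suffices. The two stabilities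
  serve different ends of a composition: that of X carries the inner polynomial, that of Y the outer
  operator, and the bounds multiply along X(G) -> X(E) -> Y(F) -> Y(H).\<close>

lemma scalar_ring_simps [simp]:
  "carrier scalar_ring = UNIV" "a \<oplus>\<^bsub>scalar_ring\<^esub> b = a + b" "a \<otimes>\<^bsub>scalar_ring\<^esub> b = a * b"
  "\<zero>\<^bsub>scalar_ring\<^esub> = 0" "\<one>\<^bsub>scalar_ring\<^esub> = 1"
  by (simp_all add: scalar_ring_def)

context normed_module
begin

lemma scal_closed [simp, intro]: "x \<in> carrier E \<Longrightarrow> a \<odot> x \<in> carrier E"
  by simp

lemma scal_one [simp]: "x \<in> carrier E \<Longrightarrow> 1 \<odot> x = x"
  using smult_one by simp

lemma scal_zero [simp]: "x \<in> carrier E \<Longrightarrow> 0 \<odot> x = \<zero>"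
  using smult_l_null by simp

lemma scal_zero_right [simp]: "a \<odot> \<zero> = \<zero>"
  using smult_r_null by simp

lemma scal_add_left: "x \<in> carrier E \<Longrightarrow> (a + b) \<odot> x = a \<odot> x \<oplus> b \<odot> x"
  using smult_l_distr[of a b x] by simp

lemma scal_add_right:
  "x \<in> carrier E \<Longrightarrow> y \<in> carrier E \<Longrightarrow> a \<odot> (x \<oplus> y) = a \<odot> x \<oplus> a \<odot> y"
  using smult_r_distr[of a x y] by simp

lemma scal_scal: "x \<in> carrier E \<Longrightarrow> a \<odot> (b \<odot> x) = (a * b) \<odot> x"
  using smult_assoc1[of a b x] by simp

lemma uminus_eq_scal: "x \<in> carrier E \<Longrightarrow> \<ominus> x = (- 1) \<odot> x"
  using scal_add_left[of x "- 1" 1] by (intro M.minus_equality) auto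

lemma minus_eq_scal: "x \<in> carrier E \<Longrightarrow> y \<in> carrier E \<Longrightarrow> x \<ominus> y = x \<oplus> (- 1) \<odot> y"
  by (simp add: a_minus_def uminus_eq_scal)

lemma minus_self [simp]: "x \<in> carrier E \<Longrightarrow> x \<ominus> x = \<zero>"
  by (simp add: a_minus_def M.r_neg)

lemma minus_zero [simp]: "x \<in> carrier E \<Longrightarrow> x \<ominus> \<zero> = x"
  by (simp add: a_minus_def)

lemma minus_eq_0_iff: "x \<in> carrier E \<Longrightarrow> y \<in> carrier E \<Longrightarrow> x \<ominus> y = \<zero> \<longleftrightarrow> x = y"
  by (metis M.add.inv_closed M.minus_equality M.minus_minus a_minus_def minus_self)

lemma add_diff_add:
  assumes "x \<in> carrier E" "y \<in> carrier E" "z \<in> carrier E" "w \<in> carrier E"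
  shows "(x \<oplus> y) \<ominus> (z \<oplus> w) = (x \<ominus> z) \<oplus> (y \<ominus> w)"
  using assms by (simp add: a_minus_def M.minus_add M.a_ac)

lemma scal_diff:
  "x \<in> carrier E \<Longrightarrow> y \<in> carrier E \<Longrightarrow> a \<odot> (x \<ominus> y) = a \<odot> x \<ominus> a \<odot> y"
  by (simp add: minus_eq_scal scal_add_right scal_scal)

lemma diff_trans:
  "x \<in> carrier E \<Longrightarrow> y \<in> carrier E \<Longrightarrow> z \<in> carrier E \<Longrightarrow> x \<ominus> z = (x \<ominus> y) \<oplus> (y \<ominus> z)"
  by (simp add: a_minus_def M.a_assoc M.r_neg1)

lemma diff_add_cancel: "x \<in> carrier E \<Longrightarrow> y \<in> carrier E \<Longrightarrow> (x \<ominus> y) \<oplus> y = x"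
  by (simp add: a_minus_def M.a_assoc M.l_neg)

lemma add_diff_cancel_left: "x \<in> carrier E \<Longrightarrow> y \<in> carrier E \<Longrightarrow> (x \<oplus> y) \<ominus> x = y"
  by (simp add: a_minus_def M.a_comm[of x y] M.a_assoc M.r_neg)

lemma vnorm_zero [simp]: "vnorm E \<zero> = 0"
  by (simp add: vnorm_eq_0)

lemma vnorm_minus_commute:
  "x \<in> carrier E \<Longrightarrow> y \<in> carrier E \<Longrightarrow> vnorm E (x \<ominus> y) = vnorm E (y \<ominus> x)"
  using scal_diff[of y x "- 1"] vnorm_smult[of "y \<ominus> x" "- 1"]
  by (simp add: minus_eq_scal scal_scal M.a_comm)

lemma vnorm_triangle_diff:
  "x \<in> carrier E \<Longrightarrow> y \<in> carrier E \<Longrightarrow> z \<in> carrier E \<Longrightarrow>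
    vnorm E (x \<ominus> z) \<le> vnorm E (x \<ominus> y) + vnorm E (y \<ominus> z)"
  using diff_trans[of x y z] vnorm_triangle[of "x \<ominus> y" "y \<ominus> z"] by simp

lemma vnorm_diff_le:
  "x \<in> carrier E \<Longrightarrow> y \<in> carrier E \<Longrightarrow> vnorm E (x \<ominus> y) \<le> vnorm E x + vnorm E y"
  using vnorm_triangle_diff[of x \<zero> y] vnorm_minus_commute[of \<zero> y] by simp

lemma vnorm_le_add_diff:
  "x \<in> carrier E \<Longrightarrow> y \<in> carrier E \<Longrightarrow> vnorm E x \<le> vnorm E y + vnorm E (x \<ominus> y)"
  using vnorm_triangle[of "x \<ominus> y" y] by (simp add: diff_add_cancel)

lemma scal_finsum:
  "finite I \<Longrightarrow> f \<in> I \<rightarrow> carrier E \<Longrightarrow> a \<odot> (\<Oplus>i\<in>I. f i) = (\<Oplus>i\<in>I. a \<odot> f i)"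
  by (simp add: finsum_smult_ldistr)

lemma finsum_const_scal:
  "finite I \<Longrightarrow> x \<in> carrier E \<Longrightarrow> (\<Oplus>i\<in>I. x) = of_nat (card I) \<odot> x"
  by (induct set: finite) (auto simp: scal_add_left)

lemma finsum_scal_left:
  "finite I \<Longrightarrow> x \<in> carrier E \<Longrightarrow> (\<Oplus>i\<in>I. c i \<odot> x) = (\<Sum>i\<in>I. c i) \<odot> x"
  by (induct set: finite) (auto simp: scal_add_left)

lemma finsum_swap:
  assumes "finite I" "finite J" "\<And>i j. i \<in> I \<Longrightarrow> j \<in> J \<Longrightarrow> f i j \<in> carrier E"
  shows "(\<Oplus>i\<in>I. \<Oplus>j\<in>J. f i j) = (\<Oplus>j\<in>J. \<Oplus>i\<in>I. f i j)"
  using assms(1,3)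
proof (induct set: finite)
  case (insert i I)
  have "(\<Oplus>k\<in>insert i I. \<Oplus>j\<in>J. f k j) = (\<Oplus>j\<in>J. f i j) \<oplus> (\<Oplus>j\<in>J. \<Oplus>k\<in>I. f k j)"
    using insert by simp
  also have "\<dots> = (\<Oplus>j\<in>J. f i j \<oplus> (\<Oplus>k\<in>I. f k j))"
    using insert by (subst M.finsum_addf) auto
  also have "\<dots> = (\<Oplus>j\<in>J. \<Oplus>k\<in>insert i I. f k j)"
    using insert by (intro M.finsum_cong') auto
  finally show ?case .
qed simp

lemma vnorm_finsum_le:
  "finite I \<Longrightarrow> f \<in> I \<rightarrow> carrier E \<Longrightarrow> vnorm E (\<Oplus>i\<in>I. f i) \<le> (\<Sum>i\<in>I. vnorm E (f i))"
proof (induct set: finite)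
  case (insert i I)
  then show ?case
    using vnorm_triangle[of "f i" "\<Oplus>i\<in>I. f i"] by (simp add: Pi_def)
qed simp

end

section \<open>Norm convergence, completeness and sequential continuity\<close>

definition converges_to :: "('k::{real_normed_field,banach}, 'v, 'm) nspace_scheme \<Rightarrow> (nat \<Rightarrow> 'v) \<Rightarrow> 'v \<Rightarrow> bool" where
  "converges_to E s l \<longleftrightarrow>
     range s \<subseteq> carrier E \<and> l \<in> carrier E \<and> (\<lambda>k. vnorm E (s k \<ominus>\<^bsub>E\<^esub> l)) \<longlonglongrightarrow> 0"

lemma converges_to_carrier:
  assumes "converges_to E s l"
  shows "s k \<in> carrier E" and "l \<in> carrier E"
  using assms by (auto simp: converges_to_def)

context normed_module
begin

lemma converges_toI:
  assumes "\<And>k. s k \<in> carrier E" "l \<in> carrier E"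
    and "\<And>k. vnorm E (s k \<ominus> l) \<le> b k" "b \<longlonglongrightarrow> 0"
  shows "converges_to E s l"
  unfolding converges_to_def
  using assms by (auto intro!: tendsto_sandwich[OF _ _ tendsto_const \<open>b \<longlonglongrightarrow> 0\<close>] vnorm_nonneg always_eventually)

lemma converges_to_const: "x \<in> carrier E \<Longrightarrow> converges_to E (\<lambda>k. x) x"
  by (auto simp: converges_to_def)

lemma converges_to_add:
  assumes "converges_to E s l" "converges_to E t m"
  shows "converges_to E (\<lambda>k. s k \<oplus> t k) (l \<oplus> m)"
proof (rule converges_toI)
  note c = converges_to_carrier[OF assms(1)] converges_to_carrier[OF assms(2)]
  show "s k \<oplus> t k \<in> carrier E" "l \<oplus> m \<in> carrier E" for k
    using c by auto
  show "vnorm E ((s k \<oplus> t k) \<ominus> (l \<oplus> m)) \<le> vnorm E (s k \<ominus> l) + vnorm E (t k \<ominus> m)" for k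
    using c by (simp add: add_diff_add vnorm_triangle)
  show "(\<lambda>k. vnorm E (s k \<ominus> l) + vnorm E (t k \<ominus> m)) \<longlonglongrightarrow> 0"
    using assms by (auto simp: converges_to_def intro: tendsto_add_zero)
qed

lemma converges_to_scal:
  assumes "converges_to E s l"
  shows "converges_to E (\<lambda>k. a \<odot> s k) (a \<odot> l)"
proof (rule converges_toI)
  note c = converges_to_carrier[OF assms]
  show "a \<odot> s k \<in> carrier E" "a \<odot> l \<in> carrier E" for k
    using c by auto
  show "vnorm E (a \<odot> s k \<ominus> a \<odot> l) \<le> norm a * vnorm E (s k \<ominus> l)" for k
    using c by (simp add: vnorm_smult flip: scal_diff)
  show "(\<lambda>k. norm a * vnorm E (s k \<ominus> l)) \<longlonglongrightarrow> 0"
    using assms by (auto simp: converges_to_def intro: tendsto_mult_right_zero)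
qed

lemma converges_to_diff:
  assumes "converges_to E s l" "converges_to E t m"
  shows "converges_to E (\<lambda>k. s k \<ominus> t k) (l \<ominus> m)"
  using converges_to_add[OF assms(1) converges_to_scal[OF assms(2), of "- 1"]] assms
  by (simp add: minus_eq_scal converges_to_carrier[OF assms(1)] converges_to_carrier[OF assms(2)])

lemma converges_to_finsum:
  "finite I \<Longrightarrow> (\<And>i. i \<in> I \<Longrightarrow> converges_to E (s i) (l i)) \<Longrightarrow>
    converges_to E (\<lambda>k. \<Oplus>i\<in>I. s i k) (\<Oplus>i\<in>I. l i)"
proof (induct set: finite)
  case empty
  show ?case by (simp add: converges_to_const)
next
  case (insert i I)
  have c: "s j k \<in> carrier E" "l j \<in> carrier E" if "j \<in> insert i I" for j k
    using converges_to_carrier[OF insert(4)[OF that]] by blast+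
  have "converges_to E (\<lambda>k. s i k \<oplus> (\<Oplus>j\<in>I. s j k)) (l i \<oplus> (\<Oplus>j\<in>I. l j))"
    by (rule converges_to_add[OF insert(4) insert(3)]) (use insert(4) in blast)+
  moreover have "(\<Oplus>j\<in>insert i I. s j k) = s i k \<oplus> (\<Oplus>j\<in>I. s j k)" for k
    using insert(1,2) c by (intro M.finsum_insert) auto
  moreover have "(\<Oplus>j\<in>insert i I. l j) = l i \<oplus> (\<Oplus>j\<in>I. l j)"
    using insert(1,2) c by (intro M.finsum_insert) auto
  ultimately show ?case
    by (simp only:)
qed

lemma vnorm_converges:
  assumes "converges_to E s l"
  shows "(\<lambda>k. vnorm E (s k)) \<longlonglongrightarrow> vnorm E l"
proof -
  note c = converges_to_carrier[OF assms]
  have "norm (vnorm E (s k) - vnorm E l) \<le> vnorm E (s k \<ominus> l)" for k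
    using vnorm_le_add_diff[of "s k" l] vnorm_le_add_diff[of l "s k"] c
    by (auto simp: vnorm_minus_commute[of l] abs_le_iff)
  then have "(\<lambda>k. vnorm E (s k) - vnorm E l) \<longlonglongrightarrow> 0"
    by (rule Lim_null_comparison[OF always_eventually[OF allI]])
      (use assms in \<open>simp add: converges_to_def\<close>)
  then show ?thesis
    by (simp add: LIM_zero_iff)
qed

lemma converges_to_unique:
  assumes "converges_to E s l" "converges_to E s m"
  shows "l = m"
proof -
  note c = converges_to_carrier[OF assms(1)] converges_to_carrier[OF assms(2)]
  have "(\<lambda>k. vnorm E (s k \<ominus> s k)) \<longlonglongrightarrow> vnorm E (l \<ominus> m)"
    by (rule vnorm_converges[OF converges_to_diff[OF assms]])
  then have "vnorm E (l \<ominus> m) = 0"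
    using c by (simp add: LIMSEQ_const_iff)
  then show ?thesis
    using c by (simp add: vnorm_eq_0 minus_eq_0_iff)
qed

lemma converges_to_bound:
  assumes "converges_to E s l" "\<And>k. k \<ge> N \<Longrightarrow> vnorm E (s k) \<le> B"
  shows "vnorm E l \<le> B"
  using assms(2) by (intro LIMSEQ_le_const2[OF vnorm_converges[OF assms(1)]]) blast

text \<open>\<open>limitin\<close> constrains only a tail of the sequence,
  \<open>converges_to\<close> every term; for sequences in the carrier, where \<open>vdist\<close>
  is the norm of the difference, they agree.\<close>

lemma limitin_iff_converges_to:
  assumes "range s \<subseteq> carrier E"
  shows "limitin (vtopology E) s l sequentially \<longleftrightarrow> converges_to E s l"
proof -
  interpret MS: Metric_space "carrier E" "vdist E"
    by (rule Metric_space_vdist)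
  have s: "s k \<in> carrier E" for k
    using assms by auto
  then have "l \<in> carrier E \<Longrightarrow> vdist E (s k) l = vnorm E (s k \<ominus> l)" for k
    by (simp add: vdist_def)
  then show ?thesis
    unfolding MS.limitin_metric_dist_null converges_to_def
    using assms s by (intro iffI) simp_all
qed

lemma MCauchy_iff:
  "Metric_space.MCauchy (carrier E) (vdist E) s \<longleftrightarrow> range s \<subseteq> carrier E \<and>
     (\<forall>\<epsilon>>0. \<exists>N. \<forall>k\<ge>N. \<forall>l\<ge>N. vnorm E (s k \<ominus> s l) < \<epsilon>)"
proof -
  interpret MS: Metric_space "carrier E" "vdist E"
    by (rule Metric_space_vdist)
  have "range s \<subseteq> carrier E \<Longrightarrow> vdist E (s k) (s l) = vnorm E (s k \<ominus> s l)" for k l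
    by (auto simp: vdist_def)
  then show ?thesis
    unfolding MS.MCauchy_def by (intro conj_cong refl all_cong) auto
qed

lemma banach_moduleI:
  assumes "\<And>s :: nat \<Rightarrow> 'v. range s \<subseteq> carrier E \<Longrightarrow> (\<And>\<epsilon>. \<epsilon> > 0 \<Longrightarrow> \<exists>N. \<forall>k\<ge>N. \<forall>l\<ge>N. vnorm E (s k \<ominus> s l) < \<epsilon>) \<Longrightarrow>
    \<exists>l. converges_to E s l"
  shows "banach_module E"
proof
  interpret MS: Metric_space "carrier E" "vdist E"
    by (rule Metric_space_vdist)
  show MS.mcomplete
    unfolding MS.mcomplete_def MCauchy_iff
  proof (intro allI impI)
    fix s :: "nat \<Rightarrow> 'v" assume s: "range s \<subseteq> carrier E \<and>
      (\<forall>\<epsilon>>0. \<exists>N. \<forall>k\<ge>N. \<forall>l\<ge>N. vnorm E (s k \<ominus> s l) < \<epsilon>)"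
    then have "range s \<subseteq> carrier E" "\<And>\<epsilon>. \<epsilon> > 0 \<Longrightarrow> \<exists>N. \<forall>k\<ge>N. \<forall>l\<ge>N. vnorm E (s k \<ominus> s l) < \<epsilon>"
      by simp_all
    from assms[OF this] obtain l where "converges_to E s l" ..
    then show "\<exists>l. limitin MS.mtopology s l sequentially"
      using s limitin_iff_converges_to by blast
  qed
qed

end

lemma (in banach_module) Cauchy_converges:
  assumes "range s \<subseteq> carrier E"
    and "\<And>\<epsilon>. \<epsilon> > 0 \<Longrightarrow> \<exists>N. \<forall>k\<ge>N. \<forall>l\<ge>N. vnorm E (s k \<ominus> s l) < \<epsilon>"
  obtains l where "converges_to E s l"
proof -
  interpret MS: Metric_space "carrier E" "vdist E"
    by (rule Metric_space_vdist)
  have "MS.MCauchy s"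
    using assms by (simp add: MCauchy_iff)
  then show ?thesis
    using complete limitin_iff_converges_to[OF assms(1)] that unfolding MS.mcomplete_def by blast
qed

text \<open>The form in which completeness of the target enters the closed graph theorem: an
  absolutely convergent image series has a limit, which the graph can then identify.\<close>

lemma (in banach_module) summable_converges:
  assumes "\<And>k. s k \<in> carrier E" "summable (\<lambda>k. vnorm E (s k))"
  obtains l where "converges_to E (\<lambda>K. \<Oplus>k\<in>{..<K}. s k) l"
proof (rule Cauchy_converges)
  have *: "vnorm E ((\<Oplus>k\<in>{..<L}. s k) \<ominus> (\<Oplus>k\<in>{..<K}. s k)) \<le> (\<Sum>k\<in>{K..<L}. vnorm E (s k))" if "K \<le> L" for K L
  proof -
    have "{..<L} = {..<K} \<union> {K..<L}"
      using that by auto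
    then have "(\<Oplus>k\<in>{..<L}. s k) = (\<Oplus>k\<in>{..<K}. s k) \<oplus> (\<Oplus>k\<in>{K..<L}. s k)"
      using assms by (simp add: M.finsum_Un_disjoint Pi_def ivl_disj_int)
    then have "(\<Oplus>k\<in>{..<L}. s k) \<ominus> (\<Oplus>k\<in>{..<K}. s k) = (\<Oplus>k\<in>{K..<L}. s k)"
      using assms by (simp add: add_diff_cancel_left Pi_def)
    then show ?thesis
      using assms by (simp add: vnorm_finsum_le Pi_def)
  qed
  fix \<epsilon> :: real assume "\<epsilon> > 0"
  then obtain N where N: "\<And>m n. m \<ge> N \<Longrightarrow> norm (\<Sum>k\<in>{m..<n}. vnorm E (s k)) < \<epsilon>"
    using assms(2) unfolding summable_Cauchy by blast
  have "vnorm E ((\<Oplus>k\<in>{..<L}. s k) \<ominus> (\<Oplus>k\<in>{..<K}. s k)) < \<epsilon>" if "K \<ge> N" "K \<le> L" for K L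
    using *[OF that(2)] N[OF that(1), of L] by simp
  moreover have "(\<Oplus>k\<in>{..<K}. s k) \<in> carrier E" for K
    using assms by simp
  ultimately have "vnorm E ((\<Oplus>k\<in>{..<K}. s k) \<ominus> (\<Oplus>k\<in>{..<L}. s k)) < \<epsilon>" if "K \<ge> N" "L \<ge> N" for K L
    using that vnorm_minus_commute nle_le[of K L] by metis
  then show "\<exists>N. \<forall>K\<ge>N. \<forall>L\<ge>N. vnorm E ((\<Oplus>k\<in>{..<K}. s k) \<ominus> (\<Oplus>k\<in>{..<L}. s k)) < \<epsilon>"
    by blast
qed (use assms that in auto)

text \<open>Turns the topological continuity in \<open>cont_polys\<close> into a sequential form,
  which sums, compositions and the finite sums of the polarization formula preserve at once.\<close>

lemma continuous_map_iff_converges_to: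
  assumes "normed_module E" "normed_module F"
  shows "continuous_map (vtopology E) (vtopology F) f \<longleftrightarrow>
    (\<forall>x\<in>carrier E. f x \<in> carrier F) \<and>
    (\<forall>s l. converges_to E s l \<longrightarrow> converges_to F (\<lambda>k. f (s k)) (f l))" (is "?L \<longleftrightarrow> ?R")
proof -
  interpret E: normed_module E by fact
  interpret F: normed_module F by fact
  interpret ME: Metric_space "carrier E" "vdist E"
    by (rule E.Metric_space_vdist)
  interpret MF: Metric_space "carrier F" "vdist F"
    by (rule F.Metric_space_vdist)
  show ?thesis
  proof
    assume L: ?L
    then have f: "\<forall>x\<in>carrier E. f x \<in> carrier F"
      by (auto simp: continuous_map_def)
    moreover have "converges_to F (\<lambda>k. f (s k)) (f l)" if s: "converges_to E s l" for s l
    proof -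
      have r: "range s \<subseteq> carrier E" "range (f \<circ> s) \<subseteq> carrier F"
        using converges_to_carrier[OF s] f by auto
      then have "limitin (vtopology F) (f \<circ> s) (f l) sequentially"
        using s E.limitin_iff_converges_to L by (intro continuous_map_limit[OF L]) blast
      then show ?thesis
        using F.limitin_iff_converges_to[OF r(2)] by (simp add: o_def)
    qed
    ultimately show ?R by blast
  next
    assume R: ?R
    \<comment> \<open>Otherwise points at distance below \<open>1 / (k + 1)\<close> from
      \<open>a\<close>, with images at distance at least \<open>\<epsilon>\<close> from
      \<open>f a\<close>, form a sequence that contradicts sequential continuity.\<close>
    have *: "\<exists>\<delta>>0. \<forall>x. x \<in> carrier E \<and> vdist E a x < \<delta> \<longrightarrow> vdist F (f a) (f x) < \<epsilon>"
      if a: "a \<in> carrier E" and \<epsilon>: "\<epsilon> > 0" for a \<epsilon>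
    proof (rule ccontr)
      assume "\<not> ?thesis"
      then have "\<exists>x. x \<in> carrier E \<and> vdist E a x < 1 / real (Suc k) \<and> \<not> vdist F (f a) (f x) < \<epsilon>" for k
        by (meson zero_less_divide_1_iff of_nat_0_less_iff zero_less_Suc)
      then obtain s where s: "\<And>k. s k \<in> carrier E" "\<And>k. vdist E a (s k) < 1 / real (Suc k)"
          "\<And>k. \<not> vdist F (f a) (f (s k)) < \<epsilon>"
        by metis
      have "converges_to E s a"
      proof (rule E.converges_toI)
        show "vnorm E (s k \<ominus>\<^bsub>E\<^esub> a) \<le> 1 / real (Suc k)" for k
          using s(1,2)[of k] a by (simp add: vdist_def E.vnorm_minus_commute)
        show "(\<lambda>k. 1 / real (Suc k)) \<longlonglongrightarrow> 0"
          using LIMSEQ_inverse_real_of_nat by (simp add: inverse_eq_divide)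
      qed (use s a in auto)
      then have "converges_to F (\<lambda>k. f (s k)) (f a)"
        using R by blast
      then have "(\<lambda>k. vnorm F (f (s k) \<ominus>\<^bsub>F\<^esub> f a)) \<longlonglongrightarrow> 0"
        by (simp add: converges_to_def)
      from order_tendstoD(2)[OF this \<epsilon>] obtain k where "vnorm F (f (s k) \<ominus>\<^bsub>F\<^esub> f a) < \<epsilon>"
        using eventually_happens'[OF sequentially_bot] by blast
      then show False
        using s(3)[of k] s(1)[of k] a R by (auto simp: vdist_def F.vnorm_minus_commute)
    qed
    then show ?L
      unfolding ME.metric_continuous_map[OF MF.Metric_space_axioms]
    proof (intro conjI ballI allI impI)
      show "f ` carrier E \<subseteq> carrier F"
        using R by auto
    qed (rule *)
  qed
qed

section \<open>Uniform boundedness and closed graphs\<close>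

lemma (in normed_module) diff_diff_diff:
  assumes "x \<in> carrier E" "y \<in> carrier E" "z \<in> carrier E" "w \<in> carrier E"
  shows "(x \<ominus> y) \<ominus> (z \<ominus> w) = (x \<ominus> z) \<ominus> (y \<ominus> w)"
  using assms by (simp add: minus_eq_scal scal_add_right scal_scal M.a_ac)

text \<open>A countably subadditive seminorm on a Banach space is bounded. By Baire's theorem some
  sublevel set is dense in a ball; differences move the ball to the origin, scaling extends the
  density to all vectors, and a series of successive approximations replaces the approximate bound
  by an exact one.\<close>

lemma (in banach_module) Zabreiko:
  fixes p :: "'v \<Rightarrow> real"
  assumes scal: "\<And>a x. x \<in> carrier E \<Longrightarrow> p (a \<odot> x) = norm a * p x"
    and subadd: "\<And>x y. x \<in> carrier E \<Longrightarrow> y \<in> carrier E \<Longrightarrow> p (x \<oplus> y) \<le> p x + p y"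
    and countable_subadd: "\<And>s x. (\<And>k. s k \<in> carrier E) \<Longrightarrow> summable (\<lambda>k. p (s k)) \<Longrightarrow>
      converges_to E (\<lambda>K. \<Oplus>k\<in>{..<K}. s k) x \<Longrightarrow> p x \<le> (\<Sum>k. p (s k))"
  obtains C where "\<And>x. x \<in> carrier E \<Longrightarrow> p x \<le> C * vnorm E x"
proof -
  interpret MS: Metric_space "carrier E" "vdist E"
    by (rule Metric_space_vdist)
  have p_zero: "p \<zero> = 0"
    using scal[of \<zero> 0] by simp
  have p_minus: "p (x \<ominus> y) \<le> p x + p y" if "x \<in> carrier E" "y \<in> carrier E" for x y
    using that subadd[of x "(- 1) \<odot> y"] scal[of y "- 1"] by (simp add: minus_eq_scal)
  have nonneg: "0 \<le> p x" if "x \<in> carrier E" for x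
    using p_minus[OF that that] p_zero that by simp
  define A where "A k = {x \<in> carrier E. p x \<le> real k}" for k :: nat
  have sub: "A k \<subseteq> Abstract_Topology.closure_of MS.mtopology (A k)" for k
    by (rule closure_of_subset) (auto simp: A_def)
  have "\<Union>(range (\<lambda>k. Abstract_Topology.closure_of MS.mtopology (A k))) = carrier E"
  proof
    show "\<Union>(range (\<lambda>k. Abstract_Topology.closure_of MS.mtopology (A k))) \<subseteq> carrier E"
      using closure_of_subset_topspace[of MS.mtopology] by auto
    show "carrier E \<subseteq> \<Union>(range (\<lambda>k. Abstract_Topology.closure_of MS.mtopology (A k)))"
    proof
      fix x assume "x \<in> carrier E"
      then have "x \<in> A (nat \<lceil>p x\<rceil>)"
        using of_nat_ceiling[of "p x"] by (simp add: A_def)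
      then show "x \<in> \<Union>(range (\<lambda>k. Abstract_Topology.closure_of MS.mtopology (A k)))"
        using sub by blast
    qed
  qed
  then have nonempty: "MS.mtopology interior_of \<Union>(range (\<lambda>k. Abstract_Topology.closure_of MS.mtopology (A k))) \<noteq> {}"
    using interior_of_topspace[of MS.mtopology] M.zero_closed by auto
  have "\<exists>k. MS.mtopology interior_of (Abstract_Topology.closure_of MS.mtopology (A k)) \<noteq> {}"
  proof (rule ccontr)
    assume "\<not> ?thesis"
    then have "MS.mtopology interior_of \<Union>(range (\<lambda>k. Abstract_Topology.closure_of MS.mtopology (A k))) = {}"
      by (intro MS.metric_Baire_category_alt[OF complete]) auto
    with nonempty show False by simp
  qed
  then obtain k where "MS.mtopology interior_of (Abstract_Topology.closure_of MS.mtopology (A k)) \<noteq> {}" ..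
  then obtain a r where a: "a \<in> carrier E" and r: "r > 0" and
    ball: "MS.mball a r \<subseteq> Abstract_Topology.closure_of MS.mtopology (A k)"
    unfolding MS.metric_interior_of by blast
  have approx1: "\<exists>y\<in>carrier E. p y \<le> real k \<and> vnorm E (z \<ominus> y) < \<epsilon>"
    if "z \<in> carrier E" "vnorm E (z \<ominus> a) < r" "\<epsilon> > 0" for z \<epsilon>
  proof -
    have "z \<in> MS.mball a r"
      using that a by (simp add: vdist_def vnorm_minus_commute)
    then obtain y where "y \<in> A k" "y \<in> MS.mball z \<epsilon>"
      using ball \<open>\<epsilon> > 0\<close> unfolding MS.metric_closure_of by blast
    then show ?thesis
      using that by (auto simp: A_def vdist_def)
  qed
  \<comment> \<open>\<open>z\<close> is the difference of the two points \<open>a \<oplus> z\<close>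
    and \<open>a\<close> of the ball, so the difference of their approximants approximates
    \<open>z\<close>; the two bounds \<open>k\<close> add up to \<open>2 * k\<close>.\<close>
  have approx2: "\<exists>y\<in>carrier E. p y \<le> 2 * real k \<and> vnorm E (z \<ominus> y) < \<epsilon>"
    if z: "z \<in> carrier E" "vnorm E z < r" "\<epsilon> > 0" for z \<epsilon>
  proof -
    have "vnorm E ((a \<oplus> z) \<ominus> a) < r"
      using a z by (simp add: add_diff_cancel_left)
    then obtain y where y: "y \<in> carrier E" "p y \<le> real k" "vnorm E ((a \<oplus> z) \<ominus> y) < \<epsilon> / 2"
      using approx1[of "a \<oplus> z" "\<epsilon> / 2"] a z by auto
    obtain w where w: "w \<in> carrier E" "p w \<le> real k" "vnorm E (a \<ominus> w) < \<epsilon> / 2"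
      using approx1[of a "\<epsilon> / 2"] a z r by auto
    have "z \<ominus> (y \<ominus> w) = ((a \<oplus> z) \<ominus> y) \<ominus> (a \<ominus> w)"
      using a z y w diff_diff_diff[of "a \<oplus> z" a y w] by (simp add: add_diff_cancel_left)
    then have "vnorm E (z \<ominus> (y \<ominus> w)) < \<epsilon>"
      using a z y w vnorm_diff_le[of "(a \<oplus> z) \<ominus> y" "a \<ominus> w"] by simp
    then show ?thesis
      using y w p_minus[of y w] by (intro bexI[of _ "y \<ominus> w"]) auto
  qed
  have approx3: "\<exists>y\<in>carrier E. p y \<le> 4 * real k / r * vnorm E z \<and> vnorm E (z \<ominus> y) < \<epsilon>"
    if z: "z \<in> carrier E" "\<epsilon> > 0" for z \<epsilon>
  proof (cases "vnorm E z = 0")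
    case True
    then show ?thesis
      using z p_zero by (intro bexI[of _ \<zero>]) auto
  next
    case False
    then have pos: "vnorm E z > 0"
      using vnorm_nonneg[OF z(1)] by simp
    \<comment> \<open>Rescales \<open>z\<close> to norm \<open>r / 2\<close>, inside the ball;
      undoing the scaling turns the bound \<open>2 * k\<close> into \<open>4 * k / r\<close> times
      the norm of \<open>z\<close>.\<close>
    define c where "c = r / (2 * vnorm E z)"
    have c: "c > 0"
      using pos r by (simp add: c_def)
    have "vnorm E (of_real c \<odot> z) < r"
      using z c pos r by (simp add: vnorm_smult) (simp add: c_def)
    then obtain y where y: "y \<in> carrier E" "p y \<le> 2 * real k" "vnorm E (of_real c \<odot> z \<ominus> y) < c * \<epsilon>"
      using approx2[of "of_real c \<odot> z" "c * \<epsilon>"] z c by auto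
    have "of_real (1 / c) \<odot> (of_real c \<odot> z \<ominus> y) = z \<ominus> of_real (1 / c) \<odot> y"
      using z y c by (simp add: scal_diff scal_scal flip: of_real_mult)
    then have "vnorm E (z \<ominus> of_real (1 / c) \<odot> y) = \<bar>1 / c\<bar> * vnorm E (of_real c \<odot> z \<ominus> y)"
      using z y vnorm_smult[of "of_real c \<odot> z \<ominus> y" "of_real (1 / c)"]
      by (simp del: of_real_divide abs_divide)
    also have "\<dots> < \<epsilon>"
      using y c by (simp add: field_simps)
    finally have "vnorm E (z \<ominus> of_real (1 / c) \<odot> y) < \<epsilon>" .
    moreover have "p (of_real (1 / c) \<odot> y) \<le> 4 * real k / r * vnorm E z"
    proof -
      have "p (of_real (1 / c) \<odot> y) = p y / c"
        using y(1) c scal[of y "of_real (1 / c)"] by (simp add: norm_divide)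
      also have "\<dots> \<le> 2 * real k / c"
        using y(2) c by (simp add: divide_right_mono)
      also have "\<dots> = 4 * real k / r * vnorm E z"
        by (simp add: c_def)
      finally show ?thesis .
    qed
    ultimately show ?thesis
      using y by blast
  qed
  define M where "M = 4 * real k / r"
  have "M \<ge> 0"
    using r by (simp add: M_def)
  have "\<exists>y. z \<in> carrier E \<longrightarrow> \<epsilon> > 0 \<longrightarrow> y \<in> carrier E \<and> p y \<le> M * vnorm E z \<and> vnorm E (z \<ominus> y) < \<epsilon>"
    for z \<epsilon>
    using approx3[of z \<epsilon>] unfolding M_def by blast
  then obtain Y where Y: "\<And>z \<epsilon>. z \<in> carrier E \<Longrightarrow> \<epsilon> > 0 \<Longrightarrow>
      Y z \<epsilon> \<in> carrier E \<and> p (Y z \<epsilon>) \<le> M * vnorm E z \<and> vnorm E (z \<ominus> Y z \<epsilon>) < \<epsilon>"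
    by metis
  have "p x \<le> (M * 2) * vnorm E x" if x: "x \<in> carrier E" for x
  proof (cases "vnorm E x = 0")
    case True
    then show ?thesis
      using x p_zero by (simp add: vnorm_eq_0)
  next
    case False
    then have pos: "vnorm E x > 0"
      using vnorm_nonneg[OF x] by simp
    \<comment> \<open>\<open>z j\<close> is what remains of \<open>x\<close> after \<open>j\<close>
      approximations. Since the tolerance is halved each time, the bounds on the corrections
      \<open>s j\<close> form a geometric series of ratio 1/2, whose sum is the origin of the final
      factor 2.\<close>
    define z where "z = rec_nat x (\<lambda>j u. u \<ominus> Y u (vnorm E x * (1 / 2) ^ Suc j))"
    define s where "s j = Y (z j) (vnorm E x * (1 / 2) ^ Suc j)" for j
    have z0: "z 0 = x" and zSuc: "z (Suc j) = z j \<ominus> s j" for j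
      by (simp_all add: z_def s_def)
    have z: "z j \<in> carrier E \<and> vnorm E (z j) \<le> vnorm E x * (1 / 2) ^ j" for j
    proof (induct j)
      case 0
      then show ?case using x by (simp add: z0)
    next
      case (Suc j)
      then show ?case
        using Y[of "z j" "vnorm E x * (1 / 2) ^ Suc j"] pos unfolding zSuc s_def by auto
    qed
    have s: "s j \<in> carrier E" "p (s j) \<le> M * vnorm E x * (1 / 2) ^ j" for j
    proof -
      have *: "s j \<in> carrier E \<and> p (s j) \<le> M * vnorm E (z j)"
        using Y[of "z j" "vnorm E x * (1 / 2) ^ Suc j"] z[of j] pos unfolding s_def by auto
      then show "s j \<in> carrier E" by blast
      have "M * vnorm E (z j) \<le> M * (vnorm E x * (1 / 2) ^ j)"
        using z[of j] \<open>M \<ge> 0\<close> by (intro mult_left_mono) auto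
      then show "p (s j) \<le> M * vnorm E x * (1 / 2) ^ j"
        using * by (simp add: mult.assoc)
    qed
    have partial: "(\<Oplus>j\<in>{..<K}. s j) = x \<ominus> z K" for K
    proof (induct K)
      case 0
      then show ?case using x by (simp add: z0)
    next
      case (Suc K)
      have "(\<Oplus>j\<in>{..<Suc K}. s j) = s K \<oplus> (x \<ominus> z K)"
        using s Suc by (simp add: lessThan_Suc)
      also have "\<dots> = x \<ominus> z (Suc K)"
        using s z x by (simp add: zSuc minus_eq_scal scal_add_right scal_scal M.a_ac)
      finally show ?case .
    qed
    have "converges_to E (\<lambda>K. \<Oplus>j\<in>{..<K}. s j) x"
      unfolding partial
    proof (rule converges_toI)
      show "vnorm E ((x \<ominus> z K) \<ominus> x) \<le> vnorm E x * (1 / 2) ^ K" for K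
      proof -
        have "(x \<ominus> z K) \<ominus> x = (- 1) \<odot> z K"
          using x z[of K] add_diff_cancel_left[of x "(- 1) \<odot> z K"] by (simp add: minus_eq_scal[of x "z K"])
        then show ?thesis
          using z[of K] vnorm_smult[of "z K" "- 1"] by simp
      qed
      show "(\<lambda>K. vnorm E x * (1 / 2) ^ K) \<longlonglongrightarrow> 0"
        by (intro tendsto_mult_right_zero LIMSEQ_power_zero) simp
    qed (use x z in auto)
    moreover have geo: "(\<lambda>j. M * vnorm E x * (1 / 2) ^ j) sums (M * vnorm E x * 2)"
      using sums_mult[OF geometric_sums[of "1 / 2 :: real"], of "M * vnorm E x"] by simp
    moreover have "summable (\<lambda>j. p (s j))"
      using s nonneg by (intro summable_comparison_test'[OF sums_summable[OF geo]]) simp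
    ultimately have "p x \<le> (\<Sum>j. p (s j))"
      using s by (intro countable_subadd) auto
    also have "\<dots> \<le> M * vnorm E x * 2"
      using s geo \<open>summable (\<lambda>j. p (s j))\<close> by (metis suminf_le sums_summable sums_unique)
    finally show ?thesis
      by (simp add: mult_ac)
  qed
  then show ?thesis
    using that by blast
qed

text \<open>Contains the closed graph theorem (\<open>S\<close> a single index) and uniform
  boundedness. The supremum over \<open>s\<close> of the norms of \<open>T s x\<close> is a seminorm
  by pointwise boundedness, and the closed graphs make it countably subadditive, so that Zabreiko's
  lemma applies.\<close>

lemma uniform_closed_graph:
  fixes T :: "'s \<Rightarrow> 'v \<Rightarrow> 'w"
  assumes "banach_module V" "banach_module W"
    and closed: "\<And>s x. s \<in> S \<Longrightarrow> x \<in> carrier V \<Longrightarrow> T s x \<in> carrier W"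
    and add: "\<And>s x y. s \<in> S \<Longrightarrow> x \<in> carrier V \<Longrightarrow> y \<in> carrier V \<Longrightarrow> T s (x \<oplus>\<^bsub>V\<^esub> y) = T s x \<oplus>\<^bsub>W\<^esub> T s y"
    and scal: "\<And>s a x. s \<in> S \<Longrightarrow> x \<in> carrier V \<Longrightarrow> T s (a \<odot>\<^bsub>V\<^esub> x) = a \<odot>\<^bsub>W\<^esub> T s x"
    and graph: "\<And>s y x w. s \<in> S \<Longrightarrow> converges_to V y x \<Longrightarrow> converges_to W (\<lambda>k. T s (y k)) w \<Longrightarrow> w = T s x"
    and bounded: "\<And>x. x \<in> carrier V \<Longrightarrow> \<exists>B. \<forall>s\<in>S. vnorm W (T s x) \<le> B"
  obtains C where "\<And>s x. s \<in> S \<Longrightarrow> x \<in> carrier V \<Longrightarrow> vnorm W (T s x) \<le> C * vnorm V x"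
\<comment> \<open>The supremum \<open>p\<close> below requires a nonempty index set.\<close>
proof (cases "S = {}")
  case True
  then show ?thesis
    using that by blast
next
  case False
  interpret V: banach_module V by fact
  interpret W: banach_module W by fact
  define p where "p x = (SUP s\<in>S. vnorm W (T s x))" for x
  have upper: "vnorm W (T s x) \<le> p x" if "s \<in> S" "x \<in> carrier V" for s x
    unfolding p_def using bounded[OF that(2)] that(1)
    by (intro cSUP_upper) (auto simp: bdd_above_def)
  have least: "p x \<le> B" if "\<And>s. s \<in> S \<Longrightarrow> vnorm W (T s x) \<le> B" for x B
    unfolding p_def using False that by (intro cSUP_least) auto
  have le: "p (a \<odot>\<^bsub>V\<^esub> x) \<le> norm a * p x" if "x \<in> carrier V" for a x
    using that closed upper
    by (intro least) (auto simp: scal W.vnorm_smult intro!: mult_left_mono)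
  have p_nonneg: "0 \<le> p x" if "x \<in> carrier V" for x
    using False upper[OF _ that] W.vnorm_nonneg[OF closed[OF _ that]] by (meson ex_in_conv order_trans)
  have "p (a \<odot>\<^bsub>V\<^esub> x) = norm a * p x" if x: "x \<in> carrier V" for a x
  proof (cases "a = 0")
    case True
    then show ?thesis
      using le[OF x, of 0] p_nonneg[of "\<zero>\<^bsub>V\<^esub>"] x by simp
  next
    case False
    \<comment> \<open>The inequality \<open>le\<close>, applied to the inverse scalar, is its own
      converse.\<close>
    have "p x \<le> norm (inverse a) * p (a \<odot>\<^bsub>V\<^esub> x)"
      using le[of "a \<odot>\<^bsub>V\<^esub> x" "inverse a"] x False by (simp add: V.scal_scal)
    then have "norm a * p x \<le> p (a \<odot>\<^bsub>V\<^esub> x)"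
      using False by (simp add: norm_inverse norm_divide field_simps)
    with le[OF x, of a] show ?thesis by simp
  qed
  moreover have "p (x \<oplus>\<^bsub>V\<^esub> y) \<le> p x + p y" if "x \<in> carrier V" "y \<in> carrier V" for x y
  proof (rule least)
    fix s assume s: "s \<in> S"
    show "vnorm W (T s (x \<oplus>\<^bsub>V\<^esub> y)) \<le> p x + p y"
      using W.vnorm_triangle[OF closed[OF s that(1)] closed[OF s that(2)]]
        upper[OF s that(1)] upper[OF s that(2)] add[OF s that] by simp
  qed
  moreover have "p x \<le> (\<Sum>k. p (u k))"
    if u: "\<And>k. u k \<in> carrier V" and sum: "summable (\<lambda>k. p (u k))"
      and conv: "converges_to V (\<lambda>K. \<Oplus>\<^bsub>V\<^esub>k\<in>{..<K}. u k) x" for u x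
  proof (rule least)
    fix s assume s: "s \<in> S"
    have "T s \<zero>\<^bsub>V\<^esub> = \<zero>\<^bsub>W\<^esub>"
      using scal[OF s V.M.zero_closed, of 0] closed[OF s V.M.zero_closed] by simp
    then have T_sum: "T s (\<Oplus>\<^bsub>V\<^esub>k\<in>{..<K}. u k) = (\<Oplus>\<^bsub>W\<^esub>k\<in>{..<K}. T s (u k))" for K
      using u closed[OF s] by (induct K) (simp_all add: lessThan_Suc add[OF s] Pi_def)
    have summ: "summable (\<lambda>k. vnorm W (T s (u k)))"
      using u s closed upper W.vnorm_nonneg by (intro summable_comparison_test'[OF sum]) simp
    then obtain w where w: "converges_to W (\<lambda>K. \<Oplus>\<^bsub>W\<^esub>k\<in>{..<K}. T s (u k)) w"
      using W.summable_converges[of "\<lambda>k. T s (u k)"] closed[OF s] u by blast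
    \<comment> \<open>Completeness of \<open>W\<close> only yields some limit \<open>w\<close> of
      the image series; the closed graph identifies it.\<close>
    have "w = T s x"
      using graph[OF s conv] w by (simp add: T_sum)
    moreover have "vnorm W w \<le> (\<Sum>k. p (u k))"
    proof (rule W.converges_to_bound[OF w])
      fix K :: nat
      have "vnorm W (\<Oplus>\<^bsub>W\<^esub>k\<in>{..<K}. T s (u k)) \<le> (\<Sum>k<K. vnorm W (T s (u k)))"
        using closed[OF s] u by (intro W.vnorm_finsum_le) auto
      also have "\<dots> \<le> (\<Sum>k<K. p (u k))"
        using upper[OF s] u by (intro sum_mono) auto
      also have "\<dots> \<le> (\<Sum>k. p (u k))"
        using p_nonneg u by (intro sum_le_suminf[OF sum]) auto
      finally show "vnorm W (\<Oplus>\<^bsub>W\<^esub>k\<in>{..<K}. T s (u k)) \<le> (\<Sum>k. p (u k))" .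
    qed
    ultimately show "vnorm W (T s x) \<le> (\<Sum>k. p (u k))" by simp
  qed
  ultimately have "\<exists>C. \<forall>x\<in>carrier V. p x \<le> C * vnorm V x"
    by (rule V.Zabreiko[of p]) auto
  then obtain C where C: "\<And>x. x \<in> carrier V \<Longrightarrow> p x \<le> C * vnorm V x"
    by blast
  show ?thesis
    by (rule that) (rule order_trans[OF upper C])
qed

lemma multilinearD:
  assumes "multilinear n E F A" "x \<in> {..<n} \<rightarrow>\<^sub>E carrier E"
  shows "A x \<in> carrier F"
    and "i < n \<Longrightarrow> y \<in> carrier E \<Longrightarrow> z \<in> carrier E \<Longrightarrow>
      A (x(i := y \<oplus>\<^bsub>E\<^esub> z)) = A (x(i := y)) \<oplus>\<^bsub>F\<^esub> A (x(i := z))"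
    and "i < n \<Longrightarrow> y \<in> carrier E \<Longrightarrow> A (x(i := a \<odot>\<^bsub>E\<^esub> y)) = a \<odot>\<^bsub>F\<^esub> A (x(i := y))"
  using assms by (auto simp: multilinear_def)

lemma fun_upd_PiE_lessThan:
  "x \<in> {..<n::nat} \<rightarrow>\<^sub>E B \<Longrightarrow> i < n \<Longrightarrow> y \<in> B \<Longrightarrow> x(i := y) \<in> {..<n} \<rightarrow>\<^sub>E B"
  by (auto simp: PiE_iff extensional_def)

text \<open>The uniform closed graph theorem frees one argument after the other: the arguments below \<open>m\<close>
  range over the unit ball, the others are fixed.\<close>

lemma multilinear_closed_graph:
  assumes "banach_module V" "banach_module W" and A: "multilinear n V W A"
    and graph: "\<And>(x :: nat \<Rightarrow> 'v) i y l w. x \<in> {..<n} \<rightarrow>\<^sub>E carrier V \<Longrightarrow> i < n \<Longrightarrow> converges_to V y l \<Longrightarrow>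
      converges_to W (\<lambda>k. A (x(i := y k))) w \<Longrightarrow> w = A (x(i := l))"
  obtains C where "\<And>x :: nat \<Rightarrow> 'v. x \<in> {..<n} \<rightarrow>\<^sub>E carrier V \<Longrightarrow> (\<And>i. i < n \<Longrightarrow> vnorm V (x i) \<le> 1) \<Longrightarrow> vnorm W (A x) \<le> C"
proof -
  interpret V: banach_module V by fact
  define S where "S m x = {y \<in> {..<n} \<rightarrow>\<^sub>E carrier V.
    (\<forall>i<n. m \<le> i \<longrightarrow> y i = x i) \<and> (\<forall>i<m. vnorm V (y i) \<le> 1)}" for m and x :: "nat \<Rightarrow> 'v"
  have "\<exists>B. \<forall>y\<in>S m x. vnorm W (A y) \<le> B" if "m \<le> n" "x \<in> {..<n} \<rightarrow>\<^sub>E carrier V" for m x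
    using that
  proof (induct m arbitrary: x)
    case 0
    have "y = x" if "y \<in> S 0 x" for y
      using that 0 by (intro PiE_ext[of y "{..<n}" "\<lambda>_. carrier V" x]) (auto simp: S_def)
    then show ?case by blast
  next
    case (Suc m)
    \<comment> \<open>Argument \<open>m\<close> is left free in \<open>S'\<close>: it is overwritten
      by the variable of the linear maps \<open>\<lambda>v. A (y(m := v))\<close>, which form a
      family indexed by \<open>S'\<close>.\<close>
    define S' where "S' = {y \<in> {..<n} \<rightarrow>\<^sub>E carrier V.
      (\<forall>i<n. Suc m \<le> i \<longrightarrow> y i = x i) \<and> (\<forall>i<m. vnorm V (y i) \<le> 1)}"
    have "\<exists>C. \<forall>y v. y \<in> S' \<longrightarrow> v \<in> carrier V \<longrightarrow> vnorm W (A (y(m := v))) \<le> C * vnorm V v"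
    proof (rule uniform_closed_graph[OF assms(1,2), of S' "\<lambda>y v. A (y(m := v))"])
      fix v assume v: "v \<in> carrier V"
      have "x(m := v) \<in> {..<n} \<rightarrow>\<^sub>E carrier V"
        using Suc v by (intro fun_upd_PiE_lessThan) auto
      \<comment> \<open>Pointwise boundedness of the family at \<open>v\<close> is the induction
        hypothesis with argument \<open>m\<close> fixed to \<open>v\<close>.\<close>
      from Suc(1)[OF _ this] obtain B where B: "\<forall>y\<in>S m (x(m := v)). vnorm W (A y) \<le> B"
        using Suc_leD[OF Suc(2)] by blast
      have "y(m := v) \<in> S m (x(m := v))" if "y \<in> S'" for y
        using that v Suc fun_upd_PiE_lessThan[of y n "carrier V" m v] by (auto simp: S_def S'_def)
      then show "\<exists>B. \<forall>y\<in>S'. vnorm W (A (y(m := v))) \<le> B"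
        using B by blast
    next
      fix y u v assume "y \<in> S'" "u \<in> carrier V" "v \<in> carrier V"
      then show "A (y(m := u \<oplus>\<^bsub>V\<^esub> v)) = A (y(m := u)) \<oplus>\<^bsub>W\<^esub> A (y(m := v))"
        using Suc(2) by (intro multilinearD(2)[OF A]) (auto simp: S'_def)
    next
      fix y a v assume "y \<in> S'" "v \<in> carrier V"
      then show "A (y(m := a \<odot>\<^bsub>V\<^esub> v)) = a \<odot>\<^bsub>W\<^esub> A (y(m := v))"
        using Suc(2) by (intro multilinearD(3)[OF A]) (auto simp: S'_def)
    next
      fix y v assume "y \<in> S'" "v \<in> carrier V"
      then show "A (y(m := v)) \<in> carrier W"
        using Suc(2) by (intro multilinearD(1)[OF A] fun_upd_PiE_lessThan) (auto simp: S'_def)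
    next
      fix y s l w assume "y \<in> S'" "converges_to V s l" "converges_to W (\<lambda>k. A (y(m := s k))) w"
      then show "w = A (y(m := l))"
        using Suc(2) by (intro graph) (auto simp: S'_def)
    qed blast
    then obtain C where C: "\<And>y v. y \<in> S' \<Longrightarrow> v \<in> carrier V \<Longrightarrow> vnorm W (A (y(m := v))) \<le> C * vnorm V v"
      by blast
    \<comment> \<open>The constant \<open>C\<close> comes without a sign, so the estimate over the
      unit ball takes its absolute value.\<close>
    have "vnorm W (A y) \<le> \<bar>C\<bar>" if "y \<in> S (Suc m) x" for y
    proof -
      have y: "y \<in> S'" "y m \<in> carrier V" "vnorm V (y m) \<le> 1"
        using that Suc(2) by (auto simp: S_def S'_def)
      have "vnorm W (A y) \<le> C * vnorm V (y m)"
        using C[OF y(1,2)] by simp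
      also have "\<dots> \<le> \<bar>C\<bar> * 1"
        using y V.vnorm_nonneg by (intro mult_mono) auto
      finally show ?thesis by simp
    qed
    then show ?case by blast
  qed
  \<comment> \<open>With \<open>m = n\<close> no argument is held fixed, so any base point serves;
    the zero tuple always exists.\<close>
  from this[of n "\<lambda>i\<in>{..<n}. \<zero>\<^bsub>V\<^esub>"] obtain C
    where C: "\<And>y. y \<in> S n (\<lambda>i\<in>{..<n}. \<zero>\<^bsub>V\<^esub>) \<Longrightarrow> vnorm W (A y) \<le> C"
    by (auto simp: PiE_iff)
  show ?thesis
    by (rule that[of C], rule C) (auto simp: S_def)
qed

section \<open>Polarization\<close>

lemma multilinear_zero:
  assumes "normed_module E" "normed_module F" "multilinear n E F A" "x \<in> {..<n} \<rightarrow>\<^sub>E carrier E" "i < n"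
  shows "A (x(i := \<zero>\<^bsub>E\<^esub>)) = \<zero>\<^bsub>F\<^esub>"
proof -
  interpret E: normed_module E by fact
  interpret F: normed_module F by fact
  have "A (x(i := 0 \<odot>\<^bsub>E\<^esub> \<zero>\<^bsub>E\<^esub>)) = 0 \<odot>\<^bsub>F\<^esub> A (x(i := \<zero>\<^bsub>E\<^esub>))"
    by (rule multilinearD(3)[OF assms(3-5)]) simp
  moreover have "A (x(i := \<zero>\<^bsub>E\<^esub>)) \<in> carrier F"
    by (rule multilinearD(1)[OF assms(3) fun_upd_PiE_lessThan[OF assms(4,5)]]) simp
  ultimately show ?thesis by simp
qed

lemma multilinear_finsum:
  assumes "normed_module E" "normed_module F" "multilinear n E F A" "x \<in> {..<n} \<rightarrow>\<^sub>E carrier E" "i < n"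
    and "finite J" "y \<in> J \<rightarrow> carrier E"
  shows "A (x(i := \<Oplus>\<^bsub>E\<^esub>j\<in>J. y j)) = (\<Oplus>\<^bsub>F\<^esub>j\<in>J. A (x(i := y j)))"
proof -
  interpret E: normed_module E by fact
  interpret F: normed_module F by fact
  have A: "A (x(i := v)) \<in> carrier F" if "v \<in> carrier E" for v
    by (rule multilinearD(1)[OF assms(3) fun_upd_PiE_lessThan[OF assms(4,5) that]])
  show ?thesis
    using assms(6,7)
  proof (induct set: finite)
    case empty
    show ?case
      unfolding E.M.finsum_empty F.M.finsum_empty by (rule multilinear_zero[OF assms(1-5)])
  next
    case (insert j J)
    then have "(\<Oplus>\<^bsub>E\<^esub>j\<in>insert j J. y j) = y j \<oplus>\<^bsub>E\<^esub> (\<Oplus>\<^bsub>E\<^esub>j\<in>J. y j)"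
      by (intro E.M.finsum_insert) auto
    then have "A (x(i := \<Oplus>\<^bsub>E\<^esub>j\<in>insert j J. y j)) = A (x(i := y j \<oplus>\<^bsub>E\<^esub> (\<Oplus>\<^bsub>E\<^esub>j\<in>J. y j)))"
      by (simp only:)
    also have "\<dots> = A (x(i := y j)) \<oplus>\<^bsub>F\<^esub> A (x(i := \<Oplus>\<^bsub>E\<^esub>j\<in>J. y j))"
      using insert by (intro multilinearD(2)[OF assms(3-5)] E.M.finsum_closed) auto
    also have "A (x(i := \<Oplus>\<^bsub>E\<^esub>j\<in>J. y j)) = (\<Oplus>\<^bsub>F\<^esub>j\<in>J. A (x(i := y j)))"
      using insert by (intro insert(3)) auto
    also have "A (x(i := y j)) \<oplus>\<^bsub>F\<^esub> (\<Oplus>\<^bsub>F\<^esub>j\<in>J. A (x(i := y j))) = (\<Oplus>\<^bsub>F\<^esub>j\<in>insert j J. A (x(i := y j)))"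
      using insert A by (intro F.M.finsum_insert[symmetric]) auto
    finally show ?case .
  qed
qed

text \<open>Sorts the functions by their value at \<open>m\<close>. The update at \<open>m\<close>
  is injective because the functions on \<open>{..<m}\<close>, being extensional, all take the value
  \<open>undefined\<close> there.\<close>

lemma (in normed_module) finsum_PiE_Suc:
  fixes J :: "'c set"
  assumes "finite J" "g \<in> ({..<Suc m} \<rightarrow>\<^sub>E J) \<rightarrow> carrier E"
  shows "(\<Oplus>f\<in>{..<Suc m} \<rightarrow>\<^sub>E J. g f) = (\<Oplus>j\<in>J. \<Oplus>f\<in>{..<m} \<rightarrow>\<^sub>E J. g (f(m := j)))"
proof -
  have un: "{..<Suc m} \<rightarrow>\<^sub>E J = (\<Union>j\<in>J. (\<lambda>f. f(m := j)) ` ({..<m} \<rightarrow>\<^sub>E J))"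
    unfolding lessThan_Suc PiE_insert_eq by auto
  have g: "g \<in> (\<Union>j\<in>J. (\<lambda>f. f(m := j)) ` ({..<m} \<rightarrow>\<^sub>E J)) \<rightarrow> carrier E"
    using assms(2) unfolding un .
  have inj: "inj_on (\<lambda>f. f(m := j)) ({..<m} \<rightarrow>\<^sub>E J)" for j
  proof (rule inj_onI)
    fix f g assume f: "f \<in> {..<m} \<rightarrow>\<^sub>E J" and g: "g \<in> {..<m} \<rightarrow>\<^sub>E J" and eq: "f(m := j) = g(m := j)"
    show "f = g"
    proof
      fix i show "f i = g i"
        using fun_cong[OF eq, of i] PiE_arb[OF f, of m] PiE_arb[OF g, of m] by (cases "i = m") auto
    qed
  qed
  have fin: "finite ((\<lambda>f. f(m := j)) ` ({..<m} \<rightarrow>\<^sub>E J))" for j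
    using assms(1) by (simp add: finite_PiE)
  have disj: "pairwise (\<lambda>i j. disjnt ((\<lambda>f. f(m := i)) ` ({..<m} \<rightarrow>\<^sub>E J)) ((\<lambda>f. f(m := j)) ` ({..<m} \<rightarrow>\<^sub>E J))) J"
  proof (rule pairwiseI)
    fix i j :: 'c assume "i \<noteq> j"
    have "f(m := i) \<noteq> g(m := j)" for f g :: "nat \<Rightarrow> 'c"
    proof
      assume "f(m := i) = g(m := j)"
      from fun_cong[OF this, of m] show False
        using \<open>i \<noteq> j\<close> by simp
    qed
    then show "disjnt ((\<lambda>f. f(m := i)) ` ({..<m} \<rightarrow>\<^sub>E J)) ((\<lambda>f. f(m := j)) ` ({..<m} \<rightarrow>\<^sub>E J))"
      unfolding disjnt_iff by blast
  qed
  have "(\<Oplus>f\<in>{..<Suc m} \<rightarrow>\<^sub>E J. g f) = (\<Oplus>j\<in>J. \<Oplus>f\<in>(\<lambda>f. f(m := j)) ` ({..<m} \<rightarrow>\<^sub>E J). g f)"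
    unfolding un
    by (rule M.add.finprod_UN_disjoint[OF assms(1) fin disj]) (rule funcset_mem[OF g UN_I])
  also have "\<dots> = (\<Oplus>j\<in>J. \<Oplus>f\<in>{..<m} \<rightarrow>\<^sub>E J. g (f(m := j)))"
  proof (rule M.finsum_cong')
    fix j assume "j \<in> J"
    then have "g \<in> (\<lambda>f. f(m := j)) ` ({..<m} \<rightarrow>\<^sub>E J) \<rightarrow> carrier E"
      using g by blast
    then show "(\<Oplus>f\<in>(\<lambda>f. f(m := j)) ` ({..<m} \<rightarrow>\<^sub>E J). g f) = (\<Oplus>f\<in>{..<m} \<rightarrow>\<^sub>E J. g (f(m := j)))"
      by (rule M.finsum_reindex) (rule inj)
  next
    show "(\<lambda>j. \<Oplus>f\<in>{..<m} \<rightarrow>\<^sub>E J. g (f(m := j))) \<in> J \<rightarrow> carrier E"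
    proof
      fix j assume "j \<in> J"
      then have "(\<lambda>f. g (f(m := j))) \<in> ({..<m} \<rightarrow>\<^sub>E J) \<rightarrow> carrier E"
        using g by blast
      then show "(\<Oplus>f\<in>{..<m} \<rightarrow>\<^sub>E J. g (f(m := j))) \<in> carrier E"
        by (rule M.finsum_closed)
    qed
  qed simp
  finally show ?thesis .
qed

text \<open>Expands the equal arguments slot by slot; choosing a summand in every slot amounts to a
  function \<open>f\<close> from the slots to \<open>J\<close>.\<close>

lemma multilinear_diagonal_finsum:
  assumes E: "normed_module E" and F: "normed_module F" and A: "multilinear n E F A"
    and J: "finite J" "x \<in> J \<rightarrow> carrier E"
  shows "A (\<lambda>i\<in>{..<n}. \<Oplus>\<^bsub>E\<^esub>j\<in>J. x j) = (\<Oplus>\<^bsub>F\<^esub>f\<in>{..<n} \<rightarrow>\<^sub>E J. A (\<lambda>i\<in>{..<n}. x (f i)))"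
proof -
  interpret E: normed_module E by fact
  interpret F: normed_module F by fact
  let ?s = "\<Oplus>\<^bsub>E\<^esub>j\<in>J. x j"
  have s: "?s \<in> carrier E"
    using J by simp
  have in_PiE: "(\<lambda>i\<in>{..<n}. if i < m then x (f i) else y i) \<in> {..<n} \<rightarrow>\<^sub>E carrier E"
    if "f \<in> {..<m} \<rightarrow>\<^sub>E J" "y \<in> {..<n} \<rightarrow>\<^sub>E carrier E" for m f y
    using that J by (auto simp: PiE_iff)
  \<comment> \<open>The slots from \<open>m\<close> on hold arbitrary vectors \<open>y\<close>, so
    that in the induction step slot \<open>m\<close> may already contain a summand
    \<open>x j\<close> when the hypothesis is applied to the slots below.\<close>
  have expand: "A (\<lambda>i\<in>{..<n}. if i < m then ?s else y i) =
      (\<Oplus>\<^bsub>F\<^esub>f\<in>{..<m} \<rightarrow>\<^sub>E J. A (\<lambda>i\<in>{..<n}. if i < m then x (f i) else y i))"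
    if "m \<le> n" "y \<in> {..<n} \<rightarrow>\<^sub>E carrier E" for m y
    using that
  proof (induct m arbitrary: y)
    case 0
    have "(\<lambda>i\<in>{..<n}. y i) = y"
      using 0 by (intro restrict_PiE_iff[THEN iffD1] extensional_restrict) (auto simp: PiE_def)
    then show ?case
      using multilinearD(1)[OF A 0(2)] by simp
  next
    case (Suc m)
    define z where "z = (\<lambda>i\<in>{..<n}. if i < m then ?s else y i)"
    have z: "z \<in> {..<n} \<rightarrow>\<^sub>E carrier E"
      using Suc(3) s by (auto simp: z_def PiE_iff)
    have yj: "y(m := x j) \<in> {..<n} \<rightarrow>\<^sub>E carrier E" if "j \<in> J" for j
      using Suc that J by (intro fun_upd_PiE_lessThan) auto
    have zj: "z(m := x j) = (\<lambda>i\<in>{..<n}. if i < m then ?s else (y(m := x j)) i)" for j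
      using Suc(2) by (auto simp: z_def fun_eq_iff)
    have fj: "(\<lambda>i\<in>{..<n}. if i < m then x (f i) else (y(m := x j)) i) =
        (\<lambda>i\<in>{..<n}. if i < Suc m then x ((f(m := j)) i) else y i)" for f j
      by (auto simp: fun_eq_iff less_Suc_eq)
    have "(\<lambda>i\<in>{..<n}. if i < Suc m then ?s else y i) = z(m := ?s)"
      using Suc(2) by (auto simp: z_def fun_eq_iff less_Suc_eq)
    then have "A (\<lambda>i\<in>{..<n}. if i < Suc m then ?s else y i) = (\<Oplus>\<^bsub>F\<^esub>j\<in>J. A (z(m := x j)))"
      using Suc(2) multilinear_finsum[OF E F A z _ J] by simp
    also have "\<dots> = (\<Oplus>\<^bsub>F\<^esub>j\<in>J. \<Oplus>\<^bsub>F\<^esub>f\<in>{..<m} \<rightarrow>\<^sub>E J.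
        A (\<lambda>i\<in>{..<n}. if i < Suc m then x ((f(m := j)) i) else y i))"
    proof (rule F.M.finsum_cong')
      fix j assume j: "j \<in> J"
      show "A (z(m := x j)) = (\<Oplus>\<^bsub>F\<^esub>f\<in>{..<m} \<rightarrow>\<^sub>E J.
          A (\<lambda>i\<in>{..<n}. if i < Suc m then x ((f(m := j)) i) else y i))"
        unfolding zj fj[symmetric] by (rule Suc(1)[OF Suc_leD[OF Suc(2)] yj[OF j]])
    next
      show "(\<lambda>j. \<Oplus>\<^bsub>F\<^esub>f\<in>{..<m} \<rightarrow>\<^sub>E J. A (\<lambda>i\<in>{..<n}. if i < Suc m then x ((f(m := j)) i) else y i)) \<in> J \<rightarrow> carrier F"
        unfolding fj[symmetric] by (intro funcsetI F.M.finsum_closed multilinearD(1)[OF A] in_PiE yj)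
    qed simp
    also have "\<dots> = (\<Oplus>\<^bsub>F\<^esub>f\<in>{..<Suc m} \<rightarrow>\<^sub>E J. A (\<lambda>i\<in>{..<n}. if i < Suc m then x (f i) else y i))"
      using J Suc(3) by (intro F.finsum_PiE_Suc[symmetric] funcsetI multilinearD(1)[OF A] in_PiE)
    finally show ?case .
  qed
  have all: "(\<lambda>i\<in>{..<n}. if i < n then g i else h i) = (\<lambda>i\<in>{..<n}. g i)" for g h
    by (auto simp: restrict_def fun_eq_iff)
  have "(\<lambda>i\<in>{..<n}. ?s) \<in> {..<n} \<rightarrow>\<^sub>E carrier E"
    using s by simp
  from expand[OF order_refl this] show ?thesis
    unfolding all .
qed

text \<open>The polarization formula without the factor \<open>1 / n!\<close>. If \<open>P\<close>
  is \<open>A\<close> on the diagonal, it is the sum of \<open>A\<close> over all permutations of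
  the arguments, that is, \<open>n!\<close> times the symmetric multilinear map of
  \<open>P\<close>.\<close>

definition polarize ::
  "nat \<Rightarrow> ('k::{real_normed_field,banach}, 'v) nspace \<Rightarrow> ('k, 'w) nspace \<Rightarrow> ('v \<Rightarrow> 'w) \<Rightarrow> (nat \<Rightarrow> 'v) \<Rightarrow> 'w" where
  "polarize n E F P x =
     (\<Oplus>\<^bsub>F\<^esub>S\<in>Pow {..<n}. (- 1) ^ (n - card S) \<odot>\<^bsub>F\<^esub> P (\<Oplus>\<^bsub>E\<^esub>i\<in>S. x i))"

text \<open>If \<open>U\<close> is a proper subset, as many sets of even as of odd size lie between
  it and the whole set, and their signs cancel; for the full \<open>U\<close> there is only one set,
  with sign 1.\<close>

lemma sum_supersets_alternating:
  assumes "U \<subseteq> {..<n::nat}"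
  shows "(\<Sum>S\<in>Pow {..<n}. (- 1) ^ (n - card S) * (if U \<subseteq> S then 1 else 0)) =
    (if U = {..<n} then 1 else (0 :: 'k::comm_ring_1))"
proof (cases "U = {..<n}")
  case True
  have "(\<Sum>S\<in>Pow {..<n}. (- 1) ^ (n - card S) * (if U \<subseteq> S then 1 else 0)) =
      (\<Sum>S\<in>{{..<n}}. (- 1) ^ (n - card S) * (if U \<subseteq> S then 1 else (0 :: 'k)))"
    by (rule sum.mono_neutral_right) (use True in auto)
  with True show ?thesis by simp
next
  case False
  then have U: "U \<subset> {..<n}"
    using assms by auto
  have "(\<Sum>S\<in>Pow {..<n}. (- 1) ^ (n - card S) * (if U \<subseteq> S then 1 else 0)) =
      (\<Sum>S\<in>{S. S \<subseteq> {..<n} \<and> U \<subseteq> S}. (- 1) ^ n * (- 1 :: 'k) ^ card S)"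
  proof (rule sum.mono_neutral_cong_right)
    fix S assume "S \<in> {S. S \<subseteq> {..<n} \<and> U \<subseteq> S}"
    then have "card S \<le> n"
      using card_mono[of "{..<n}" S] by simp
    \<comment> \<open>Since \<open>card S \<le> n\<close>, the subtraction is not truncated, and the
      sign splits into a constant and \<open>(- 1) ^ card S\<close>.\<close>
    then have "even (n - card S) \<longleftrightarrow> (even n \<longleftrightarrow> even (card S))"
      by auto
    then show "(- 1) ^ (n - card S) * (if U \<subseteq> S then 1 else 0) = (- 1) ^ n * (- 1 :: 'k) ^ card S"
      using \<open>S \<in> _\<close> by (auto simp: minus_one_power_iff)
  qed auto
  also have "\<dots> = (- 1) ^ n * (\<Sum>S\<in>{S. S \<subseteq> {..<n} \<and> U \<subseteq> S}. (- 1) ^ card S)"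
    by (simp add: sum_distrib_left)
  also have "(\<Sum>S\<in>{S. S \<subseteq> {..<n} \<and> U \<subseteq> S}. (- 1) ^ card S) = (0 :: 'k)"
    using card_subsupersets_even_odd[OF _ U] by (intro sum_alternating_cancels) (auto simp: conj_ac)
  finally show ?thesis
    using False by simp
qed

text \<open>Expanding \<open>P\<close> at the sum over \<open>S\<close> yields all functions with
  values in \<open>S\<close>. After an exchange of sums, the coefficient of \<open>f\<close> is the
  alternating sum over the sets \<open>S\<close> that contain its image, which vanishes unless
  \<open>f\<close> is onto.\<close>

lemma polarize_eq_sum_bijections:
  fixes E :: "('k::{real_normed_field,banach}, 'v) nspace" and F :: "('k, 'w) nspace"
  assumes E: "normed_module E" and F: "normed_module F" and A: "multilinear n E F A"
    and P: "\<And>x. x \<in> carrier E \<Longrightarrow> P x = A (\<lambda>i\<in>{..<n}. x)" and x: "x \<in> {..<n} \<rightarrow> carrier E"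
  shows "polarize n E F P x = (\<Oplus>\<^bsub>F\<^esub>f\<in>{f \<in> {..<n} \<rightarrow>\<^sub>E {..<n}. f ` {..<n} = {..<n}}. A (\<lambda>i\<in>{..<n}. x (f i)))"
proof -
  interpret E: normed_module E by fact
  interpret F: normed_module F by fact
  let ?N = "{..<n}" and ?c = "\<lambda>S. (- 1) ^ (n - card S) :: 'k"
  let ?A = "\<lambda>f. A (\<lambda>i\<in>{..<n}. x (f i))" and ?d = "\<lambda>f S. if f ` {..<n} \<subseteq> S then 1 else (0 :: 'k)"
  have A_closed: "?A f \<in> carrier F" if "f \<in> ?N \<rightarrow>\<^sub>E ?N" for f
    using that x by (intro multilinearD(1)[OF A]) auto
  have fin: "finite (?N \<rightarrow>\<^sub>E ?N)"
    by (simp add: finite_PiE)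
  have "?c S \<odot>\<^bsub>F\<^esub> P (\<Oplus>\<^bsub>E\<^esub>i\<in>S. x i) = (\<Oplus>\<^bsub>F\<^esub>f\<in>?N \<rightarrow>\<^sub>E ?N. (?c S * ?d f S) \<odot>\<^bsub>F\<^esub> ?A f)" if S: "S \<in> Pow ?N" for S
  proof -
    have xS: "x \<in> S \<rightarrow> carrier E" and "finite S"
      using S x by (auto intro: finite_subset)
    then have "P (\<Oplus>\<^bsub>E\<^esub>i\<in>S. x i) = (\<Oplus>\<^bsub>F\<^esub>f\<in>?N \<rightarrow>\<^sub>E S. ?A f)"
      by (simp add: P multilinear_diagonal_finsum[OF E F A])
    \<comment> \<open>The indicator makes the index set of the inner sum independent of
      \<open>S\<close>, as the exchange of sums requires.\<close>
    also have "\<dots> = (\<Oplus>\<^bsub>F\<^esub>f\<in>?N \<rightarrow>\<^sub>E ?N. ?d f S \<odot>\<^bsub>F\<^esub> ?A f)"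
    proof (rule F.M.add.finprod_mono_neutral_cong_left[OF fin])
      show "?N \<rightarrow>\<^sub>E S \<subseteq> ?N \<rightarrow>\<^sub>E ?N"
        using S by (intro PiE_mono) auto
      show "?d f S \<odot>\<^bsub>F\<^esub> ?A f = \<zero>\<^bsub>F\<^esub>" if "f \<in> (?N \<rightarrow>\<^sub>E ?N) - (?N \<rightarrow>\<^sub>E S)" for f
      proof -
        have "\<not> f ` ?N \<subseteq> S"
          using that by (auto simp: PiE_iff)
        then show ?thesis
          using that A_closed by auto
      qed
      show "?A f = ?d f S \<odot>\<^bsub>F\<^esub> ?A f" if "f \<in> ?N \<rightarrow>\<^sub>E S" for f
      proof -
        have "f \<in> ?N \<rightarrow>\<^sub>E ?N" "f ` ?N \<subseteq> S"
          using that S by (auto simp: PiE_iff)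
        then show ?thesis
          using A_closed by auto
      qed
    qed (use A_closed in auto)
    finally show ?thesis
      using A_closed by (simp add: F.scal_finsum[OF fin] F.scal_scal Pi_def cong: F.M.finsum_cong)
  qed
  then have "polarize n E F P x = (\<Oplus>\<^bsub>F\<^esub>S\<in>Pow ?N. \<Oplus>\<^bsub>F\<^esub>f\<in>?N \<rightarrow>\<^sub>E ?N. (?c S * ?d f S) \<odot>\<^bsub>F\<^esub> ?A f)"
    unfolding polarize_def using A_closed by (intro F.M.finsum_cong' funcsetI F.M.finsum_closed F.scal_closed) auto
  also have "\<dots> = (\<Oplus>\<^bsub>F\<^esub>f\<in>?N \<rightarrow>\<^sub>E ?N. \<Oplus>\<^bsub>F\<^esub>S\<in>Pow ?N. (?c S * ?d f S) \<odot>\<^bsub>F\<^esub> ?A f)"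
    using A_closed fin by (intro F.finsum_swap F.scal_closed) auto
  also have "\<dots> = (\<Oplus>\<^bsub>F\<^esub>f\<in>?N \<rightarrow>\<^sub>E ?N. (if f ` ?N = ?N then 1 else 0) \<odot>\<^bsub>F\<^esub> ?A f)"
  proof (rule F.M.finsum_cong')
    fix f assume f: "f \<in> ?N \<rightarrow>\<^sub>E ?N"
    then have "f ` ?N \<subseteq> ?N"
      by auto
    then show "(\<Oplus>\<^bsub>F\<^esub>S\<in>Pow ?N. (?c S * ?d f S) \<odot>\<^bsub>F\<^esub> ?A f) = (if f ` ?N = ?N then 1 else 0) \<odot>\<^bsub>F\<^esub> ?A f"
      using F.finsum_scal_left[of "Pow ?N" "?A f" "\<lambda>S. ?c S * ?d f S"] A_closed[OF f]
        sum_supersets_alternating[of "f ` ?N" n, where 'k = 'k] by simp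
  qed (use A_closed in auto)
  also have "\<dots> = (\<Oplus>\<^bsub>F\<^esub>f\<in>{f \<in> ?N \<rightarrow>\<^sub>E ?N. f ` ?N = ?N}. ?A f)"
    by (rule F.M.add.finprod_mono_neutral_cong_left[OF fin, symmetric]) (use A_closed in auto)
  finally show ?thesis .
qed

text \<open>On a finite set the maps onto it are the injective ones, and injections are counted by a
  falling factorial.\<close>

lemma card_bijections:
  "card {f \<in> {..<n::nat} \<rightarrow>\<^sub>E {..<n}. f ` {..<n} = {..<n}} = fact n"
proof -
  have "{f \<in> {..<n} \<rightarrow>\<^sub>E {..<n}. f ` {..<n} = {..<n}} = {f \<in> {..<n} \<rightarrow>\<^sub>E {..<n}. inj_on f {..<n}}"
  proof (intro Collect_cong conj_cong refl)
    fix f assume f: "f \<in> {..<n} \<rightarrow>\<^sub>E {..<n}"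
    show "f ` {..<n} = {..<n} \<longleftrightarrow> inj_on f {..<n}"
      using f endo_inj_surj[of "{..<n}" f] eq_card_imp_inj_on[of "{..<n}" f] by auto
  qed
  then show ?thesis
    using card_inj_on_subset_funcset[of "{..<n}" "{..<n}" "{..<n}"]
    by (simp add: fact_prod_rev)
qed

text \<open>\<open>homogeneous_poly\<close> only asserts that some multilinear map exists.
  Polarization recovers one, up to the factor \<open>n!\<close>, from the values of \<open>P\<close>
  alone, and can therefore follow \<open>P\<close> through limits and into sequence spaces.\<close>

lemma multilinear_polarize:
  fixes E :: "('k::{real_normed_field,banach}, 'v) nspace" and F :: "('k, 'w) nspace"
  assumes E: "normed_module E" and F: "normed_module F" and P: "homogeneous_poly n E F P"
  shows "multilinear n E F (polarize n E F P)"
    and "x \<in> carrier E \<Longrightarrow> polarize n E F P (\<lambda>i\<in>{..<n}. x) = fact n \<odot>\<^bsub>F\<^esub> P x"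
proof -
  interpret E: normed_module E by fact
  interpret F: normed_module F by fact
  obtain A where A: "multilinear n E F A" and PA: "\<And>x. x \<in> carrier E \<Longrightarrow> P x = A (\<lambda>i\<in>{..<n}. x)"
    using P by (auto simp: homogeneous_poly_def)
  let ?N = "{..<n}"
  let ?B = "{f \<in> ?N \<rightarrow>\<^sub>E ?N. f ` ?N = ?N}"
  have fin: "finite ?B"
    by (simp add: finite_PiE)
  have pol: "polarize n E F P x = (\<Oplus>\<^bsub>F\<^esub>f\<in>?B. A (\<lambda>i\<in>?N. x (f i)))" if "x \<in> ?N \<rightarrow>\<^sub>E carrier E" for x
    using that by (intro polarize_eq_sum_bijections[OF E F A PA]) auto
  have comp: "(\<lambda>i\<in>?N. x (f i)) \<in> ?N \<rightarrow>\<^sub>E carrier E" if "x \<in> ?N \<rightarrow>\<^sub>E carrier E" "f \<in> ?B" for x f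
    using that by auto
  have A_closed: "A (\<lambda>i\<in>?N. x (f i)) \<in> carrier F" if "x \<in> ?N \<rightarrow>\<^sub>E carrier E" "f \<in> ?B" for x f
    by (rule multilinearD(1)[OF A comp[OF that]])
  \<comment> \<open>A permutation \<open>f\<close> reads argument \<open>i\<close> in exactly one
    slot \<open>k\<close>, so changing one argument changes one slot of \<open>A\<close>.\<close>
  have upd: "\<exists>k<n. \<forall>y. (\<lambda>j\<in>?N. (x(i := y)) (f j)) = (\<lambda>j\<in>?N. x (f j))(k := y)" if f: "f \<in> ?B" and i: "i < n" for f i and x :: "nat \<Rightarrow> 'v"
  proof -
    have inj: "inj_on f ?N"
      using f by (intro eq_card_imp_inj_on) auto
    have "i \<in> f ` ?N"
      using f i by simp
    then obtain k where "k < n" "f k = i"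
      by auto
    with inj have "(\<lambda>j\<in>?N. (x(i := y)) (f j)) = (\<lambda>j\<in>?N. x (f j))(k := y)" for y
      by (auto simp: fun_eq_iff inj_on_def)
    then show ?thesis
      using \<open>k < n\<close> by blast
  qed
  show "multilinear n E F (polarize n E F P)"
    unfolding multilinear_def
  proof (intro conjI funcsetI ballI allI impI)
    fix x assume x: "x \<in> ?N \<rightarrow>\<^sub>E carrier E"
    show "polarize n E F P x \<in> carrier F"
      unfolding pol[OF x] by (intro F.M.finsum_closed funcsetI A_closed[OF x])
  next
    fix x i y z
    assume x: "x \<in> ?N \<rightarrow>\<^sub>E carrier E" and i: "i < n" and y: "y \<in> carrier E" and z: "z \<in> carrier E"
    have upd_in: "x(i := y) \<in> ?N \<rightarrow>\<^sub>E carrier E" if "y \<in> carrier E" for y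
      using x i that by (rule fun_upd_PiE_lessThan)
    note upd_closed = A_closed[OF upd_in]
    have eq: "A (\<lambda>j\<in>?N. (x(i := y \<oplus>\<^bsub>E\<^esub> z)) (f j)) =
        A (\<lambda>j\<in>?N. (x(i := y)) (f j)) \<oplus>\<^bsub>F\<^esub> A (\<lambda>j\<in>?N. (x(i := z)) (f j))" if f: "f \<in> ?B" for f
    proof -
      obtain k where k: "k < n" "\<And>y. (\<lambda>j\<in>?N. (x(i := y)) (f j)) = (\<lambda>j\<in>?N. x (f j))(k := y)"
        using upd[OF f i, of x] by blast
      show ?thesis
        unfolding k(2) by (rule multilinearD(2)[OF A comp[OF x f] k(1) y z])
    qed
    have "polarize n E F P (x(i := y \<oplus>\<^bsub>E\<^esub> z)) =
        (\<Oplus>\<^bsub>F\<^esub>f\<in>?B. A (\<lambda>j\<in>?N. (x(i := y)) (f j)) \<oplus>\<^bsub>F\<^esub> A (\<lambda>j\<in>?N. (x(i := z)) (f j)))"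
      unfolding pol[OF upd_in[OF E.M.a_closed[OF y z]]]
      by (rule F.M.finsum_cong'[OF refl _ eq]) (intro funcsetI F.M.a_closed upd_closed y z)
    also have "\<dots> = polarize n E F P (x(i := y)) \<oplus>\<^bsub>F\<^esub> polarize n E F P (x(i := z))"
      unfolding pol[OF upd_in[OF y]] pol[OF upd_in[OF z]]
      by (intro F.M.finsum_addf funcsetI upd_closed y z)
    finally show "polarize n E F P (x(i := y \<oplus>\<^bsub>E\<^esub> z)) =
      polarize n E F P (x(i := y)) \<oplus>\<^bsub>F\<^esub> polarize n E F P (x(i := z))" .
  next
    fix x i y a
    assume x: "x \<in> ?N \<rightarrow>\<^sub>E carrier E" and i: "i < n" and y: "y \<in> carrier E"
    have upd_in: "x(i := y) \<in> ?N \<rightarrow>\<^sub>E carrier E" if "y \<in> carrier E" for y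
      using x i that by (rule fun_upd_PiE_lessThan)
    note upd_closed = A_closed[OF upd_in]
    have eq: "A (\<lambda>j\<in>?N. (x(i := a \<odot>\<^bsub>E\<^esub> y)) (f j)) = a \<odot>\<^bsub>F\<^esub> A (\<lambda>j\<in>?N. (x(i := y)) (f j))" if f: "f \<in> ?B" for f
    proof -
      obtain k where k: "k < n" "\<And>y. (\<lambda>j\<in>?N. (x(i := y)) (f j)) = (\<lambda>j\<in>?N. x (f j))(k := y)"
        using upd[OF f i, of x] by blast
      show ?thesis
        unfolding k(2) by (rule multilinearD(3)[OF A comp[OF x f] k(1) y])
    qed
    have "polarize n E F P (x(i := a \<odot>\<^bsub>E\<^esub> y)) = (\<Oplus>\<^bsub>F\<^esub>f\<in>?B. a \<odot>\<^bsub>F\<^esub> A (\<lambda>j\<in>?N. (x(i := y)) (f j)))"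
      unfolding pol[OF upd_in[OF E.scal_closed[OF y]]]
      by (rule F.M.finsum_cong'[OF refl _ eq]) (intro funcsetI F.scal_closed upd_closed y)
    also have "\<dots> = a \<odot>\<^bsub>F\<^esub> polarize n E F P (x(i := y))"
      unfolding pol[OF upd_in[OF y]]
      by (intro F.scal_finsum[symmetric] fin funcsetI upd_closed y)
    finally show "polarize n E F P (x(i := a \<odot>\<^bsub>E\<^esub> y)) = a \<odot>\<^bsub>F\<^esub> polarize n E F P (x(i := y))" .
  qed
  assume x: "x \<in> carrier E"
  then have "polarize n E F P (\<lambda>i\<in>?N. x) = (\<Oplus>\<^bsub>F\<^esub>f\<in>?B. P x)"
    unfolding pol[OF restrict_PiE_iff[THEN iffD2, OF ballI, OF x]]
    using A_closed[of "\<lambda>i\<in>?N. x"]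
    by (intro F.M.finsum_cong') (auto simp: PA fun_eq_iff intro!: arg_cong[of _ _ A] multilinearD(1)[OF A])
  also have "\<dots> = fact n \<odot>\<^bsub>F\<^esub> P x"
    using F.finsum_const_scal[OF fin, of "P x"] multilinearD(1)[OF A] x
    by (simp add: PA card_bijections)
  finally show "polarize n E F P (\<lambda>i\<in>?N. x) = fact n \<odot>\<^bsub>F\<^esub> P x" .
qed

lemma homogeneous_poly_closed:
  assumes "normed_module E" "normed_module F" "homogeneous_poly n E F P" "x \<in> carrier E"
  shows "P x \<in> carrier F"
proof -
  obtain A where A: "multilinear n E F A" "P x = A (\<lambda>i\<in>{..<n}. x)"
    using assms by (auto simp: homogeneous_poly_def)
  then show ?thesis
    using multilinearD(1)[OF A(1), of "\<lambda>i\<in>{..<n}. x"] assms(4) by simp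
qed

text \<open>Both the polynomial and its arguments may vary with \<open>k\<close>: the former in the
  passage to pointwise limits, the latter in the closed graph argument.\<close>

lemma polarize_converges:
  assumes "normed_module E" "normed_module F" "\<And>S. S \<subseteq> {..<n} \<Longrightarrow>
    converges_to F (\<lambda>k. P k (\<Oplus>\<^bsub>E\<^esub>i\<in>S. x k i)) (Q (\<Oplus>\<^bsub>E\<^esub>i\<in>S. y i))"
  shows "converges_to F (\<lambda>k. polarize n E F (P k) (x k)) (polarize n E F Q y)"
  unfolding polarize_def using assms
  by (intro normed_module.converges_to_finsum normed_module.converges_to_scal) auto

text \<open>An \<open>n\<close>-homogeneous polynomial determines its polarization, so that pointwise limits of
  polynomials yield pointwise limits of multilinear maps.\<close>

lemma homogeneous_poly_limit:
  assumes E: "normed_module E" and F: "normed_module F" and P: "\<And>k. homogeneous_poly n E F (P k)"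
    and lim: "\<And>x. x \<in> carrier E \<Longrightarrow> converges_to F (\<lambda>k. P k x) (Q x)"
  shows "homogeneous_poly n E F Q"
proof -
  interpret E: normed_module E by fact
  interpret F: normed_module F by fact
  note pol = multilinear_polarize[OF E F P]
  have conv: "converges_to F (\<lambda>k. polarize n E F (P k) x) (polarize n E F Q x)"
    if "x \<in> {..<n} \<rightarrow>\<^sub>E carrier E" for x
  proof (rule polarize_converges[OF E F lim])
    fix S assume "S \<subseteq> {..<n}"
    then show "(\<Oplus>\<^bsub>E\<^esub>i\<in>S. x i) \<in> carrier E"
      using that by (intro E.M.finsum_closed) auto
  qed
  \<comment> \<open>Dividing by \<open>n!\<close>, which is invertible in a real normed field,
    supplies the factor absent from \<open>polarize\<close>. The multilinear identities pass to the
    limit because limits are unique.\<close>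
  have "multilinear n E F (\<lambda>x. inverse (fact n) \<odot>\<^bsub>F\<^esub> polarize n E F Q x)"
    unfolding multilinear_def
  proof (intro conjI funcsetI ballI allI impI)
    fix x assume "x \<in> {..<n} \<rightarrow>\<^sub>E carrier E"
    then show "inverse (fact n) \<odot>\<^bsub>F\<^esub> polarize n E F Q x \<in> carrier F"
      using converges_to_carrier(2)[OF conv] by simp
  next
    fix x i y z
    assume x: "x \<in> {..<n} \<rightarrow>\<^sub>E carrier E" and i: "i < n" and y: "y \<in> carrier E" and z: "z \<in> carrier E"
    note c = conv[OF fun_upd_PiE_lessThan[OF x i]]
    have "polarize n E F Q (x(i := y \<oplus>\<^bsub>E\<^esub> z)) = polarize n E F Q (x(i := y)) \<oplus>\<^bsub>F\<^esub> polarize n E F Q (x(i := z))"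
      using c[OF E.M.a_closed[OF y z]] F.converges_to_add[OF c[OF y] c[OF z]]
      unfolding multilinearD(2)[OF pol(1) x i y z] by (rule F.converges_to_unique)
    then show "inverse (fact n) \<odot>\<^bsub>F\<^esub> polarize n E F Q (x(i := y \<oplus>\<^bsub>E\<^esub> z)) =
        inverse (fact n) \<odot>\<^bsub>F\<^esub> polarize n E F Q (x(i := y)) \<oplus>\<^bsub>F\<^esub> inverse (fact n) \<odot>\<^bsub>F\<^esub> polarize n E F Q (x(i := z))"
      using converges_to_carrier(2)[OF c[OF y]] converges_to_carrier(2)[OF c[OF z]] by (simp add: F.scal_add_right)
  next
    fix x i y a
    assume x: "x \<in> {..<n} \<rightarrow>\<^sub>E carrier E" and i: "i < n" and y: "y \<in> carrier E"
    note c = conv[OF fun_upd_PiE_lessThan[OF x i]]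
    have "polarize n E F Q (x(i := a \<odot>\<^bsub>E\<^esub> y)) = a \<odot>\<^bsub>F\<^esub> polarize n E F Q (x(i := y))"
      using c[OF E.scal_closed[OF y]] F.converges_to_scal[OF c[OF y]]
      unfolding multilinearD(3)[OF pol(1) x i y] by (rule F.converges_to_unique)
    then show "inverse (fact n) \<odot>\<^bsub>F\<^esub> polarize n E F Q (x(i := a \<odot>\<^bsub>E\<^esub> y)) =
        a \<odot>\<^bsub>F\<^esub> (inverse (fact n) \<odot>\<^bsub>F\<^esub> polarize n E F Q (x(i := y)))"
      using converges_to_carrier(2)[OF c[OF y]] by (simp add: F.scal_scal mult.commute)
  qed
  moreover have "Q x = inverse (fact n) \<odot>\<^bsub>F\<^esub> polarize n E F Q (\<lambda>i\<in>{..<n}. x)" if x: "x \<in> carrier E" for x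
  proof -
    have "polarize n E F Q (\<lambda>i\<in>{..<n}. x) = fact n \<odot>\<^bsub>F\<^esub> Q x"
      using conv[of "\<lambda>i\<in>{..<n}. x"] F.converges_to_scal[OF lim[OF x], of "fact n"] x
      unfolding pol(2)[OF x] by (intro F.converges_to_unique) auto
    then show ?thesis
      using converges_to_carrier(2)[OF lim[OF x]] by (simp add: F.scal_scal)
  qed
  ultimately show ?thesis
    unfolding homogeneous_poly_def by blast
qed

section \<open>Homogeneous polynomials\<close>

lemma homogeneous_poly_cong:
  "(\<And>x. x \<in> carrier E \<Longrightarrow> P x = Q x) \<Longrightarrow> homogeneous_poly n E F P \<longleftrightarrow> homogeneous_poly n E F Q"
  by (simp add: homogeneous_poly_def)

lemma homogeneous_poly_scal:
  assumes E: "normed_module E" and F: "normed_module F" and P: "homogeneous_poly n E F P" and x: "x \<in> carrier E"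
  shows "P (a \<odot>\<^bsub>E\<^esub> x) = a ^ n \<odot>\<^bsub>F\<^esub> P x"
proof -
  interpret E: normed_module E by fact
  interpret F: normed_module F by fact
  obtain A where A: "multilinear n E F A" and PA: "\<And>x. x \<in> carrier E \<Longrightarrow> P x = A (\<lambda>i\<in>{..<n}. x)"
    using P by (auto simp: homogeneous_poly_def)
  \<comment> \<open>\<open>m\<close> counts the slots from which the scalar has already been pulled
    out.\<close>
  have "A (\<lambda>i\<in>{..<n}. if i < m then a \<odot>\<^bsub>E\<^esub> x else x) = a ^ m \<odot>\<^bsub>F\<^esub> A (\<lambda>i\<in>{..<n}. x)" if "m \<le> n" for m
    using that
  proof (induct m)
    case 0
    have "A (\<lambda>i\<in>{..<n}. x) \<in> carrier F"
      using multilinearD(1)[OF A, of "\<lambda>i\<in>{..<n}. x"] x by simp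
    from F.scal_one[OF this] show ?case
      by (simp only: not_less_zero if_False power_0)
  next
    case (Suc m)
    let ?z = "\<lambda>i\<in>{..<n}. if i < m then a \<odot>\<^bsub>E\<^esub> x else x"
    have z: "?z \<in> {..<n} \<rightarrow>\<^sub>E carrier E"
      using x by auto
    have "(\<lambda>i\<in>{..<n}. if i < Suc m then a \<odot>\<^bsub>E\<^esub> x else x) = ?z(m := a \<odot>\<^bsub>E\<^esub> x)" and eq: "?z(m := x) = ?z"
      using Suc(2) by (auto simp: fun_eq_iff less_Suc_eq)
    then have "A (\<lambda>i\<in>{..<n}. if i < Suc m then a \<odot>\<^bsub>E\<^esub> x else x) = A (?z(m := a \<odot>\<^bsub>E\<^esub> x))"
      by (simp only:)
    also have "\<dots> = a \<odot>\<^bsub>F\<^esub> A (?z(m := x))"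
      using Suc(2) by (intro multilinearD(3)[OF A z _ x]) auto
    also have "\<dots> = a \<odot>\<^bsub>F\<^esub> (a ^ m \<odot>\<^bsub>F\<^esub> A (\<lambda>i\<in>{..<n}. x))"
      unfolding eq Suc(1)[OF Suc_leD[OF Suc(2)]] ..
    also have "\<dots> = a ^ Suc m \<odot>\<^bsub>F\<^esub> A (\<lambda>i\<in>{..<n}. x)"
      using multilinearD(1)[OF A, of "\<lambda>i\<in>{..<n}. x"] x by (simp add: F.scal_scal)
    finally show ?case .
  qed
  from this[OF order_refl] have "A (\<lambda>i\<in>{..<n}. a \<odot>\<^bsub>E\<^esub> x) = a ^ n \<odot>\<^bsub>F\<^esub> A (\<lambda>i\<in>{..<n}. x)"
    by (simp add: restrict_def cong: if_cong)
  then show ?thesis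
    using x by (simp add: PA)
qed

lemma homogeneous_poly_zero:
  assumes E: "normed_module E" and F: "normed_module F"
  shows "homogeneous_poly n E F (\<lambda>x. \<zero>\<^bsub>F\<^esub>)"
proof -
  interpret F: normed_module F by fact
  have "multilinear n E F (\<lambda>x. \<zero>\<^bsub>F\<^esub>)"
    by (simp add: multilinear_def)
  then show ?thesis
    by (auto simp: homogeneous_poly_def)
qed

lemma homogeneous_poly_add:
  assumes E: "normed_module E" and F: "normed_module F"
    and P: "homogeneous_poly n E F P" and Q: "homogeneous_poly n E F Q"
  shows "homogeneous_poly n E F (\<lambda>x. P x \<oplus>\<^bsub>F\<^esub> Q x)"
proof -
  interpret E: normed_module E by fact
  interpret F: normed_module F by fact
  obtain A where A: "multilinear n E F A" and PA: "\<And>x. x \<in> carrier E \<Longrightarrow> P x = A (\<lambda>i\<in>{..<n}. x)"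
    using P by (auto simp: homogeneous_poly_def)
  obtain B where B: "multilinear n E F B" and QB: "\<And>x. x \<in> carrier E \<Longrightarrow> Q x = B (\<lambda>i\<in>{..<n}. x)"
    using Q by (auto simp: homogeneous_poly_def)
  have "multilinear n E F (\<lambda>x. A x \<oplus>\<^bsub>F\<^esub> B x)"
    unfolding multilinear_def
  proof (intro conjI funcsetI ballI allI impI)
    fix x assume x: "x \<in> {..<n} \<rightarrow>\<^sub>E carrier E"
    then show "A x \<oplus>\<^bsub>F\<^esub> B x \<in> carrier F"
      by (intro F.M.a_closed multilinearD(1)[OF A] multilinearD(1)[OF B])
  next
    fix x i y z
    assume x: "x \<in> {..<n} \<rightarrow>\<^sub>E carrier E" and i: "i < n" and y: "y \<in> carrier E" and z: "z \<in> carrier E"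
    note c = multilinearD(1)[OF A fun_upd_PiE_lessThan[OF x i]] multilinearD(1)[OF B fun_upd_PiE_lessThan[OF x i]]
    show "A (x(i := y \<oplus>\<^bsub>E\<^esub> z)) \<oplus>\<^bsub>F\<^esub> B (x(i := y \<oplus>\<^bsub>E\<^esub> z)) =
        (A (x(i := y)) \<oplus>\<^bsub>F\<^esub> B (x(i := y))) \<oplus>\<^bsub>F\<^esub> (A (x(i := z)) \<oplus>\<^bsub>F\<^esub> B (x(i := z)))"
      unfolding multilinearD(2)[OF A x i y z] multilinearD(2)[OF B x i y z]
      using c[OF y] c[OF z] by (simp add: F.M.a_ac)
  next
    fix x i y a
    assume x: "x \<in> {..<n} \<rightarrow>\<^sub>E carrier E" and i: "i < n" and y: "y \<in> carrier E"
    note c = multilinearD(1)[OF A fun_upd_PiE_lessThan[OF x i]] multilinearD(1)[OF B fun_upd_PiE_lessThan[OF x i]]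
    show "A (x(i := a \<odot>\<^bsub>E\<^esub> y)) \<oplus>\<^bsub>F\<^esub> B (x(i := a \<odot>\<^bsub>E\<^esub> y)) = a \<odot>\<^bsub>F\<^esub> (A (x(i := y)) \<oplus>\<^bsub>F\<^esub> B (x(i := y)))"
      unfolding multilinearD(3)[OF A x i y] multilinearD(3)[OF B x i y]
      using c[OF y] by (simp add: F.scal_add_right)
  qed
  then show ?thesis
    unfolding homogeneous_poly_def using PA QB by (intro exI[of _ "\<lambda>x. A x \<oplus>\<^bsub>F\<^esub> B x"]) auto
qed

lemma homogeneous_poly_smult:
  assumes E: "normed_module E" and F: "normed_module F" and P: "homogeneous_poly n E F P"
  shows "homogeneous_poly n E F (\<lambda>x. c \<odot>\<^bsub>F\<^esub> P x)"
proof -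
  interpret E: normed_module E by fact
  interpret F: normed_module F by fact
  obtain A where A: "multilinear n E F A" and PA: "\<And>x. x \<in> carrier E \<Longrightarrow> P x = A (\<lambda>i\<in>{..<n}. x)"
    using P by (auto simp: homogeneous_poly_def)
  have "multilinear n E F (\<lambda>x. c \<odot>\<^bsub>F\<^esub> A x)"
    unfolding multilinear_def
  proof (intro conjI funcsetI ballI allI impI)
    fix x assume x: "x \<in> {..<n} \<rightarrow>\<^sub>E carrier E"
    then show "c \<odot>\<^bsub>F\<^esub> A x \<in> carrier F"
      by (intro F.scal_closed multilinearD(1)[OF A])
  next
    fix x i y z
    assume x: "x \<in> {..<n} \<rightarrow>\<^sub>E carrier E" and i: "i < n" and y: "y \<in> carrier E" and z: "z \<in> carrier E"
    note c = multilinearD(1)[OF A fun_upd_PiE_lessThan[OF x i]]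
    show "c \<odot>\<^bsub>F\<^esub> A (x(i := y \<oplus>\<^bsub>E\<^esub> z)) = c \<odot>\<^bsub>F\<^esub> A (x(i := y)) \<oplus>\<^bsub>F\<^esub> c \<odot>\<^bsub>F\<^esub> A (x(i := z))"
      unfolding multilinearD(2)[OF A x i y z] using c[OF y] c[OF z] by (rule F.scal_add_right)
  next
    fix x i y a
    assume x: "x \<in> {..<n} \<rightarrow>\<^sub>E carrier E" and i: "i < n" and y: "y \<in> carrier E"
    show "c \<odot>\<^bsub>F\<^esub> A (x(i := a \<odot>\<^bsub>E\<^esub> y)) = a \<odot>\<^bsub>F\<^esub> (c \<odot>\<^bsub>F\<^esub> A (x(i := y)))"
      unfolding multilinearD(3)[OF A x i y]
      using multilinearD(1)[OF A fun_upd_PiE_lessThan[OF x i y]] by (simp add: F.scal_scal mult.commute)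
  qed
  then show ?thesis
    unfolding homogeneous_poly_def using PA by (intro exI[of _ "\<lambda>x. c \<odot>\<^bsub>F\<^esub> A x"]) auto
qed

text \<open>Decodes slot \<open>l\<close> as place \<open>l mod m\<close> of block
  \<open>l div m\<close>.\<close>

lemma block_index:
  fixes n m :: nat
  assumes "l < m * n"
  shows "l div m < n" and "l mod m < m" and "j < m \<Longrightarrow> i * m + j = l \<longleftrightarrow> i = l div m \<and> j = l mod m"
proof -
  show "l div m < n"
    using assms by (simp add: less_mult_imp_div_less mult.commute)
  show m: "l mod m < m"
    using assms by (metis less_nat_zero_code mod_less_divisor mult_0 neq0_conv)
  show "i * m + j = l \<longleftrightarrow> i = l div m \<and> j = l mod m" if "j < m"
    using that by auto
qed

text \<open>The arguments of the composed multilinear map come in \<open>n\<close> blocks of length \<open>m\<close>.\<close>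

lemma homogeneous_poly_compose:
  fixes G :: "('k::{real_normed_field,banach}, 'u) nspace" and E :: "('k, 'v) nspace" and F :: "('k, 'w) nspace"
  assumes G: "normed_module G" and E: "normed_module E" and F: "normed_module F"
    and P: "homogeneous_poly n E F P" and R: "homogeneous_poly m G E R"
  shows "homogeneous_poly (m * n) G F (\<lambda>x. P (R x))"
proof -
  interpret G: normed_module G by fact
  interpret E: normed_module E by fact
  interpret F: normed_module F by fact
  obtain A where A: "multilinear n E F A" and PA: "\<And>x. x \<in> carrier E \<Longrightarrow> P x = A (\<lambda>i\<in>{..<n}. x)"
    using P by (auto simp: homogeneous_poly_def)
  obtain B where B: "multilinear m G E B" and RB: "\<And>x. x \<in> carrier G \<Longrightarrow> R x = B (\<lambda>i\<in>{..<m}. x)"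
    using R by (auto simp: homogeneous_poly_def)
  define blk where "blk x i = (\<lambda>j\<in>{..<m}. x (i * m + j))" for x :: "nat \<Rightarrow> 'u" and i
  define D where "D x = A (\<lambda>i\<in>{..<n}. B (blk x i))" for x
  have idx: "i * m + j < m * n" if "i < n" "j < m" for i j
  proof -
    have "i * m + j < (i + 1) * m"
      using that by simp
    also have "\<dots> \<le> n * m"
      using that by (intro mult_le_mono1) simp
    finally show ?thesis
      by (simp add: mult.commute)
  qed
  have blk: "blk x i \<in> {..<m} \<rightarrow>\<^sub>E carrier G" if "x \<in> {..<m * n} \<rightarrow>\<^sub>E carrier G" "i < n" for x i
    unfolding blk_def restrict_PiE_iff using that idx by blast
  have blks: "(\<lambda>i\<in>{..<n}. B (blk x i)) \<in> {..<n} \<rightarrow>\<^sub>E carrier E" if "x \<in> {..<m * n} \<rightarrow>\<^sub>E carrier G" for x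
    unfolding restrict_PiE_iff using multilinearD(1)[OF B blk[OF that]] by blast
  \<comment> \<open>Changing one argument affects a single place of a single block, so linearity in
    it is linearity of \<open>B\<close> in that place followed by linearity of \<open>A\<close> in
    that block.\<close>
  have D_upd: "D (x(l := v)) = A ((\<lambda>i\<in>{..<n}. B (blk x i))(l div m := B ((blk x (l div m))(l mod m := v))))"
    if "l < m * n" for x l v
  proof -
    have blk_upd: "blk (x(l := v)) i = (if i = l div m then (blk x i)(l mod m := v) else blk x i)" for i
      using block_index[OF that] by (auto simp: blk_def fun_eq_iff)
    show ?thesis
      unfolding D_def blk_upd using block_index(1)[OF that]
      by (intro arg_cong[of _ _ A]) (rule ext, simp)
  qed
  have "multilinear (m * n) G F D"
    unfolding multilinear_def
  proof (intro conjI funcsetI ballI allI impI)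
    fix x assume "x \<in> {..<m * n} \<rightarrow>\<^sub>E carrier G"
    then show "D x \<in> carrier F"
      unfolding D_def by (intro multilinearD(1)[OF A blks])
  next
    fix x l y z
    assume x: "x \<in> {..<m * n} \<rightarrow>\<^sub>E carrier G" and l: "l < m * n" and y: "y \<in> carrier G" and z: "z \<in> carrier G"
    note idx = block_index(1,2)[OF l]
    note b = blk[OF x idx(1)]
    note c = multilinearD(1)[OF B fun_upd_PiE_lessThan[OF b idx(2)]]
    show "D (x(l := y \<oplus>\<^bsub>G\<^esub> z)) = D (x(l := y)) \<oplus>\<^bsub>F\<^esub> D (x(l := z))"
      unfolding D_upd[OF l] multilinearD(2)[OF B b idx(2) y z]
      by (rule multilinearD(2)[OF A blks[OF x] idx(1) c[OF y] c[OF z]])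
  next
    fix x l y a
    assume x: "x \<in> {..<m * n} \<rightarrow>\<^sub>E carrier G" and l: "l < m * n" and y: "y \<in> carrier G"
    note idx = block_index(1,2)[OF l]
    note b = blk[OF x idx(1)]
    note c = multilinearD(1)[OF B fun_upd_PiE_lessThan[OF b idx(2)]]
    show "D (x(l := a \<odot>\<^bsub>G\<^esub> y)) = a \<odot>\<^bsub>F\<^esub> D (x(l := y))"
      unfolding D_upd[OF l] multilinearD(3)[OF B b idx(2) y]
      by (rule multilinearD(3)[OF A blks[OF x] idx(1) c[OF y]])
  qed
  moreover have "P (R x) = D (\<lambda>i\<in>{..<m * n}. x)" if x: "x \<in> carrier G" for x
  proof -
    have "blk (\<lambda>i\<in>{..<m * n}. x) i = (\<lambda>j\<in>{..<m}. x)" if "i < n" for i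
      using idx[OF that] by (auto simp: blk_def fun_eq_iff)
    then have "(\<lambda>i\<in>{..<n}. B (blk (\<lambda>i\<in>{..<m * n}. x) i)) = (\<lambda>i\<in>{..<n}. R x)"
      using x by (intro ext) (simp add: RB)
    then show ?thesis
      using PA[OF homogeneous_poly_closed[OF G E R x]] by (simp add: D_def)
  qed
  ultimately show ?thesis
    unfolding homogeneous_poly_def by blast
qed

section \<open>Continuous polynomials and their norms\<close>

lemma cont_polys_iff:
  assumes "normed_module E" "normed_module F"
  shows "P \<in> cont_polys n E F \<longleftrightarrow> P \<in> extensional (carrier E) \<and> homogeneous_poly n E F P \<and>
    (\<forall>s l. converges_to E s l \<longrightarrow> converges_to F (\<lambda>k. P (s k)) (P l))"
  using continuous_map_iff_converges_to[OF assms, of P] homogeneous_poly_closed[OF assms, of n P]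
  by (auto simp: cont_polys_def PiE_def)

lemma cont_polysD:
  assumes "P \<in> cont_polys n E F"
  shows "x \<in> carrier E \<Longrightarrow> P x \<in> carrier F" "homogeneous_poly n E F P" "P \<in> extensional (carrier E)"
  using assms by (auto simp: cont_polys_def PiE_def)

lemma cont_polys_zero:
  assumes "normed_module E" "normed_module F"
  shows "(\<lambda>x\<in>carrier E. \<zero>\<^bsub>F\<^esub>) \<in> cont_polys n E F"
proof -
  interpret F: normed_module F by fact
  show ?thesis
    unfolding cont_polys_iff[OF assms]
  proof (intro conjI allI impI)
    show "homogeneous_poly n E F (\<lambda>x\<in>carrier E. \<zero>\<^bsub>F\<^esub>)"
      using homogeneous_poly_zero[OF assms] by (subst homogeneous_poly_cong[where Q = "\<lambda>x. \<zero>\<^bsub>F\<^esub>"]) auto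
    fix s l assume "converges_to E s l"
    then show "converges_to F (\<lambda>k. (\<lambda>x\<in>carrier E. \<zero>\<^bsub>F\<^esub>) (s k)) ((\<lambda>x\<in>carrier E. \<zero>\<^bsub>F\<^esub>) l)"
      using converges_to_carrier[of E s l] by (simp add: F.converges_to_const)
  qed simp
qed

lemma cont_polys_add:
  assumes "normed_module E" "normed_module F" and P: "P \<in> cont_polys n E F" and Q: "Q \<in> cont_polys n E F"
  shows "(\<lambda>x\<in>carrier E. P x \<oplus>\<^bsub>F\<^esub> Q x) \<in> cont_polys n E F"
proof -
  interpret F: normed_module F by fact
  show ?thesis
    unfolding cont_polys_iff[OF assms(1,2)]
  proof (intro conjI allI impI)
    show "homogeneous_poly n E F (\<lambda>x\<in>carrier E. P x \<oplus>\<^bsub>F\<^esub> Q x)"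
      using homogeneous_poly_add[OF assms(1,2) cont_polysD(2)[OF P] cont_polysD(2)[OF Q]]
      by (subst homogeneous_poly_cong[where Q = "\<lambda>x. P x \<oplus>\<^bsub>F\<^esub> Q x"]) auto
    fix s l assume s: "converges_to E s l"
    then have "converges_to F (\<lambda>k. P (s k) \<oplus>\<^bsub>F\<^esub> Q (s k)) (P l \<oplus>\<^bsub>F\<^esub> Q l)"
      using P Q unfolding cont_polys_iff[OF assms(1,2)] by (simp add: F.converges_to_add)
    then show "converges_to F (\<lambda>k. (\<lambda>x\<in>carrier E. P x \<oplus>\<^bsub>F\<^esub> Q x) (s k)) ((\<lambda>x\<in>carrier E. P x \<oplus>\<^bsub>F\<^esub> Q x) l)"
      using converges_to_carrier[OF s] by simp
  qed simp
qed

lemma cont_polys_smult: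
  assumes "normed_module E" "normed_module F" and P: "P \<in> cont_polys n E F"
  shows "(\<lambda>x\<in>carrier E. a \<odot>\<^bsub>F\<^esub> P x) \<in> cont_polys n E F"
proof -
  interpret F: normed_module F by fact
  show ?thesis
    unfolding cont_polys_iff[OF assms(1,2)]
  proof (intro conjI allI impI)
    show "homogeneous_poly n E F (\<lambda>x\<in>carrier E. a \<odot>\<^bsub>F\<^esub> P x)"
      using homogeneous_poly_smult[OF assms(1,2) cont_polysD(2)[OF P]]
      by (subst homogeneous_poly_cong[where Q = "\<lambda>x. a \<odot>\<^bsub>F\<^esub> P x"]) auto
    fix s l assume s: "converges_to E s l"
    then have "converges_to F (\<lambda>k. a \<odot>\<^bsub>F\<^esub> P (s k)) (a \<odot>\<^bsub>F\<^esub> P l)"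
      using P unfolding cont_polys_iff[OF assms(1,2)] by (simp add: F.converges_to_scal)
    then show "converges_to F (\<lambda>k. (\<lambda>x\<in>carrier E. a \<odot>\<^bsub>F\<^esub> P x) (s k)) ((\<lambda>x\<in>carrier E. a \<odot>\<^bsub>F\<^esub> P x) l)"
      using converges_to_carrier[OF s] by simp
  qed simp
qed

lemma cont_polys_compose:
  assumes G: "normed_module G" and E: "normed_module E" and F: "normed_module F"
    and P: "P \<in> cont_polys n E F" and R: "R \<in> cont_polys m G E"
  shows "compose (carrier G) P R \<in> cont_polys (m * n) G F"
  unfolding cont_polys_iff[OF G F]
proof (intro conjI allI impI)
  show "homogeneous_poly (m * n) G F (compose (carrier G) P R)"
    using homogeneous_poly_compose[OF G E F cont_polysD(2)[OF P] cont_polysD(2)[OF R]]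
    by (subst homogeneous_poly_cong[where Q = "\<lambda>x. P (R x)"]) (auto simp: compose_def)
  fix s l assume s: "converges_to G s l"
  then have "converges_to F (\<lambda>k. P (R (s k))) (P (R l))"
    using P R unfolding cont_polys_iff[OF G E] cont_polys_iff[OF E F] by simp
  then show "converges_to F (\<lambda>k. compose (carrier G) P R (s k)) (compose (carrier G) P R l)"
    using converges_to_carrier[OF s] by (simp add: compose_def)
qed simp

text \<open>Lets operators be treated as polynomials of degree 1, so that composition and norm
  estimates are proved only once.\<close>

lemma bounded_ops_subset_cont_polys:
  assumes "normed_module E" "normed_module F"
  shows "bounded_ops E F \<subseteq> cont_polys 1 E F"
proof
  interpret E: normed_module E by fact
  interpret F: normed_module F by fact
  fix u assume "u \<in> bounded_ops E F"
  then obtain C where u: "u \<in> carrier E \<rightarrow>\<^sub>E carrier F"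
    and add: "\<And>x y. x \<in> carrier E \<Longrightarrow> y \<in> carrier E \<Longrightarrow> u (x \<oplus>\<^bsub>E\<^esub> y) = u x \<oplus>\<^bsub>F\<^esub> u y"
    and scal: "\<And>a x. x \<in> carrier E \<Longrightarrow> u (a \<odot>\<^bsub>E\<^esub> x) = a \<odot>\<^bsub>F\<^esub> u x"
    and "\<forall>x\<in>carrier E. vnorm F (u x) \<le> C * vnorm E x"
    unfolding bounded_ops_def by auto
  then have C: "\<And>x. x \<in> carrier E \<Longrightarrow> vnorm F (u x) \<le> C * vnorm E x"
    by blast
  show "u \<in> cont_polys 1 E F"
    unfolding cont_polys_iff[OF assms]
  proof (intro conjI allI impI)
    show "u \<in> extensional (carrier E)"
      using u by (simp add: PiE_def)
    have "multilinear 1 E F (\<lambda>x. u (x 0))"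
      using u add scal by (auto simp: multilinear_def PiE_iff)
    then show "homogeneous_poly 1 E F u"
      unfolding homogeneous_poly_def by (intro exI[of _ "\<lambda>x. u (x 0)"]) auto
    fix s l assume s: "converges_to E s l"
    note c = converges_to_carrier[OF s]
    show "converges_to F (\<lambda>k. u (s k)) (u l)"
    proof (rule F.converges_toI)
      show "u (s k) \<in> carrier F" "u l \<in> carrier F" for k
        using u c by auto
      show "vnorm F (u (s k) \<ominus>\<^bsub>F\<^esub> u l) \<le> C * vnorm E (s k \<ominus>\<^bsub>E\<^esub> l)" for k
      proof -
        have "u (s k) \<ominus>\<^bsub>F\<^esub> u l = u (s k \<ominus>\<^bsub>E\<^esub> l)"
          using c PiE_mem[OF u] by (simp add: E.minus_eq_scal F.minus_eq_scal add scal)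
        then show ?thesis
          using C[of "s k \<ominus>\<^bsub>E\<^esub> l"] c by simp
      qed
      show "(\<lambda>k. C * vnorm E (s k \<ominus>\<^bsub>E\<^esub> l)) \<longlonglongrightarrow> 0"
        using s by (auto simp: converges_to_def intro: tendsto_mult_right_zero)
    qed
  qed
qed

text \<open>Continuity at the origin spreads by homogeneity. If \<open>P\<close> were unbounded on
  the unit ball, points \<open>x k\<close> with images of norm above \<open>(k + 1) ^ n\<close>,
  shrunk by the factor \<open>1 / (k + 1)\<close>, would tend to 0 while their images kept norm
  above 1.\<close>

lemma cont_poly_bounded:
  fixes E :: "('k::{real_normed_field,banach}, 'v) nspace" and F :: "('k, 'w) nspace"
  assumes E: "normed_module E" and F: "normed_module F" and P: "P \<in> cont_polys n E F" and n: "n \<ge> 1"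
  obtains C where "\<And>x. x \<in> carrier E \<Longrightarrow> vnorm E x \<le> 1 \<Longrightarrow> vnorm F (P x) \<le> C"
proof (rule ccontr)
  interpret E: normed_module E by fact
  interpret F: normed_module F by fact
  assume "\<not> thesis"
  then have "\<exists>x. x \<in> carrier E \<and> vnorm E x \<le> 1 \<and> real (Suc k) ^ n < vnorm F (P x)" for k
    using that not_le by blast
  then obtain x where x: "\<And>k. x k \<in> carrier E" "\<And>k. vnorm E (x k) \<le> 1" "\<And>k. real (Suc k) ^ n < vnorm F (P (x k))"
    by metis
  define y where "y k = of_real (1 / real (Suc k)) \<odot>\<^bsub>E\<^esub> x k" for k
  have y: "y k \<in> carrier E" for k
    using x by (simp add: y_def)
  have "converges_to E y \<zero>\<^bsub>E\<^esub>"
  proof (rule E.converges_toI)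
    show "vnorm E (y k \<ominus>\<^bsub>E\<^esub> \<zero>\<^bsub>E\<^esub>) \<le> 1 / real (Suc k)" for k
    proof -
      have "vnorm E (y k) = 1 / real (Suc k) * vnorm E (x k)"
        using E.vnorm_smult[OF x(1)[of k], of "of_real (1 / real (Suc k))"] by (simp add: y_def del: of_real_divide)
      also have "\<dots> \<le> 1 / real (Suc k) * 1"
        using x(2) by (intro mult_left_mono) auto
      finally show ?thesis
        using y by simp
    qed
    show "(\<lambda>k. 1 / real (Suc k)) \<longlonglongrightarrow> 0"
      using LIMSEQ_inverse_real_of_nat by (simp add: inverse_eq_divide)
  qed (use y in auto)
  then have lim: "converges_to F (\<lambda>k. P (y k)) (P \<zero>\<^bsub>E\<^esub>)"
    using P unfolding cont_polys_iff[OF E F] by blast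
  \<comment> \<open>Here degree at least 1 enters: \<open>0 ^ n = 0\<close> forces the value 0 at
    the origin.\<close>
  have "P \<zero>\<^bsub>E\<^esub> = \<zero>\<^bsub>F\<^esub>"
    using homogeneous_poly_scal[OF E F cont_polysD(2)[OF P] E.M.zero_closed, of 0] n
      cont_polysD(1)[OF P E.M.zero_closed] by (simp add: power_0_left)
  then have "(\<lambda>k. vnorm F (P (y k))) \<longlonglongrightarrow> 0"
    using F.vnorm_converges[OF lim] by simp
  from order_tendstoD(2)[OF this zero_less_one] obtain k where k: "vnorm F (P (y k)) < 1"
    using eventually_happens'[OF sequentially_bot] by blast
  have norm_pow: "norm (of_real (1 / real (Suc k)) ^ n :: 'k) = (1 / real (Suc k)) ^ n"
    by (simp add: norm_power del: of_real_divide)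
  have "vnorm F (P (y k)) = (1 / real (Suc k)) ^ n * vnorm F (P (x k))"
    unfolding y_def homogeneous_poly_scal[OF E F cont_polysD(2)[OF P] x(1)]
      F.vnorm_smult[OF cont_polysD(1)[OF P x(1)]] norm_pow ..
  then have "vnorm F (P (x k)) = vnorm F (P (y k)) * real (Suc k) ^ n"
    by (simp add: power_one_over)
  also have "\<dots> < 1 * real (Suc k) ^ n"
    by (rule mult_strict_right_mono[OF k]) simp
  finally have "vnorm F (P (x k)) < real (Suc k) ^ n"
    by simp
  then show False
    using x(3)[of k] by simp
qed

text \<open>A bound \<open>C\<close> has to be supplied since the supremum of an unbounded set of
  reals need not dominate its elements.\<close>

lemma sup_norm_upper:
  assumes "\<And>x. x \<in> carrier E \<Longrightarrow> vnorm E x \<le> 1 \<Longrightarrow> vnorm F (f x) \<le> C" "x \<in> carrier E" "vnorm E x \<le> 1"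
  shows "vnorm F (f x) \<le> sup_norm E F f"
  unfolding sup_norm_def using assms by (intro cSUP_upper) (auto simp: bdd_above_def)

lemma sup_norm_least:
  assumes "normed_module E" "\<And>x. x \<in> carrier E \<Longrightarrow> vnorm E x \<le> 1 \<Longrightarrow> vnorm F (f x) \<le> B"
  shows "sup_norm E F f \<le> B"
proof -
  interpret E: normed_module E by fact
  have "\<zero>\<^bsub>E\<^esub> \<in> {x \<in> carrier E. vnorm E x \<le> 1}"
    by simp
  then show ?thesis
    unfolding sup_norm_def using assms(2) by (intro cSUP_least) auto
qed

text \<open>Normalizes \<open>x\<close> to a unit vector. It is stated for any bounded
  \<open>n\<close>-homogeneous function, so that it applies to induced maps without a multilinear
  representation.\<close>

lemma homogeneous_norm_le:
  fixes E :: "('k::{real_normed_field,banach}, 'v) nspace" and F :: "('k, 'w) nspace"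
  assumes E: "normed_module E" and F: "normed_module F" and n: "n \<ge> 1"
    and closed: "\<And>x. x \<in> carrier E \<Longrightarrow> f x \<in> carrier F"
    and scal: "\<And>a x. x \<in> carrier E \<Longrightarrow> f (a \<odot>\<^bsub>E\<^esub> x) = a ^ n \<odot>\<^bsub>F\<^esub> f x"
    and C: "\<And>x. x \<in> carrier E \<Longrightarrow> vnorm E x \<le> 1 \<Longrightarrow> vnorm F (f x) \<le> C"
    and x: "x \<in> carrier E"
  shows "vnorm F (f x) \<le> sup_norm E F f * vnorm E x ^ n"
proof -
  interpret E: normed_module E by fact
  interpret F: normed_module F by fact
  show ?thesis
  proof (cases "vnorm E x = 0")
    case True
    then have "f x = \<zero>\<^bsub>F\<^esub>"
      using x scal[OF E.M.zero_closed, of 0] closed n by (simp add: E.vnorm_eq_0 power_0_left)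
    then show ?thesis
      using True n by (simp add: power_0_left)
  next
    case False
    then have pos: "vnorm E x > 0"
      using E.vnorm_nonneg[OF x] by simp
    let ?c = "of_real (1 / vnorm E x) :: 'k"
    have norm_c: "norm ?c = 1 / vnorm E x"
      using pos by (simp del: of_real_divide)
    have "vnorm E (?c \<odot>\<^bsub>E\<^esub> x) \<le> 1"
      using x pos unfolding E.vnorm_smult[OF x] norm_c by simp
    then have "vnorm F (f (?c \<odot>\<^bsub>E\<^esub> x)) \<le> sup_norm E F f"
      using x by (intro sup_norm_upper[OF C]) auto
    moreover have "vnorm F (f (?c \<odot>\<^bsub>E\<^esub> x)) = (1 / vnorm E x) ^ n * vnorm F (f x)"
      unfolding scal[OF x] F.vnorm_smult[OF closed[OF x]] norm_power norm_c ..
    then have "vnorm E x ^ n * vnorm F (f (?c \<odot>\<^bsub>E\<^esub> x)) = vnorm F (f x)"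
      using pos by (simp add: power_one_over)
    ultimately show ?thesis
      using mult_left_mono[of "vnorm F (f (?c \<odot>\<^bsub>E\<^esub> x))" "sup_norm E F f" "vnorm E x ^ n"] pos
      by (simp only: mult.commute zero_le_power less_imp_le)
  qed
qed

lemma cont_poly_norm_le:
  assumes "normed_module E" "normed_module F" "P \<in> cont_polys n E F" "n \<ge> 1" "x \<in> carrier E"
  shows "vnorm F (P x) \<le> sup_norm E F P * vnorm E x ^ n"
proof -
  obtain C where "\<And>x. x \<in> carrier E \<Longrightarrow> vnorm E x \<le> 1 \<Longrightarrow> vnorm F (P x) \<le> C"
    using cont_poly_bounded[OF assms(1-4)] by blast
  then show ?thesis
    using assms homogeneous_poly_scal[OF assms(1,2) cont_polysD(2)[OF assms(3)]] cont_polysD(1)[OF assms(3)]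
    by (intro homogeneous_norm_le) auto
qed

lemma sup_norm_nonneg:
  assumes "normed_module E" "normed_module F" "\<And>x. x \<in> carrier E \<Longrightarrow> f x \<in> carrier F"
    and "\<And>x. x \<in> carrier E \<Longrightarrow> vnorm E x \<le> 1 \<Longrightarrow> vnorm F (f x) \<le> C"
  shows "0 \<le> sup_norm E F f"
proof -
  interpret E: normed_module E by fact
  interpret F: normed_module F by fact
  have "0 \<le> vnorm F (f \<zero>\<^bsub>E\<^esub>)"
    using assms(3) by (simp add: F.vnorm_nonneg)
  also have "\<dots> \<le> sup_norm E F f"
    by (rule sup_norm_upper[OF assms(4)]) auto
  finally show ?thesis .
qed

text \<open>The error is relative to the \<open>n\<close>-th power of the norm, hence uniform on
  bounded sets only. This is enough, since a convergent sequence stays in some ball of radius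
  \<open>r\<close>.\<close>

lemma continuous_uniform_limit:
  assumes E: "normed_module E" and F: "normed_module F"
    and Q: "\<And>k s l. converges_to E s l \<Longrightarrow> converges_to F (\<lambda>i. Q k (s i)) (Q k l)"
    and P: "\<And>x. x \<in> carrier E \<Longrightarrow> P x \<in> carrier F"
    and unif: "\<And>\<epsilon>. \<epsilon> > 0 \<Longrightarrow> \<exists>k. \<forall>x\<in>carrier E. vnorm F (Q k x \<ominus>\<^bsub>F\<^esub> P x) \<le> \<epsilon> * vnorm E x ^ n"
    and s: "converges_to E s l"
  shows "converges_to F (\<lambda>i. P (s i)) (P l)"
proof -
  interpret E: normed_module E by fact
  interpret F: normed_module F by fact
  note c = converges_to_carrier[OF s]
  have QF: "Q k x \<in> carrier F" if "x \<in> carrier E" for k x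
    using converges_to_carrier(2)[OF Q[OF E.converges_to_const[OF that]]] .
  have "Bseq (\<lambda>i. vnorm E (s i))"
    using E.vnorm_converges[OF s] convergent_imp_Bseq convergentI by blast
  then obtain r where r: "r > 0" "\<And>i. norm (vnorm E (s i)) \<le> r"
    by (auto elim: BseqE)
  have sr: "vnorm E (s i) \<le> r" for i
    using r(2)[of i] by simp
  have lr: "vnorm E l \<le> r"
    using E.converges_to_bound[OF s, of 0 r] sr by simp
  have "(\<lambda>i. vnorm F (P (s i) \<ominus>\<^bsub>F\<^esub> P l)) \<longlonglongrightarrow> 0"
  proof (rule LIMSEQ_I)
    fix e :: real assume "e > 0"
    \<comment> \<open>Chosen so that the error on the ball of radius \<open>r\<close> is at most
      \<open>e / 3\<close>; two such errors and one from the continuity of \<open>Q k\<close> add up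
      to less than \<open>e\<close>.\<close>
    define \<epsilon> where "\<epsilon> = e / (3 * r ^ n)"
    have \<epsilon>: "\<epsilon> > 0" "\<epsilon> * r ^ n = e / 3"
      using \<open>e > 0\<close> r by (simp_all add: \<epsilon>_def)
    obtain k where k: "\<And>x. x \<in> carrier E \<Longrightarrow> vnorm F (Q k x \<ominus>\<^bsub>F\<^esub> P x) \<le> \<epsilon> * vnorm E x ^ n"
      using unif[OF \<epsilon>(1)] by blast
    have near: "vnorm F (Q k x \<ominus>\<^bsub>F\<^esub> P x) \<le> e / 3" if "x \<in> carrier E" "vnorm E x \<le> r" for x
    proof -
      have "\<epsilon> * vnorm E x ^ n \<le> \<epsilon> * r ^ n"
        using that E.vnorm_nonneg \<epsilon> by (intro mult_left_mono power_mono) auto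
      with k[OF that(1)] \<epsilon>(2) show ?thesis by simp
    qed
    have "(\<lambda>i. vnorm F (Q k (s i) \<ominus>\<^bsub>F\<^esub> Q k l)) \<longlonglongrightarrow> 0"
      using Q[OF s] by (simp add: converges_to_def)
    from LIMSEQ_D[OF this, of "e / 3"] \<open>e > 0\<close> obtain N
      where N: "\<And>i. i \<ge> N \<Longrightarrow> norm (vnorm F (Q k (s i) \<ominus>\<^bsub>F\<^esub> Q k l) - 0) < e / 3"
      by auto
    have "norm (vnorm F (P (s i) \<ominus>\<^bsub>F\<^esub> P l) - 0) < e" if "i \<ge> N" for i
    proof -
      have "vnorm F (P (s i) \<ominus>\<^bsub>F\<^esub> P l) \<le> vnorm F (P (s i) \<ominus>\<^bsub>F\<^esub> Q k (s i)) + vnorm F (Q k (s i) \<ominus>\<^bsub>F\<^esub> P l)"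
        using c P QF by (intro F.vnorm_triangle_diff) auto
      moreover have "vnorm F (Q k (s i) \<ominus>\<^bsub>F\<^esub> P l) \<le> vnorm F (Q k (s i) \<ominus>\<^bsub>F\<^esub> Q k l) + vnorm F (Q k l \<ominus>\<^bsub>F\<^esub> P l)"
        using c P QF by (intro F.vnorm_triangle_diff) auto
      moreover have "vnorm F (P (s i) \<ominus>\<^bsub>F\<^esub> Q k (s i)) = vnorm F (Q k (s i) \<ominus>\<^bsub>F\<^esub> P (s i))"
        using c P QF by (intro F.vnorm_minus_commute) auto
      ultimately show ?thesis
        using N[OF that] near[OF c(1) sr, of i] near[OF c(2) lr] c P F.vnorm_nonneg[of "P (s i) \<ominus>\<^bsub>F\<^esub> P l"] by simp
    qed
    then show "\<exists>N. \<forall>i\<ge>N. norm (vnorm F (P (s i) \<ominus>\<^bsub>F\<^esub> P l) - 0) < e"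
      by blast
  qed
  then show ?thesis
    using c P by (auto simp: converges_to_def)
qed

section \<open>Sequence classes\<close>

lemma sequence_classD:
  assumes "sequence_class X" "banach_module E"
  shows "banach_module (X E)" and "null_seqs E \<subseteq> carrier (X E)"
    and "x \<in> carrier (X E) \<Longrightarrow> x j \<in> carrier E"
    and "x \<in> carrier (X E) \<Longrightarrow> y \<in> carrier (X E) \<Longrightarrow> x \<oplus>\<^bsub>X E\<^esub> y = (\<lambda>j. x j \<oplus>\<^bsub>E\<^esub> y j)"
    and "x \<in> carrier (X E) \<Longrightarrow> a \<odot>\<^bsub>X E\<^esub> x = (\<lambda>j. a \<odot>\<^bsub>E\<^esub> x j)"
    and "x \<in> carrier (X E) \<Longrightarrow> vnorm E (x j) \<le> vnorm (X E) x"
proof -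
  show "banach_module (X E)" "null_seqs E \<subseteq> carrier (X E)"
    using assms by (auto simp: sequence_class_def)
  have emb: "norm_embedded (X E) (bounded_seqs E)"
    using assms by (auto simp: sequence_class_def)
  {
    fix x assume x: "x \<in> carrier (X E)"
    then have b: "range x \<subseteq> carrier E" "bdd_above (range (\<lambda>j. vnorm E (x j)))"
      using emb by (auto simp: norm_embedded_def bounded_seqs_def)
    show "x j \<in> carrier E" for j
      using b by auto
    have "vnorm E (x j) \<le> (SUP j. vnorm E (x j))"
      using b(2) by (rule cSUP_upper[OF UNIV_I])
    also have "\<dots> \<le> vnorm (X E) x"
      using emb x by (auto simp: norm_embedded_def bounded_seqs_def)
    finally show "vnorm E (x j) \<le> vnorm (X E) x" .
    show "a \<odot>\<^bsub>X E\<^esub> x = (\<lambda>j. a \<odot>\<^bsub>E\<^esub> x j)"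
      using emb x by (auto simp: norm_embedded_def bounded_seqs_def)
    show "x \<oplus>\<^bsub>X E\<^esub> y = (\<lambda>j. x j \<oplus>\<^bsub>E\<^esub> y j)" if "y \<in> carrier (X E)" for y
      using emb x that by (auto simp: norm_embedded_def bounded_seqs_def)
  }
qed

lemma banach_normed: "banach_module E \<Longrightarrow> normed_module E"
  by (simp add: banach_module_def)

text \<open>\<open>norm_embedded\<close> compares sums and multiples but not zeros, so the zero of
  X(E) is found as a multiple by the scalar 0.\<close>

lemma sequence_class_zero:
  assumes "sequence_class X" "banach_module E"
  shows "\<zero>\<^bsub>X E\<^esub> = (\<lambda>j. \<zero>\<^bsub>E\<^esub>)"
proof -
  interpret E: banach_module E by fact
  interpret XE: banach_module "X E" by (rule sequence_classD(1)[OF assms])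
  have "\<zero>\<^bsub>X E\<^esub> = 0 \<odot>\<^bsub>X E\<^esub> \<zero>\<^bsub>X E\<^esub>"
    by simp
  also have "\<dots> = (\<lambda>j. 0 \<odot>\<^bsub>E\<^esub> (\<zero>\<^bsub>X E\<^esub> j))"
    by (rule sequence_classD(5)[OF assms]) simp
  also have "\<dots> = (\<lambda>j. \<zero>\<^bsub>E\<^esub>)"
    using sequence_classD(3)[OF assms XE.M.zero_closed] by simp
  finally show ?thesis .
qed

lemma sequence_class_minus:
  assumes "sequence_class X" "banach_module E" "x \<in> carrier (X E)" "y \<in> carrier (X E)"
  shows "x \<ominus>\<^bsub>X E\<^esub> y = (\<lambda>j. x j \<ominus>\<^bsub>E\<^esub> y j)"
proof -
  interpret E: banach_module E by fact
  interpret XE: banach_module "X E" by (rule sequence_classD(1)[OF assms(1,2)])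
  note D = sequence_classD[OF assms(1,2)]
  show ?thesis
    unfolding XE.minus_eq_scal[OF assms(3,4)]
    unfolding D(4)[OF assms(3) XE.scal_closed[OF assms(4)]]
    unfolding D(5)[OF assms(4)]
    using D(3)[OF assms(3)] D(3)[OF assms(4)] by (simp add: E.minus_eq_scal)
qed

lemma sequence_class_finsum:
  assumes "sequence_class X" "banach_module E" "finite I" "f \<in> I \<rightarrow> carrier (X E)"
  shows "(\<Oplus>\<^bsub>X E\<^esub>i\<in>I. f i) j = (\<Oplus>\<^bsub>E\<^esub>i\<in>I. f i j)"
proof -
  interpret E: banach_module E by fact
  interpret XE: banach_module "X E" by (rule sequence_classD(1)[OF assms(1,2)])
  note D = sequence_classD[OF assms(1,2)]
  show ?thesis
    using assms(3,4)
  proof (induct set: finite)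
    case empty
    then show ?case
      by (simp add: sequence_class_zero[OF assms(1,2)])
  next
    case (insert i I)
    then show ?case
      using D(3) by (simp add: D(4) Pi_def)
  qed
qed

lemma sequence_class_converges:
  assumes "sequence_class X" "banach_module E" and s: "converges_to (X E) s l"
  shows "converges_to E (\<lambda>k. s k j) (l j)"
proof -
  interpret E: banach_module E by fact
  interpret XE: banach_module "X E" by (rule sequence_classD(1)[OF assms(1,2)])
  note D = sequence_classD[OF assms(1,2)] and c = converges_to_carrier[OF s]
  show ?thesis
  proof (rule E.converges_toI)
    show "vnorm E (s k j \<ominus>\<^bsub>E\<^esub> l j) \<le> vnorm (X E) (s k \<ominus>\<^bsub>X E\<^esub> l)" for k
      using D(6)[OF XE.M.minus_closed[OF c], of k j]
      unfolding fun_cong[OF sequence_class_minus[OF assms(1,2) c]] .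
    show "(\<lambda>k. vnorm (X E) (s k \<ominus>\<^bsub>X E\<^esub> l)) \<longlonglongrightarrow> 0"
      using s by (simp add: converges_to_def)
  qed (use c D(3) in auto)
qed

definition first_seq :: "('k::{real_normed_field,banach}, 'v) nspace \<Rightarrow> 'v \<Rightarrow> nat \<Rightarrow> 'v" where
  "first_seq E x = (\<lambda>j. if j = 0 then x else \<zero>\<^bsub>E\<^esub>)"

lemma first_seq_in:
  assumes "sequence_class X" "banach_module E" "x \<in> carrier E"
  shows "first_seq E x \<in> carrier (X E)"
proof -
  interpret E: banach_module E by fact
  have "first_seq E x \<in> null_seqs E"
    using assms(3) by (auto simp: null_seqs_def first_seq_def intro!: exI[of _ 1])
  then show ?thesis
    using sequence_classD(2)[OF assms(1,2)] by blast
qed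

lemma induced_map_apply [simp]: "x \<in> carrier (X E) \<Longrightarrow> induced_map X E f x = (\<lambda>j. f (x j))"
  by (simp add: induced_map_def)

lemma scalar_space_simps [simp]:
  "carrier scalar_space = range Inl" "\<zero>\<^bsub>scalar_space\<^esub> = Inl 0"
  "x \<oplus>\<^bsub>scalar_space\<^esub> y = Inl (projl x + projl y)" "a \<odot>\<^bsub>scalar_space\<^esub> x = Inl (a * projl x)"
  "vnorm scalar_space x = norm (projl x)"
  by (simp_all add: scalar_space_def)

definition line_map :: "('k::{real_normed_field,banach}, 'a) bspace \<Rightarrow> 'k + 'a \<Rightarrow> 'k + 'a \<Rightarrow> 'k + 'a" where
  "line_map F b = (\<lambda>z\<in>carrier (scalar_space :: ('k, 'a) bspace). projl z \<odot>\<^bsub>F\<^esub> b)"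

lemma line_map:
  assumes "normed_module F" "b \<in> carrier F"
  shows "line_map F b \<in> bounded_ops scalar_space F" and "sup_norm scalar_space F (line_map F b) \<le> vnorm F b"
proof -
  interpret F: normed_module F by fact
  show "line_map F b \<in> bounded_ops scalar_space F"
    unfolding bounded_ops_def
  proof (intro CollectI conjI ballI allI)
    show "line_map F b \<in> carrier scalar_space \<rightarrow>\<^sub>E carrier F"
      using assms(2) by (auto simp: line_map_def)
    show "\<exists>C. \<forall>x\<in>carrier scalar_space. vnorm F (line_map F b x) \<le> C * vnorm scalar_space x"
      using assms(2) by (intro exI[of _ "vnorm F b"]) (auto simp: line_map_def F.vnorm_smult)
  qed (use assms(2) in \<open>auto simp: line_map_def F.scal_add_left F.scal_scal\<close>)
  show "sup_norm scalar_space F (line_map F b) \<le> vnorm F b"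
  proof (rule sup_norm_least)
    show "normed_module scalar_space"
      by (rule banach_normed[OF banach_module_scalar_space])
    fix z assume "z \<in> carrier (scalar_space :: ('a, 'b) bspace)" "vnorm (scalar_space :: ('a, 'b) bspace) z \<le> 1"
    then show "vnorm F (line_map F b z) \<le> vnorm F b"
      using assms(2) F.vnorm_nonneg[OF assms(2)] mult_left_le_one_le[of "vnorm F b" "norm (projl z)"]
      by (auto simp: line_map_def F.vnorm_smult)
  qed
qed

lemma polynomially_stableD:
  assumes "polynomially_stable X" "n \<ge> 1" "banach_module E" "banach_module F" "P \<in> cont_polys n E F"
  shows "x \<in> carrier (X E) \<Longrightarrow> (\<lambda>j. P (x j)) \<in> carrier (X F)"
    and "induced_map X E P \<in> cont_polys n (X E) (X F)"
    and "sup_norm (X E) (X F) (induced_map X E P) = sup_norm E F P"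
  using assms unfolding polynomially_stable_def by blast+

lemma vnorm_first_seq_le:
  assumes "sequence_class X" "polynomially_stable X" "banach_module E" "x \<in> carrier E"
  shows "vnorm (X E) (first_seq E x) \<le> vnorm E x"
proof -
  let ?K = "scalar_space :: ('a, 'b) bspace"
  interpret E: banach_module E by fact
  have K: "banach_module ?K"
    by (rule banach_module_scalar_space)
  have u: "line_map E x \<in> cont_polys 1 ?K E"
    using bounded_ops_subset_cont_polys[OF banach_normed[OF K] E.normed_module_axioms]
      line_map(1)[OF E.normed_module_axioms assms(4)] by blast
  note st = polynomially_stableD[OF assms(2) order_refl K assms(3) u]
  have e: "first_seq ?K (Inl 1) \<in> carrier (X ?K)"
    by (rule first_seq_in[OF assms(1) K]) simp
  have "vnorm (X ?K) (scalar_seq (\<lambda>i. if i = 0 then 1 else 0)) = 1"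
    using assms(1) by (simp add: sequence_class_def)
  also have "scalar_seq (\<lambda>i. if i = 0 then 1 else 0) = first_seq ?K (Inl 1)"
    by (auto simp: scalar_seq_def first_seq_def)
  finally have norm_e: "vnorm (X ?K) (first_seq ?K (Inl 1)) = 1" .
  \<comment> \<open>The line through \<open>x\<close> sends the first unit sequence, of norm 1 in
    X(K), to \<open>first_seq E x\<close>. The norm of the induced map, by stability that of the
    line, therefore bounds the norm of \<open>first_seq E x\<close>.\<close>
  have "induced_map X ?K (line_map E x) (first_seq ?K (Inl 1)) = first_seq E x"
    using e assms(4) by (auto simp: first_seq_def line_map_def)
  then have "vnorm (X E) (first_seq E x) \<le> sup_norm (X ?K) (X E) (induced_map X ?K (line_map E x))"
    using cont_poly_norm_le[OF _ _ st(2) order_refl e] norm_e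
      banach_normed[OF sequence_classD(1)[OF assms(1) K]] banach_normed[OF sequence_classD(1)[OF assms(1,3)]]
    by simp
  then show ?thesis
    using st(3) line_map(2)[OF E.normed_module_axioms assms(4)] by simp
qed

text \<open>A summing polynomial induces a bounded map because the polarization of the induced map is
  separately closed: convergence in \<open>X(E)\<close> and in \<open>Y(F)\<close> entails coordinatewise convergence.\<close>

lemma summing_poly_bounded:
  fixes X Y :: "('k::{real_normed_field,banach}, 'a) seq_rule"
  assumes X: "sequence_class X" and Y: "sequence_class Y" and E: "banach_module E" and F: "banach_module F"
    and P: "P \<in> cont_polys n E F" and summing: "\<And>x. x \<in> carrier (X E) \<Longrightarrow> (\<lambda>j. P (x j)) \<in> carrier (Y F)"
  obtains C where "\<And>x. x \<in> carrier (X E) \<Longrightarrow> vnorm (X E) x \<le> 1 \<Longrightarrow> vnorm (Y F) (\<lambda>j. P (x j)) \<le> C"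
proof -
  interpret E: banach_module E by fact
  interpret F: banach_module F by fact
  interpret XE: banach_module "X E" by (rule sequence_classD(1)[OF X E])
  interpret YF: banach_module "Y F" by (rule sequence_classD(1)[OF Y F])
  note XD = sequence_classD[OF X E] and YD = sequence_classD[OF Y F]
  note En = E.normed_module_axioms and Fn = F.normed_module_axioms
  let ?N = "{..<n}"
  \<comment> \<open>The polarization of the induced map, formed in the sequence spaces before that
    map is known to be a polynomial.\<close>
  define A where "A = polarize n (X E) (Y F) (\<lambda>x j. P (x j))"
  define a where "a = polarize n E F P"
  note a = multilinear_polarize[OF En Fn cont_polysD(2)[OF P], folded a_def]
  have sum_closed: "(\<Oplus>\<^bsub>X E\<^esub>i\<in>S. z i) \<in> carrier (X E)" if "z \<in> ?N \<rightarrow>\<^sub>E carrier (X E)" "S \<subseteq> ?N" for z S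
    using that by (intro XE.M.finsum_closed) auto
  have term_closed: "(- 1) ^ (n - card S) \<odot>\<^bsub>Y F\<^esub> (\<lambda>j. P ((\<Oplus>\<^bsub>X E\<^esub>i\<in>S. z i) j)) \<in> carrier (Y F)"
    if "z \<in> ?N \<rightarrow>\<^sub>E carrier (X E)" "S \<in> Pow ?N" for z S
    using that by (intro YF.scal_closed summing sum_closed) auto
  have A_closed: "A z \<in> carrier (Y F)" if "z \<in> ?N \<rightarrow>\<^sub>E carrier (X E)" for z
    unfolding A_def polarize_def by (intro YF.M.finsum_closed funcsetI term_closed that)
  define co where "co z j = (\<lambda>i\<in>?N. z i j)" for z :: "nat \<Rightarrow> nat \<Rightarrow> 'k + 'a" and j :: nat
  have co: "co z j \<in> ?N \<rightarrow>\<^sub>E carrier E" if "z \<in> ?N \<rightarrow>\<^sub>E carrier (X E)" for z j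
    unfolding co_def restrict_PiE_iff using that XD(3) by blast
  \<comment> \<open>Operations in X(E) and Y(F) are coordinatewise, so polarization commutes with
    taking coordinate \<open>j\<close>; all multilinear identities thus pass from \<open>a\<close>
    to \<open>A\<close>.\<close>
  have A_coord: "A z j = a (co z j)" if z: "z \<in> ?N \<rightarrow>\<^sub>E carrier (X E)" for z j
  proof -
    have "A z j = (\<Oplus>\<^bsub>F\<^esub>S\<in>Pow ?N. ((- 1) ^ (n - card S) \<odot>\<^bsub>Y F\<^esub> (\<lambda>j. P ((\<Oplus>\<^bsub>X E\<^esub>i\<in>S. z i) j))) j)"
      unfolding A_def polarize_def by (intro sequence_class_finsum[OF Y F] funcsetI term_closed z) auto
    also have "\<dots> = a (co z j)"
      unfolding a_def polarize_def
    proof (rule F.M.finsum_cong')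
      fix S assume S: "S \<in> Pow ?N"
      have zS: "z \<in> S \<rightarrow> carrier (X E)"
        using S z by auto
      have "(\<Oplus>\<^bsub>X E\<^esub>i\<in>S. z i) j = (\<Oplus>\<^bsub>E\<^esub>i\<in>S. z i j)"
        using S zS by (intro sequence_class_finsum[OF X E]) (auto intro: finite_subset)
      also have "\<dots> = (\<Oplus>\<^bsub>E\<^esub>i\<in>S. co z j i)"
        using S co[OF z, of j] by (intro E.M.finsum_cong') (auto simp: co_def)
      finally have "(\<Oplus>\<^bsub>X E\<^esub>i\<in>S. z i) j = (\<Oplus>\<^bsub>E\<^esub>i\<in>S. co z j i)" .
      then show "((- 1) ^ (n - card S) \<odot>\<^bsub>Y F\<^esub> (\<lambda>j. P ((\<Oplus>\<^bsub>X E\<^esub>i\<in>S. z i) j))) j =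
          (- 1) ^ (n - card S) \<odot>\<^bsub>F\<^esub> P (\<Oplus>\<^bsub>E\<^esub>i\<in>S. co z j i)"
        using YD(5)[OF summing[OF sum_closed[OF z]], of S] S by simp
    next
      show "(\<lambda>S. (- 1) ^ (n - card S) \<odot>\<^bsub>F\<^esub> P (\<Oplus>\<^bsub>E\<^esub>i\<in>S. co z j i)) \<in> Pow ?N \<rightarrow> carrier F"
      proof
        fix S assume "S \<in> Pow ?N"
        then have "(\<Oplus>\<^bsub>E\<^esub>i\<in>S. co z j i) \<in> carrier E"
          using co[OF z, of j] by (intro E.M.finsum_closed) auto
        then show "(- 1) ^ (n - card S) \<odot>\<^bsub>F\<^esub> P (\<Oplus>\<^bsub>E\<^esub>i\<in>S. co z j i) \<in> carrier F"
          by (intro F.scal_closed cont_polysD(1)[OF P])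
      qed
    qed simp
    finally show ?thesis .
  qed
  have co_upd: "co (z(i := u)) j = (co z j)(i := u j)" if "i < n" for z i u j
    using that by (auto simp: co_def fun_eq_iff)
  have A: "multilinear n (X E) (Y F) A"
    unfolding multilinear_def
  proof (intro conjI funcsetI ballI allI impI)
    fix z i u v
    assume z: "z \<in> ?N \<rightarrow>\<^sub>E carrier (X E)" and i: "i < n" and u: "u \<in> carrier (X E)" and v: "v \<in> carrier (X E)"
    note upd = fun_upd_PiE_lessThan[OF z i]
    show "A (z(i := u \<oplus>\<^bsub>X E\<^esub> v)) = A (z(i := u)) \<oplus>\<^bsub>Y F\<^esub> A (z(i := v))"
    proof
      fix j
      have "A (z(i := u \<oplus>\<^bsub>X E\<^esub> v)) j = a ((co z j)(i := u j \<oplus>\<^bsub>E\<^esub> v j))"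
        unfolding A_coord[OF upd[OF XE.M.a_closed[OF u v]]] co_upd[OF i] fun_cong[OF XD(4)[OF u v]] ..
      also have "\<dots> = a ((co z j)(i := u j)) \<oplus>\<^bsub>F\<^esub> a ((co z j)(i := v j))"
        by (rule multilinearD(2)[OF a(1) co[OF z] i XD(3)[OF u] XD(3)[OF v]])
      also have "\<dots> = (A (z(i := u)) \<oplus>\<^bsub>Y F\<^esub> A (z(i := v))) j"
        unfolding YD(4)[OF A_closed[OF upd[OF u]] A_closed[OF upd[OF v]]]
          A_coord[OF upd[OF u]] A_coord[OF upd[OF v]] co_upd[OF i] ..
      finally show "A (z(i := u \<oplus>\<^bsub>X E\<^esub> v)) j = (A (z(i := u)) \<oplus>\<^bsub>Y F\<^esub> A (z(i := v))) j" .
    qed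
  next
    fix z i u c
    assume z: "z \<in> ?N \<rightarrow>\<^sub>E carrier (X E)" and i: "i < n" and u: "u \<in> carrier (X E)"
    note upd = fun_upd_PiE_lessThan[OF z i]
    show "A (z(i := c \<odot>\<^bsub>X E\<^esub> u)) = c \<odot>\<^bsub>Y F\<^esub> A (z(i := u))"
    proof
      fix j
      have "A (z(i := c \<odot>\<^bsub>X E\<^esub> u)) j = a ((co z j)(i := c \<odot>\<^bsub>E\<^esub> u j))"
        unfolding A_coord[OF upd[OF XE.scal_closed[OF u]]] co_upd[OF i] fun_cong[OF XD(5)[OF u]] ..
      also have "\<dots> = c \<odot>\<^bsub>F\<^esub> a ((co z j)(i := u j))"
        by (rule multilinearD(3)[OF a(1) co[OF z] i XD(3)[OF u]])
      also have "\<dots> = (c \<odot>\<^bsub>Y F\<^esub> A (z(i := u))) j"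
        unfolding YD(5)[OF A_closed[OF upd[OF u]]] A_coord[OF upd[OF u]] co_upd[OF i] ..
      finally show "A (z(i := c \<odot>\<^bsub>X E\<^esub> u)) j = (c \<odot>\<^bsub>Y F\<^esub> A (z(i := u))) j" .
    qed
  qed (rule A_closed)
  \<comment> \<open>In coordinate \<open>j\<close> the images converge to \<open>w j\<close> by
    assumption and to the coordinate of \<open>A (z(i := l))\<close> by continuity of
    \<open>P\<close>; limits in \<open>F\<close> are unique.\<close>
  have graph: "w = A (z(i := l))"
    if z: "z \<in> ?N \<rightarrow>\<^sub>E carrier (X E)" and i: "i < n" and y: "converges_to (X E) y l"
      and w: "converges_to (Y F) (\<lambda>k. A (z(i := y k))) w" for z i y l w
  proof
    fix j
    note c = converges_to_carrier[OF y] and upd = fun_upd_PiE_lessThan[OF z i]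
    have "converges_to F (\<lambda>k. a ((co z j)(i := y k j))) (a ((co z j)(i := l j)))"
      unfolding a_def
    proof (rule polarize_converges[OF En Fn])
      fix S assume S: "S \<subseteq> ?N"
      have "converges_to E (\<lambda>k. \<Oplus>\<^bsub>E\<^esub>i'\<in>S. ((co z j)(i := y k j)) i') (\<Oplus>\<^bsub>E\<^esub>i'\<in>S. ((co z j)(i := l j)) i')"
      proof (rule E.converges_to_finsum)
        show "finite S"
          using S by (rule finite_subset) simp
        fix i' assume "i' \<in> S"
        then show "converges_to E (\<lambda>k. ((co z j)(i := y k j)) i') (((co z j)(i := l j)) i')"
          using S co[OF z, of j] sequence_class_converges[OF X E y, of j]
          by (cases "i' = i") (auto intro!: E.converges_to_const)
      qed
      then show "converges_to F (\<lambda>k. P (\<Oplus>\<^bsub>E\<^esub>i'\<in>S. ((co z j)(i := y k j)) i')) (P (\<Oplus>\<^bsub>E\<^esub>i'\<in>S. ((co z j)(i := l j)) i'))"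
        using P unfolding cont_polys_iff[OF En Fn] by blast
    qed
    moreover have "converges_to F (\<lambda>k. a ((co z j)(i := y k j))) (w j)"
      using sequence_class_converges[OF Y F w, of j]
      unfolding A_coord[OF upd[OF c(1)]] co_upd[OF i] .
    ultimately have "w j = a ((co z j)(i := l j))"
      by (intro F.converges_to_unique)
    then show "w j = A (z(i := l)) j"
      unfolding A_coord[OF upd[OF c(2)]] co_upd[OF i] .
  qed
  obtain C where C: "\<And>z. z \<in> ?N \<rightarrow>\<^sub>E carrier (X E) \<Longrightarrow> (\<And>i. i < n \<Longrightarrow> vnorm (X E) (z i) \<le> 1) \<Longrightarrow> vnorm (Y F) (A z) \<le> C"
    by (rule multilinear_closed_graph[OF XE.banach_module_axioms YF.banach_module_axioms A], erule (3) graph) blast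
  \<comment> \<open>On the diagonal \<open>A\<close> is \<open>n!\<close> times the induced map,
    which is why the bound \<open>C\<close> is divided by it.\<close>
  have "vnorm (Y F) (\<lambda>j. P (x j)) \<le> C / fact n" if x: "x \<in> carrier (X E)" "vnorm (X E) x \<le> 1" for x
  proof -
    have z: "(\<lambda>i\<in>?N. x) \<in> ?N \<rightarrow>\<^sub>E carrier (X E)"
      using x by simp
    have "A (\<lambda>i\<in>?N. x) = fact n \<odot>\<^bsub>Y F\<^esub> (\<lambda>j. P (x j))"
    proof
      fix j
      have "co (\<lambda>i\<in>?N. x) j = (\<lambda>i\<in>?N. x j)"
        by (auto simp: co_def)
      then show "A (\<lambda>i\<in>?N. x) j = (fact n \<odot>\<^bsub>Y F\<^esub> (\<lambda>j. P (x j))) j"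
        unfolding A_coord[OF z] YD(5)[OF summing[OF x(1)]] using a(2)[OF XD(3)[OF x(1)]] by (simp only:)
    qed
    then have "vnorm (Y F) (A (\<lambda>i\<in>?N. x)) = fact n * vnorm (Y F) (\<lambda>j. P (x j))"
      using YF.vnorm_smult[OF summing[OF x(1)], of "fact n"] by simp
    moreover have "vnorm (Y F) (A (\<lambda>i\<in>?N. x)) \<le> C"
      by (rule C[OF z]) (use x in simp)
    ultimately show ?thesis
      by (simp add: field_simps)
  qed
  then show ?thesis
    using that by blast
qed

section \<open>Spaces of maps\<close>

text \<open>A common shape for \<open>poly_space\<close> and for a component with its own norm, so
  that the pointwise module laws are verified once.\<close>

definition map_space ::
  "('k::{real_normed_field,banach}, 'v) nspace \<Rightarrow> ('k, 'w) nspace \<Rightarrow> ('v \<Rightarrow> 'w) set \<Rightarrow> (('v \<Rightarrow> 'w) \<Rightarrow> real)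
    \<Rightarrow> ('k, 'v \<Rightarrow> 'w) nspace" where
  "map_space E F H N = \<lparr>
     carrier = H,
     monoid.mult = undefined, one = undefined,
     zero = (\<lambda>x\<in>carrier E. \<zero>\<^bsub>F\<^esub>),
     add = (\<lambda>P Q. \<lambda>x\<in>carrier E. P x \<oplus>\<^bsub>F\<^esub> Q x),
     smult = (\<lambda>a P. \<lambda>x\<in>carrier E. a \<odot>\<^bsub>F\<^esub> P x),
     vnorm = N\<rparr>"

lemma map_space_simps [simp]:
  "carrier (map_space E F H N) = H"
  "\<zero>\<^bsub>map_space E F H N\<^esub> = (\<lambda>x\<in>carrier E. \<zero>\<^bsub>F\<^esub>)"
  "P \<oplus>\<^bsub>map_space E F H N\<^esub> Q = (\<lambda>x\<in>carrier E. P x \<oplus>\<^bsub>F\<^esub> Q x)"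
  "a \<odot>\<^bsub>map_space E F H N\<^esub> P = (\<lambda>x\<in>carrier E. a \<odot>\<^bsub>F\<^esub> P x)"
  "vnorm (map_space E F H N) = N"
  by (simp_all add: map_space_def)

lemma poly_space_eq_map_space:
  "poly_space n E F = map_space E F (cont_polys n E F) (sup_norm E F)"
  "poly_space n E F\<lparr>carrier := H, vnorm := N\<rparr> = map_space E F H N"
  by (simp_all add: poly_space_def map_space_def)

lemma module_map_space:
  fixes E :: "('k::{real_normed_field,banach}, 'v) nspace" and F :: "('k, 'w) nspace"
  assumes "normed_module F" and H: "H \<subseteq> carrier E \<rightarrow>\<^sub>E carrier F"
    and zero: "(\<lambda>x\<in>carrier E. \<zero>\<^bsub>F\<^esub>) \<in> H"
    and add: "\<And>P Q. P \<in> H \<Longrightarrow> Q \<in> H \<Longrightarrow> (\<lambda>x\<in>carrier E. P x \<oplus>\<^bsub>F\<^esub> Q x) \<in> H"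
    and smult: "\<And>a P. P \<in> H \<Longrightarrow> (\<lambda>x\<in>carrier E. a \<odot>\<^bsub>F\<^esub> P x) \<in> H"
  shows "module scalar_ring (map_space E F H N)"
proof -
  interpret F: normed_module F by fact
  have val: "P x \<in> carrier F" if "P \<in> H" "x \<in> carrier E" for P x
    using that H by blast
  \<comment> \<open>Elements of \<open>H\<close> are extensional, so agreement on the carrier is
    equality and the restrictions in the operations lose nothing.\<close>
  have ext: "restrict f (carrier E) = P" if "P \<in> H" "\<And>x. x \<in> carrier E \<Longrightarrow> f x = P x" for f P
    using that H by (intro extensionalityI[where A = "carrier E"]) (auto simp: PiE_def)
  show ?thesis
  proof (rule moduleI)
    show "cring (scalar_ring :: 'k ring)"
      using F.module_axioms by (simp add: module_def)
    show "abelian_group (map_space E F H N)"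
    proof (rule abelian_groupI)
      fix P assume P: "P \<in> carrier (map_space E F H N)"
      then show "\<exists>Q\<in>carrier (map_space E F H N). Q \<oplus>\<^bsub>map_space E F H N\<^esub> P = \<zero>\<^bsub>map_space E F H N\<^esub>"
        using smult[of P "- 1"] val
        by (intro bexI[of _ "\<lambda>x\<in>carrier E. (- 1) \<odot>\<^bsub>F\<^esub> P x"])
          (auto intro!: restrict_ext simp: F.M.l_neg simp flip: F.uminus_eq_scal)
      show "\<zero>\<^bsub>map_space E F H N\<^esub> \<oplus>\<^bsub>map_space E F H N\<^esub> P = P"
        using P val by (auto intro: ext)
    qed (use zero add val in \<open>auto intro!: restrict_ext simp: F.M.a_ac\<close>)
    fix P assume P: "P \<in> carrier (map_space E F H N)"
    then show "\<one>\<^bsub>scalar_ring\<^esub> \<odot>\<^bsub>map_space E F H N\<^esub> P = P"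
      using val by (auto intro: ext)
  qed (use smult val in \<open>auto intro!: restrict_ext simp: F.scal_add_left F.scal_add_right F.scal_scal\<close>)
qed

lemma module_poly_space:
  assumes "normed_module E" "normed_module F"
  shows "module scalar_ring (poly_space n E F)"
  unfolding poly_space_eq_map_space
  by (rule module_map_space[OF assms(2) _ cont_polys_zero[OF assms] cont_polys_add[OF assms] cont_polys_smult[OF assms]])
    (auto simp: cont_polys_def)

section \<open>Summing polynomials\<close>

locale summing_pair =
  fixes X Y :: "('k::{real_normed_field,banach}, 'a) seq_rule"
  assumes X: "sequence_class X" and Y: "sequence_class Y"
    and stable_X: "polynomially_stable X" and stable_Y: "linearly_stable Y"
    and powers: "\<And>n. n \<ge> 1 \<Longrightarrow> power_embedded n X Y"
begin

abbreviation "summing n \<equiv> component (summing_polys X Y) n"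

abbreviation "N \<equiv> summing_norm X Y"

lemma summing_iff:
  "n \<ge> 1 \<Longrightarrow> P \<in> summing n E F \<longleftrightarrow>
    P \<in> cont_polys n E F \<and> (\<forall>x\<in>carrier (X E). (\<lambda>j. P (x j)) \<in> carrier (Y F))"
  by (auto simp: component_def summing_polys_def)

text \<open>Guarantees that \<open>N\<close> is the supremum of a bounded set; all upper estimates
  by \<open>N\<close> go back to it.\<close>

lemma summing_bounded:
  assumes "n \<ge> 1" "banach_module E" "banach_module F" "P \<in> summing n E F"
  obtains C where "\<And>x. x \<in> carrier (X E) \<Longrightarrow> vnorm (X E) x \<le> 1 \<Longrightarrow> vnorm (Y F) (induced_map X E P x) \<le> C"
proof -
  have P: "P \<in> cont_polys n E F" "\<And>x. x \<in> carrier (X E) \<Longrightarrow> (\<lambda>j. P (x j)) \<in> carrier (Y F)"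
    using assms(4) unfolding summing_iff[OF assms(1)] by auto
  obtain C where "\<And>x. x \<in> carrier (X E) \<Longrightarrow> vnorm (X E) x \<le> 1 \<Longrightarrow> vnorm (Y F) (\<lambda>j. P (x j)) \<le> C"
    using summing_poly_bounded[OF X Y assms(2,3) P] by blast
  then show ?thesis
    using that[of C] by simp
qed

lemma N_nonneg:
  assumes "n \<ge> 1" "banach_module E" "banach_module F" "P \<in> summing n E F"
  shows "0 \<le> N E F P"
proof -
  obtain C where "\<And>x. x \<in> carrier (X E) \<Longrightarrow> vnorm (X E) x \<le> 1 \<Longrightarrow> vnorm (Y F) (induced_map X E P x) \<le> C"
    using summing_bounded[OF assms] by blast
  then show ?thesis
    unfolding summing_norm_def using assms(4)
    by (intro sup_norm_nonneg banach_normed sequence_classD(1)[OF X] sequence_classD(1)[OF Y] assms)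
      (auto simp: summing_iff[OF assms(1)])
qed

lemma N_least:
  assumes "banach_module E" "\<And>x. x \<in> carrier (X E) \<Longrightarrow> vnorm (X E) x \<le> 1 \<Longrightarrow> vnorm (Y F) (\<lambda>j. P (x j)) \<le> B"
  shows "N E F P \<le> B"
  unfolding summing_norm_def
  using assms by (intro sup_norm_least banach_normed sequence_classD(1)[OF X]) auto

lemma vnorm_induced_le:
  assumes n: "n \<ge> 1" and E: "banach_module E" and F: "banach_module F" and P: "P \<in> summing n E F"
    and x: "x \<in> carrier (X E)"
  shows "vnorm (Y F) (\<lambda>j. P (x j)) \<le> N E F P * vnorm (X E) x ^ n"
proof -
  interpret XE: banach_module "X E" by (rule sequence_classD(1)[OF X E])
  interpret YF: banach_module "Y F" by (rule sequence_classD(1)[OF Y F])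
  obtain C where C: "\<And>x. x \<in> carrier (X E) \<Longrightarrow> vnorm (X E) x \<le> 1 \<Longrightarrow> vnorm (Y F) (induced_map X E P x) \<le> C"
    using summing_bounded[OF n E F P] by blast
  have cont: "P \<in> cont_polys n E F" and summing: "\<And>x. x \<in> carrier (X E) \<Longrightarrow> (\<lambda>j. P (x j)) \<in> carrier (Y F)"
    using P unfolding summing_iff[OF n] by auto
  have "vnorm (Y F) (induced_map X E P x) \<le> sup_norm (X E) (Y F) (induced_map X E P) * vnorm (X E) x ^ n"
  proof (rule homogeneous_norm_le[OF XE.normed_module_axioms YF.normed_module_axioms n _ _ C x])
    show "induced_map X E P z \<in> carrier (Y F)" if "z \<in> carrier (X E)" for z
      using summing[OF that] that by simp
    show "induced_map X E P (a \<odot>\<^bsub>X E\<^esub> z) = a ^ n \<odot>\<^bsub>Y F\<^esub> induced_map X E P z" if z: "z \<in> carrier (X E)" for a z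
    proof -
      have "P (a \<odot>\<^bsub>E\<^esub> z j) = a ^ n \<odot>\<^bsub>F\<^esub> P (z j)" for j
        by (rule homogeneous_poly_scal[OF banach_normed[OF E] banach_normed[OF F] cont_polysD(2)[OF cont]
              sequence_classD(3)[OF X E z]])
      then show ?thesis
        unfolding induced_map_apply[of z X E, OF z] induced_map_apply[of _ X E, OF XE.scal_closed[OF z]]
        unfolding sequence_classD(5)[OF Y F summing[OF z]] sequence_classD(5)[OF X E z] by simp
    qed
  qed
  then show ?thesis
    using x by (simp add: summing_norm_def)
qed

text \<open>Tests the induced map on \<open>first_seq E x\<close>: coordinate 0 of the image is
  \<open>P x\<close>, and the norm of Y(F) dominates each coordinate. This yields definiteness of
  \<open>N\<close>.\<close>

lemma vnorm_value_le:
  assumes n: "n \<ge> 1" and E: "banach_module E" and F: "banach_module F" and P: "P \<in> summing n E F"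
    and x: "x \<in> carrier E"
  shows "vnorm F (P x) \<le> N E F P * vnorm E x ^ n"
proof -
  interpret XE: banach_module "X E" by (rule sequence_classD(1)[OF X E])
  note f = first_seq_in[OF X E x]
  have "vnorm F (P x) = vnorm F (P (first_seq E x 0))"
    by (simp add: first_seq_def)
  also have "\<dots> \<le> vnorm (Y F) (\<lambda>j. P (first_seq E x j))"
    using P f unfolding summing_iff[OF n] by (intro sequence_classD(6)[OF Y F, of "\<lambda>j. P (first_seq E x j)" 0]) blast
  also have "\<dots> \<le> N E F P * vnorm (X E) (first_seq E x) ^ n"
    by (rule vnorm_induced_le[OF n E F P f])
  also have "\<dots> \<le> N E F P * vnorm E x ^ n"
    using vnorm_first_seq_le[OF X stable_X E x] XE.vnorm_nonneg[OF f] N_nonneg[OF n E F P]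
    by (intro mult_left_mono power_mono)
  finally show ?thesis .
qed

section \<open>The components as Banach spaces\<close>

lemma summing_zero:
  assumes n: "n \<ge> 1" and E: "banach_module E" and F: "banach_module F"
  shows "(\<lambda>x\<in>carrier E. \<zero>\<^bsub>F\<^esub>) \<in> summing n E F"
proof -
  interpret YF: banach_module "Y F" by (rule sequence_classD(1)[OF Y F])
  have "(\<lambda>j. (\<lambda>x\<in>carrier E. \<zero>\<^bsub>F\<^esub>) (x j)) = \<zero>\<^bsub>Y F\<^esub>" if "x \<in> carrier (X E)" for x
    using sequence_classD(3)[OF X E that] by (simp add: sequence_class_zero[OF Y F])
  then show ?thesis
    using cont_polys_zero[OF banach_normed[OF E] banach_normed[OF F]] by (simp add: summing_iff[OF n])
qed

lemma induced_add:
  assumes n: "n \<ge> 1" and E: "banach_module E" and F: "banach_module F"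
    and P: "P \<in> summing n E F" and Q: "Q \<in> summing n E F" and x: "x \<in> carrier (X E)"
  shows "(\<lambda>j. (\<lambda>x\<in>carrier E. P x \<oplus>\<^bsub>F\<^esub> Q x) (x j)) = (\<lambda>j. P (x j)) \<oplus>\<^bsub>Y F\<^esub> (\<lambda>j. Q (x j))"
  using sequence_classD(3)[OF X E x] P Q x
  by (simp add: summing_iff[OF n] sequence_classD(4)[OF Y F])

lemma induced_smult:
  assumes n: "n \<ge> 1" and E: "banach_module E" and F: "banach_module F"
    and P: "P \<in> summing n E F" and x: "x \<in> carrier (X E)"
  shows "(\<lambda>j. (\<lambda>x\<in>carrier E. a \<odot>\<^bsub>F\<^esub> P x) (x j)) = a \<odot>\<^bsub>Y F\<^esub> (\<lambda>j. P (x j))"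
  using sequence_classD(3)[OF X E x] P x
  by (simp add: summing_iff[OF n] sequence_classD(5)[OF Y F])

lemma summing_add:
  assumes n: "n \<ge> 1" and E: "banach_module E" and F: "banach_module F"
    and P: "P \<in> summing n E F" and Q: "Q \<in> summing n E F"
  shows "(\<lambda>x\<in>carrier E. P x \<oplus>\<^bsub>F\<^esub> Q x) \<in> summing n E F"
proof -
  interpret YF: banach_module "Y F" by (rule sequence_classD(1)[OF Y F])
  have "(\<lambda>j. (\<lambda>x\<in>carrier E. P x \<oplus>\<^bsub>F\<^esub> Q x) (x j)) \<in> carrier (Y F)" if x: "x \<in> carrier (X E)" for x
    unfolding induced_add[OF assms x] using P Q x by (simp add: summing_iff[OF n])
  then show ?thesis
    using cont_polys_add[OF banach_normed[OF E] banach_normed[OF F]] P Q by (simp add: summing_iff[OF n])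
qed

lemma summing_smult:
  assumes n: "n \<ge> 1" and E: "banach_module E" and F: "banach_module F" and P: "P \<in> summing n E F"
  shows "(\<lambda>x\<in>carrier E. a \<odot>\<^bsub>F\<^esub> P x) \<in> summing n E F"
proof -
  interpret YF: banach_module "Y F" by (rule sequence_classD(1)[OF Y F])
  have "(\<lambda>j. (\<lambda>x\<in>carrier E. a \<odot>\<^bsub>F\<^esub> P x) (x j)) \<in> carrier (Y F)" if x: "x \<in> carrier (X E)" for x
    unfolding induced_smult[OF assms x] using P x by (simp add: summing_iff[OF n])
  then show ?thesis
    using cont_polys_smult[OF banach_normed[OF E] banach_normed[OF F]] P by (simp add: summing_iff[OF n])
qed

lemma summing_subset:
  "n \<ge> 1 \<Longrightarrow> summing n E F \<subseteq> carrier E \<rightarrow>\<^sub>E carrier F"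
  by (auto simp: component_def cont_polys_def)

lemma module_summing:
  assumes "n \<ge> 1" "banach_module E" "banach_module F"
  shows "module scalar_ring (map_space E F (summing n E F) (N E F))"
  using summing_subset[OF assms(1)] summing_zero[OF assms] summing_add[OF assms] summing_smult[OF assms]
  by (intro module_map_space banach_normed[OF assms(3)])

lemma submodule_summing:
  assumes "n \<ge> 1" "banach_module E" "banach_module F"
  shows "submodule (summing n E F) scalar_ring (poly_space n E F)"
proof -
  \<comment> \<open>This record and the \<open>map_space\<close> of \<open>module_summing\<close>
    differ in the norm only, which the module axioms do not mention; unfolding the locale predicates
    makes this visible.\<close>
  have "module scalar_ring (poly_space n E F\<lparr>carrier := summing n E F\<rparr>)"
    using module_summing[OF assms] unfolding module_def module_axioms_def abelian_group_def
      abelian_monoid_def abelian_group_axioms_def comm_group_def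
    by (simp add: poly_space_def map_space_def)
  then show ?thesis
    by (intro module.module_incl_imp_submodule module_poly_space banach_normed assms)
      (auto simp: poly_space_def component_def)
qed

lemma normed_summing:
  assumes n: "n \<ge> 1" and E: "banach_module E" and F: "banach_module F"
  shows "normed_module (map_space E F (summing n E F) (N E F))"
proof -
  interpret E: banach_module E by fact
  interpret F: banach_module F by fact
  interpret XE: banach_module "X E" by (rule sequence_classD(1)[OF X E])
  interpret YF: banach_module "Y F" by (rule sequence_classD(1)[OF Y F])
  note le1 = vnorm_induced_le[OF n E F]
  have ind: "(\<lambda>j. P (x j)) \<in> carrier (Y F)" if "P \<in> summing n E F" "x \<in> carrier (X E)" for P x
    using that by (simp add: summing_iff[OF n])
  have bound: "vnorm (Y F) (\<lambda>j. P (x j)) \<le> N E F P"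
    if P: "P \<in> summing n E F" and x: "x \<in> carrier (X E)" "vnorm (X E) x \<le> 1" for P x
  proof -
    have "N E F P * vnorm (X E) x ^ n \<le> N E F P * 1"
      using N_nonneg[OF n E F P] x XE.vnorm_nonneg by (intro mult_left_mono power_le_one) auto
    with le1[OF P x(1)] show ?thesis by simp
  qed
  \<comment> \<open>The supremum gives one inequality only; equality follows below by applying it to
    the inverse scalar.\<close>
  have smult_le: "N E F (\<lambda>x\<in>carrier E. a \<odot>\<^bsub>F\<^esub> P x) \<le> norm a * N E F P" if P: "P \<in> summing n E F" for a P
  proof (rule N_least[OF E])
    fix x assume x: "x \<in> carrier (X E)" "vnorm (X E) x \<le> 1"
    show "vnorm (Y F) (\<lambda>j. (\<lambda>x\<in>carrier E. a \<odot>\<^bsub>F\<^esub> P x) (x j)) \<le> norm a * N E F P"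
      unfolding induced_smult[OF n E F P x(1)] YF.vnorm_smult[OF ind[OF P x(1)]]
      by (intro mult_left_mono bound[OF P x]) simp
  qed
  show ?thesis
  proof (intro normed_module.intro normed_module_axioms.intro module_summing[OF assms]; unfold map_space_simps)
    fix P assume P: "P \<in> summing n E F"
    show "0 \<le> N E F P"
      by (rule N_nonneg[OF n E F P])
    show "N E F P = 0 \<longleftrightarrow> P = (\<lambda>x\<in>carrier E. \<zero>\<^bsub>F\<^esub>)"
    proof
      assume "N E F P = 0"
      then have "P x = \<zero>\<^bsub>F\<^esub>" if "x \<in> carrier E" for x
        using vnorm_value_le[OF n E F P that] summing_subset[OF n, of E F] P that
          F.vnorm_nonneg[of "P x"] F.vnorm_eq_0[of "P x"] by force
      then show "P = (\<lambda>x\<in>carrier E. \<zero>\<^bsub>F\<^esub>)"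
        using summing_subset[OF n, of E F] P
        by (intro extensionalityI[of P "carrier E"]) (auto simp: PiE_def)
    next
      assume P0: "P = (\<lambda>x\<in>carrier E. \<zero>\<^bsub>F\<^esub>)"
      \<comment> \<open>The zero map is 0 times itself.\<close>
      have "N E F P \<le> norm (0 :: 'k) * N E F P"
        using smult_le[OF P, of 0] by (simp add: P0 cong: restrict_cong)
      then show "N E F P = 0"
        using N_nonneg[OF n E F P] by simp
    qed
    show "N E F (\<lambda>x\<in>carrier E. a \<odot>\<^bsub>F\<^esub> P x) = norm a * N E F P" for a
    proof (cases "a = 0")
      case True
      then show ?thesis
        using smult_le[OF P, of a] N_nonneg[OF n E F summing_smult[OF n E F P], of a] by simp
    next
      case False
      let ?Q = "\<lambda>x\<in>carrier E. a \<odot>\<^bsub>F\<^esub> P x"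
      have "P x \<in> carrier F" if "x \<in> carrier E" for x
        using summing_subset[OF n, of E F] P that by blast
      moreover have "P \<in> extensional (carrier E)"
        using summing_subset[OF n, of E F] P by (auto simp: PiE_def)
      ultimately have "(\<lambda>x\<in>carrier E. inverse a \<odot>\<^bsub>F\<^esub> ?Q x) = P"
        using False by (intro extensionalityI[where A = "carrier E"]) (auto simp: F.scal_scal)
      then have "N E F P \<le> norm (inverse a) * N E F ?Q"
        using smult_le[OF summing_smult[OF n E F P, of a], of "inverse a"] by simp
      then have "norm a * N E F P \<le> norm a * (norm (inverse a) * N E F ?Q)"
        by (rule mult_left_mono) simp
      also have "\<dots> = N E F ?Q"
        using False by (simp add: norm_inverse norm_divide)
      finally have "norm a * N E F P \<le> N E F ?Q" .
      with smult_le[OF P, of a] show ?thesis by simp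
    qed
    fix Q assume Q: "Q \<in> summing n E F"
    show "N E F (\<lambda>x\<in>carrier E. P x \<oplus>\<^bsub>F\<^esub> Q x) \<le> N E F P + N E F Q"
    proof (rule N_least[OF E])
      fix x assume x: "x \<in> carrier (X E)" "vnorm (X E) x \<le> 1"
      have "vnorm (Y F) ((\<lambda>j. P (x j)) \<oplus>\<^bsub>Y F\<^esub> (\<lambda>j. Q (x j))) \<le> vnorm (Y F) (\<lambda>j. P (x j)) + vnorm (Y F) (\<lambda>j. Q (x j))"
        by (rule YF.vnorm_triangle[OF ind[OF P x(1)] ind[OF Q x(1)]])
      also have "\<dots> \<le> N E F P + N E F Q"
        by (rule add_mono[OF bound[OF P x] bound[OF Q x]])
      finally show "vnorm (Y F) (\<lambda>j. (\<lambda>x\<in>carrier E. P x \<oplus>\<^bsub>F\<^esub> Q x) (x j)) \<le> N E F P + N E F Q"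
        unfolding induced_add[OF n E F P Q x(1)] .
    qed
  qed
qed

text \<open>Subtraction in \<open>map_space\<close> is derived from its group structure rather than
  given pointwise, so it is rewritten as adding the multiple by -1.\<close>

lemma induced_minus:
  assumes n: "n \<ge> 1" and E: "banach_module E" and F: "banach_module F"
    and P: "P \<in> summing n E F" and Q: "Q \<in> summing n E F" and x: "x \<in> carrier (X E)"
  shows "(\<lambda>j. (P \<ominus>\<^bsub>map_space E F (summing n E F) (N E F)\<^esub> Q) (x j)) = (\<lambda>j. P (x j)) \<ominus>\<^bsub>Y F\<^esub> (\<lambda>j. Q (x j))"
proof -
  interpret M: normed_module "map_space E F (summing n E F) (N E F)"
    by (rule normed_summing[OF n E F])
  interpret YF: banach_module "Y F" by (rule sequence_classD(1)[OF Y F])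
  have "P \<ominus>\<^bsub>map_space E F (summing n E F) (N E F)\<^esub> Q =
      (\<lambda>x\<in>carrier E. P x \<oplus>\<^bsub>F\<^esub> (\<lambda>x\<in>carrier E. (- 1) \<odot>\<^bsub>F\<^esub> Q x) x)"
    using M.minus_eq_scal[of P Q] P Q by simp
  then have "(\<lambda>j. (P \<ominus>\<^bsub>map_space E F (summing n E F) (N E F)\<^esub> Q) (x j)) =
      (\<lambda>j. P (x j)) \<oplus>\<^bsub>Y F\<^esub> (- 1) \<odot>\<^bsub>Y F\<^esub> (\<lambda>j. Q (x j))"
    using induced_add[OF n E F P summing_smult[OF n E F Q, of "- 1"] x] induced_smult[OF n E F Q x, of "- 1"]
    by (simp only:)
  then show ?thesis
    using P Q x by (simp add: YF.minus_eq_scal summing_iff[OF n])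
qed

text \<open>A Cauchy sequence for \<open>N\<close> makes the images of each sequence in X(E) Cauchy
  in Y(F). The main point is that all these limits are induced by one map \<open>P\<close>, which
  inherits homogeneity from pointwise and continuity from locally uniform convergence.\<close>

lemma banach_summing:
  assumes n: "n \<ge> 1" and E: "banach_module E" and F: "banach_module F"
  shows "banach_module (map_space E F (summing n E F) (N E F))"
proof -
  let ?M = "map_space E F (summing n E F) (N E F)"
  interpret M: normed_module ?M by (rule normed_summing[OF assms])
  interpret E: banach_module E by fact
  interpret F: banach_module F by fact
  interpret XE: banach_module "X E" by (rule sequence_classD(1)[OF X E])
  interpret YF: banach_module "Y F" by (rule sequence_classD(1)[OF Y F])
  show ?thesis
  proof (rule M.banach_moduleI)
    fix s :: "nat \<Rightarrow> 'k + 'a \<Rightarrow> 'k + 'a"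
    assume "range s \<subseteq> carrier ?M"
      and Cauchy: "\<And>\<epsilon>. \<epsilon> > 0 \<Longrightarrow> \<exists>K. \<forall>k\<ge>K. \<forall>l\<ge>K. vnorm ?M (s k \<ominus>\<^bsub>?M\<^esub> s l) < \<epsilon>"
    then have s: "s k \<in> summing n E F" for k
      by auto
    have ind: "(\<lambda>j. s k (x j)) \<in> carrier (Y F)" if "x \<in> carrier (X E)" for k x
      using s[of k] that by (simp add: summing_iff[OF n])
    have close: "\<exists>K. \<forall>x\<in>carrier (X E). \<forall>k\<ge>K. \<forall>l\<ge>K.
        vnorm (Y F) ((\<lambda>j. s k (x j)) \<ominus>\<^bsub>Y F\<^esub> (\<lambda>j. s l (x j))) \<le> \<epsilon> * vnorm (X E) x ^ n"
      if \<epsilon>: "\<epsilon> > 0" for \<epsilon>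
    proof -
      obtain K where K: "\<And>k l. k \<ge> K \<Longrightarrow> l \<ge> K \<Longrightarrow> vnorm ?M (s k \<ominus>\<^bsub>?M\<^esub> s l) < \<epsilon>"
        using Cauchy[OF \<epsilon>] by blast
      have "vnorm (Y F) ((\<lambda>j. s k (x j)) \<ominus>\<^bsub>Y F\<^esub> (\<lambda>j. s l (x j))) \<le> \<epsilon> * vnorm (X E) x ^ n"
        if x: "x \<in> carrier (X E)" and kl: "k \<ge> K" "l \<ge> K" for x k l
      proof -
        have "s k \<ominus>\<^bsub>?M\<^esub> s l \<in> carrier ?M"
          using s by (intro M.M.minus_closed) auto
        then have "vnorm (Y F) (\<lambda>j. (s k \<ominus>\<^bsub>?M\<^esub> s l) (x j)) \<le> N E F (s k \<ominus>\<^bsub>?M\<^esub> s l) * vnorm (X E) x ^ n"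
          by (intro vnorm_induced_le[OF n E F _ x]) simp
        also have "\<dots> \<le> \<epsilon> * vnorm (X E) x ^ n"
          using K[OF kl] XE.vnorm_nonneg[OF x] by (intro mult_right_mono) auto
        finally show ?thesis
          unfolding induced_minus[OF n E F s s x] .
      qed
      then show ?thesis by blast
    qed
    have "\<exists>w. converges_to (Y F) (\<lambda>k j. s k (x j)) w" if x: "x \<in> carrier (X E)" for x
    proof (rule YF.Cauchy_converges)
      show "range (\<lambda>k j. s k (x j)) \<subseteq> carrier (Y F)"
        using ind[OF x] by auto
      fix \<epsilon> :: real assume "\<epsilon> > 0"
      \<comment> \<open>The added 1 keeps the denominator positive even if \<open>x\<close> is zero,
        and makes the resulting inequality strict.\<close>
      define \<delta> where "\<delta> = \<epsilon> / (vnorm (X E) x ^ n + 1)"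
      have pos: "vnorm (X E) x ^ n + 1 > 0"
        using XE.vnorm_nonneg[OF x] by (simp add: add_nonneg_pos)
      then have "\<delta> > 0"
        using \<open>\<epsilon> > 0\<close> by (simp add: \<delta>_def)
      then obtain K where K: "\<And>k l. k \<ge> K \<Longrightarrow> l \<ge> K \<Longrightarrow>
          vnorm (Y F) ((\<lambda>j. s k (x j)) \<ominus>\<^bsub>Y F\<^esub> (\<lambda>j. s l (x j))) \<le> \<delta> * vnorm (X E) x ^ n"
        using close x by blast
      have "\<delta> * (vnorm (X E) x ^ n + 1) = \<epsilon>"
        using pos by (simp add: \<delta>_def)
      then have "\<delta> * vnorm (X E) x ^ n < \<epsilon>"
        using \<open>\<delta> > 0\<close> by (simp add: distrib_left)
      then show "\<exists>K. \<forall>k\<ge>K. \<forall>l\<ge>K. vnorm (Y F) ((\<lambda>j. s k (x j)) \<ominus>\<^bsub>Y F\<^esub> (\<lambda>j. s l (x j))) < \<epsilon>"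
        using K order_le_less_trans by blast
    qed blast
    then obtain W where W: "\<And>x. x \<in> carrier (X E) \<Longrightarrow> converges_to (Y F) (\<lambda>k j. s k (x j)) (W x)"
      by metis
    \<comment> \<open>Limits are available only for sequences, so the value at \<open>x\<close> is
      read off from coordinate 0 of the limit along \<open>first_seq E x\<close>.\<close>
    define P where "P = (\<lambda>x\<in>carrier E. W (first_seq E x) 0)"
    have P_lim: "converges_to F (\<lambda>k. s k x) (P x)" if x: "x \<in> carrier E" for x
      using sequence_class_converges[OF Y F W[OF first_seq_in[OF X E x]], of 0] x
      by (simp add: P_def first_seq_def)
    \<comment> \<open>Coordinate \<open>j\<close> of \<open>W x\<close> and the value of
      \<open>P\<close> at \<open>x j\<close> are limits of the same sequence in
      \<open>F\<close>.\<close>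
    have W_eq: "W x = (\<lambda>j. P (x j))" if x: "x \<in> carrier (X E)" for x
    proof
      fix j
      show "W x j = P (x j)"
        using sequence_class_converges[OF Y F W[OF x], of j] P_lim[OF sequence_classD(3)[OF X E x], of j]
        by (rule F.converges_to_unique)
    qed
    have PY: "(\<lambda>j. P (x j)) \<in> carrier (Y F)" if "x \<in> carrier (X E)" for x
      using converges_to_carrier(2)[OF W[OF that]] by (simp add: W_eq[OF that])
    \<comment> \<open>The second index of the Cauchy estimate tends to infinity; weak bounds on
      norms survive the limit.\<close>
    have close_P: "\<exists>K. \<forall>x\<in>carrier (X E). \<forall>k\<ge>K.
        vnorm (Y F) ((\<lambda>j. s k (x j)) \<ominus>\<^bsub>Y F\<^esub> (\<lambda>j. P (x j))) \<le> \<epsilon> * vnorm (X E) x ^ n"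
      if \<epsilon>: "\<epsilon> > 0" for \<epsilon>
    proof -
      obtain K where K: "\<And>x k l. x \<in> carrier (X E) \<Longrightarrow> k \<ge> K \<Longrightarrow> l \<ge> K \<Longrightarrow>
          vnorm (Y F) ((\<lambda>j. s k (x j)) \<ominus>\<^bsub>Y F\<^esub> (\<lambda>j. s l (x j))) \<le> \<epsilon> * vnorm (X E) x ^ n"
        using close[OF \<epsilon>] by blast
      have "vnorm (Y F) ((\<lambda>j. s k (x j)) \<ominus>\<^bsub>Y F\<^esub> (\<lambda>j. P (x j))) \<le> \<epsilon> * vnorm (X E) x ^ n"
        if x: "x \<in> carrier (X E)" and k: "k \<ge> K" for x k
      proof (rule YF.converges_to_bound)
        show "converges_to (Y F) (\<lambda>l. (\<lambda>j. s k (x j)) \<ominus>\<^bsub>Y F\<^esub> (\<lambda>j. s l (x j)))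
            ((\<lambda>j. s k (x j)) \<ominus>\<^bsub>Y F\<^esub> (\<lambda>j. P (x j)))"
          using W[OF x] ind[OF x] unfolding W_eq[OF x]
          by (intro YF.converges_to_diff YF.converges_to_const)
      qed (rule K[OF x k])
      then show ?thesis by blast
    qed
    \<comment> \<open>Testing on \<open>first_seq E x\<close> brings the estimate down to
      \<open>E\<close> and \<open>F\<close>, in the relative form that
      \<open>continuous_uniform_limit\<close> asks for.\<close>
    have unif: "\<exists>k. \<forall>x\<in>carrier E. vnorm F (s k x \<ominus>\<^bsub>F\<^esub> P x) \<le> \<epsilon> * vnorm E x ^ n" if \<epsilon>: "\<epsilon> > 0" for \<epsilon>
    proof -
      obtain k where k: "\<And>x. x \<in> carrier (X E) \<Longrightarrow>
          vnorm (Y F) ((\<lambda>j. s k (x j)) \<ominus>\<^bsub>Y F\<^esub> (\<lambda>j. P (x j))) \<le> \<epsilon> * vnorm (X E) x ^ n"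
        using close_P[OF \<epsilon>] by blast
      have "vnorm F (s k x \<ominus>\<^bsub>F\<^esub> P x) \<le> \<epsilon> * vnorm E x ^ n" if x: "x \<in> carrier E" for x
      proof -
        note f = first_seq_in[OF X E x]
        have "vnorm F (s k x \<ominus>\<^bsub>F\<^esub> P x) = vnorm F (((\<lambda>j. s k (first_seq E x j)) \<ominus>\<^bsub>Y F\<^esub> (\<lambda>j. P (first_seq E x j))) 0)"
          unfolding sequence_class_minus[OF Y F ind[OF f] PY[OF f]] by (simp add: first_seq_def)
        also have "\<dots> \<le> vnorm (Y F) ((\<lambda>j. s k (first_seq E x j)) \<ominus>\<^bsub>Y F\<^esub> (\<lambda>j. P (first_seq E x j)))"
          by (rule sequence_classD(6)[OF Y F YF.M.minus_closed[OF ind[OF f] PY[OF f]]])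
        also have "\<dots> \<le> \<epsilon> * vnorm (X E) (first_seq E x) ^ n"
          by (rule k[OF f])
        also have "\<dots> \<le> \<epsilon> * vnorm E x ^ n"
          using vnorm_first_seq_le[OF X stable_X E x] XE.vnorm_nonneg[OF f] \<epsilon>
          by (intro mult_left_mono power_mono) auto
        finally show ?thesis .
      qed
      then show ?thesis by blast
    qed
    have sc: "s k \<in> cont_polys n E F" for k
      using s[of k] by (simp add: summing_iff[OF n])
    note En = E.normed_module_axioms and Fn = F.normed_module_axioms
    have "P \<in> cont_polys n E F"
      unfolding cont_polys_iff[OF En Fn]
    proof (intro conjI allI impI)
      show "P \<in> extensional (carrier E)"
        by (simp add: P_def)
      show "homogeneous_poly n E F P"
        by (rule homogeneous_poly_limit[OF En Fn cont_polysD(2)[OF sc] P_lim])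
      fix u l assume u: "converges_to E u l"
      show "converges_to F (\<lambda>k. P (u k)) (P l)"
      proof (rule continuous_uniform_limit[OF En Fn _ _ unif u])
        show "converges_to F (\<lambda>i. s k (v i)) (s k w)" if "converges_to E v w" for k v w
          using sc[of k] that unfolding cont_polys_iff[OF En Fn] by blast
      qed (rule converges_to_carrier(2)[OF P_lim])
    qed
    then have P: "P \<in> summing n E F"
      using PY by (simp add: summing_iff[OF n])
    have "(\<lambda>k. N E F (s k \<ominus>\<^bsub>?M\<^esub> P)) \<longlonglongrightarrow> 0"
    proof (rule LIMSEQ_I)
      fix e :: real assume "e > 0"
      then obtain K where K: "\<And>x k. x \<in> carrier (X E) \<Longrightarrow> k \<ge> K \<Longrightarrow>
          vnorm (Y F) ((\<lambda>j. s k (x j)) \<ominus>\<^bsub>Y F\<^esub> (\<lambda>j. P (x j))) \<le> e / 2 * vnorm (X E) x ^ n"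
        using close_P[of "e / 2"] by auto
      have "norm (N E F (s k \<ominus>\<^bsub>?M\<^esub> P) - 0) < e" if k: "k \<ge> K" for k
      proof -
        \<comment> \<open>A supremum inherits only the weak inequality; half of \<open>e\<close>
          leaves room for the strict one.\<close>
        have "N E F (s k \<ominus>\<^bsub>?M\<^esub> P) \<le> e / 2"
        proof (rule N_least[OF E])
          fix x assume x: "x \<in> carrier (X E)" "vnorm (X E) x \<le> 1"
          have "e / 2 * vnorm (X E) x ^ n \<le> e / 2 * 1"
            using x XE.vnorm_nonneg \<open>e > 0\<close> by (intro mult_left_mono power_le_one) auto
          with K[OF x(1) k] show "vnorm (Y F) (\<lambda>j. (s k \<ominus>\<^bsub>?M\<^esub> P) (x j)) \<le> e / 2"
            unfolding induced_minus[OF n E F s P x(1)] by simp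
        qed
        moreover have "0 \<le> N E F (s k \<ominus>\<^bsub>?M\<^esub> P)"
          using M.vnorm_nonneg[OF M.M.minus_closed, of "s k" P] s P by simp
        ultimately show ?thesis
          using \<open>e > 0\<close> by simp
      qed
      then show "\<exists>K. \<forall>k\<ge>K. norm (N E F (s k \<ominus>\<^bsub>?M\<^esub> P) - 0) < e"
        by blast
    qed
    then have "converges_to ?M s P"
      using s P by (auto simp: converges_to_def)
    then show "\<exists>l. converges_to ?M s l"
      by blast
  qed
qed

text \<open>The induced map factors as X(G) -> X(E) -> Y(F) -> Y(H). Polynomial stability, the
  summing property and linear stability bound the three factors, and degree \<open>n\<close> of the
  middle one raises the norm of \<open>R\<close> to the power \<open>n\<close>.\<close>

lemma summing_hyper_ideal:
  assumes n: "n \<ge> 1" and m: "m \<ge> 1"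
    and E: "banach_module E" and F: "banach_module F" and G: "banach_module G" and H: "banach_module H"
    and P: "P \<in> summing n E F" and R: "R \<in> cont_polys m G E" and t: "t \<in> bounded_ops F H"
  shows "compose (carrier G) t (compose (carrier G) P R) \<in> summing (m * n) G H" (is "?T \<in> _")
    and "N G H (compose (carrier G) t (compose (carrier G) P R)) \<le> sup_norm F H t * N E F P * sup_norm G E R ^ n"
proof -
  note norm = banach_normed[OF E] banach_normed[OF F] banach_normed[OF G] banach_normed[OF H]
  note st = polynomially_stableD[OF stable_X m G E R]
  have mn: "m * n \<ge> 1"
    using n m by simp
  have P': "P \<in> cont_polys n E F" "\<And>x. x \<in> carrier (X E) \<Longrightarrow> (\<lambda>j. P (x j)) \<in> carrier (Y F)"
    using P by (auto simp: summing_iff[OF n])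
  have t1: "t \<in> cont_polys 1 F H"
    using t bounded_ops_subset_cont_polys[OF norm(2,4)] by blast
  have tY: "\<And>x. x \<in> carrier (Y F) \<Longrightarrow> (\<lambda>j. t (x j)) \<in> carrier (Y H)"
    and ind_t: "induced_map Y F t \<in> bounded_ops (Y F) (Y H)"
    and norm_t: "sup_norm (Y F) (Y H) (induced_map Y F t) = sup_norm F H t"
    using stable_Y F H t unfolding linearly_stable_def by blast+
  have ind_t1: "induced_map Y F t \<in> cont_polys 1 (Y F) (Y H)"
    using ind_t bounded_ops_subset_cont_polys[OF banach_normed[OF sequence_classD(1)[OF Y F]]
      banach_normed[OF sequence_classD(1)[OF Y H]]] by blast
  have T_ind: "(\<lambda>j. ?T (x j)) = (\<lambda>j. t (P (R (x j))))" if "x \<in> carrier (X G)" for x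
    using sequence_classD(3)[OF X G that] by (simp add: compose_def)
  \<comment> \<open>Degrees multiply from the inside out, with \<open>t\<close> as a polynomial of
    degree 1; hence the trailing factor.\<close>
  have "?T \<in> cont_polys (m * n * 1) G H"
    by (rule cont_polys_compose[OF norm(3,2,4) t1 cont_polys_compose[OF norm(3,1,2) P'(1) R]])
  then show "?T \<in> summing (m * n) G H"
    using tY[OF P'(2)[OF st(1)]] T_ind by (simp add: summing_iff[OF mn])
  interpret XE: banach_module "X E" by (rule sequence_classD(1)[OF X E])
  interpret XG: banach_module "X G" by (rule sequence_classD(1)[OF X G])
  interpret H: banach_module H by fact
  show "N G H ?T \<le> sup_norm F H t * N E F P * sup_norm G E R ^ n"
  proof (rule N_least[OF G])
    fix x assume x: "x \<in> carrier (X G)" "vnorm (X G) x \<le> 1"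
    note Rx = st(1)[OF x(1)] and PRx = P'(2)[OF st(1)[OF x(1)]]
    obtain Cr where Cr: "\<And>x. x \<in> carrier G \<Longrightarrow> vnorm G x \<le> 1 \<Longrightarrow> vnorm E (R x) \<le> Cr"
      using cont_poly_bounded[OF norm(3,1) R m] by blast
    have R0: "0 \<le> sup_norm G E R"
      by (rule sup_norm_nonneg[OF norm(3,1)], erule cont_polysD(1)[OF R], erule (1) Cr)
    obtain Ct where Ct: "\<And>x. x \<in> carrier F \<Longrightarrow> vnorm F x \<le> 1 \<Longrightarrow> vnorm H (t x) \<le> Ct"
      using cont_poly_bounded[OF norm(2,4) t1] by blast
    have t0: "0 \<le> sup_norm F H t"
      by (rule sup_norm_nonneg[OF norm(2,4)], erule cont_polysD(1)[OF t1], erule (1) Ct)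
    have "vnorm (X E) (\<lambda>j. R (x j)) \<le> sup_norm G E R * vnorm (X G) x ^ m"
      using cont_poly_norm_le[OF XG.normed_module_axioms XE.normed_module_axioms st(2) m x(1)] x(1)
      by (simp add: st(3))
    also have "\<dots> \<le> sup_norm G E R * 1"
      using x XG.vnorm_nonneg R0 by (intro mult_left_mono power_le_one) auto
    finally have 1: "vnorm (X E) (\<lambda>j. R (x j)) \<le> sup_norm G E R"
      by simp
    have "vnorm (Y F) (\<lambda>j. P (R (x j))) \<le> N E F P * vnorm (X E) (\<lambda>j. R (x j)) ^ n"
      by (rule vnorm_induced_le[OF n E F P Rx])
    also have "\<dots> \<le> N E F P * sup_norm G E R ^ n"
      using N_nonneg[OF n E F P] 1 XE.vnorm_nonneg[OF Rx] by (intro mult_left_mono power_mono)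
    finally have 2: "vnorm (Y F) (\<lambda>j. P (R (x j))) \<le> N E F P * sup_norm G E R ^ n" .
    have "vnorm (Y H) (\<lambda>j. t (P (R (x j)))) \<le> sup_norm F H t * vnorm (Y F) (\<lambda>j. P (R (x j)))"
      using cont_poly_norm_le[OF banach_normed[OF sequence_classD(1)[OF Y F]]
          banach_normed[OF sequence_classD(1)[OF Y H]] ind_t1 order_refl PRx] PRx by (simp add: norm_t)
    also have "\<dots> \<le> sup_norm F H t * (N E F P * sup_norm G E R ^ n)"
      by (rule mult_left_mono[OF 2 t0])
    finally show "vnorm (Y H) (\<lambda>j. ?T (x j)) \<le> sup_norm F H t * N E F P * sup_norm G E R ^ n"
      unfolding T_ind[OF x(1)] by (simp add: mult.assoc)
  qed
qed

end

section \<open>Powers of scalars and polynomials of finite type\<close>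

definition power_map :: "nat \<Rightarrow> 'k::{real_normed_field,banach} + 'a \<Rightarrow> 'k + 'a" where
  "power_map n = (\<lambda>z\<in>carrier (scalar_space :: ('k, 'a) bspace). Inl (projl z ^ n))"

lemma scalar_space_minus:
  assumes "x \<in> carrier scalar_space" "y \<in> carrier scalar_space"
  shows "x \<ominus>\<^bsub>scalar_space\<^esub> y = Inl (projl x - projl y)"
  using normed_module.minus_eq_scal[OF banach_normed[OF banach_module_scalar_space] assms] by simp

lemma converges_to_scalar_space_iff:
  "converges_to scalar_space s l \<longleftrightarrow>
    range s \<subseteq> range Inl \<and> l \<in> range Inl \<and> (\<lambda>k. projl (s k)) \<longlonglongrightarrow> projl l"
proof (cases "range s \<subseteq> range Inl \<and> l \<in> range Inl")
  case True
  then have "s k \<ominus>\<^bsub>scalar_space\<^esub> l = Inl (projl (s k) - projl l)" for k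
    by (intro scalar_space_minus) auto
  then show ?thesis
    using True by (simp add: converges_to_def tendsto_norm_zero_iff LIM_zero_iff)
qed (auto simp: converges_to_def)

lemma power_map_cont_poly: "power_map n \<in> cont_polys n scalar_space scalar_space"
proof -
  let ?K = "scalar_space :: ('a, 'b) bspace"
  have K: "normed_module ?K"
    by (rule banach_normed[OF banach_module_scalar_space])
  show ?thesis
    unfolding cont_polys_iff[OF K K]
  proof (intro conjI allI impI)
    show "power_map n \<in> extensional (carrier ?K)"
      by (simp add: power_map_def)
    \<comment> \<open>Splitting slot \<open>i\<close> off the product reduces multilinearity to
      distributivity in the field.\<close>
    have upd: "(\<Prod>j<n. projl ((x(i := v)) j)) = projl v * (\<Prod>j\<in>{..<n} - {i}. projl (x j))"
      if "i < n" for x :: "nat \<Rightarrow> 'a + 'b" and i v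
      using that by (simp add: prod.remove[of "{..<n}" i])
    have "multilinear n ?K ?K (\<lambda>x. Inl (\<Prod>i<n. projl (x i)))"
      unfolding multilinear_def by (simp add: upd distrib_right mult.assoc del: fun_upd_apply)
    then show "homogeneous_poly n ?K ?K (power_map n)"
      unfolding homogeneous_poly_def
      by (intro exI[of _ "\<lambda>x. Inl (\<Prod>i<n. projl (x i))"]) (simp add: power_map_def)
    fix s l assume s: "converges_to ?K s l"
    then show "converges_to ?K (\<lambda>k. power_map n (s k)) (power_map n l)"
      unfolding converges_to_scalar_space_iff
      by (auto simp: power_map_def image_subset_iff intro!: tendsto_power)
  qed
qed

context summing_pair
begin

text \<open>Compatibility of X and Y with all \<open>n\<close> factors equal to the scalars of
  \<open>x\<close> gives membership and norm at most 1. The first unit sequence gives the converse,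
  being fixed by the power and of norm 1 in both classes.\<close>

lemma power_map_summing:
  assumes n: "n \<ge> 1"
  shows "power_map n \<in> summing n scalar_space scalar_space"
    and "N scalar_space scalar_space (power_map n) = 1"
proof -
  let ?K = "scalar_space :: ('k, 'a) bspace"
  have K: "banach_module ?K"
    by (rule banach_module_scalar_space)
  have pow: "(\<lambda>j. power_map n (x j)) \<in> carrier (Y ?K) \<and> vnorm (Y ?K) (\<lambda>j. power_map n (x j)) \<le> vnorm (X ?K) x ^ n"
    if x: "x \<in> carrier (X ?K)" for x
  proof -
    have xj: "x j \<in> range Inl" for j
      using sequence_classD(3)[OF X K x] by simp
    have "Inl (projl (x j)) = x j" for j
      using xj[of j] by auto
    then have "scalar_seq (\<lambda>j. projl (x j)) = x"
      by (simp add: scalar_seq_def)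
    moreover have "scalar_seq (\<lambda>j. \<Prod>m=1..n. projl (x j)) = (\<lambda>j. power_map n (x j))"
      using xj by (simp add: scalar_seq_def power_map_def)
    ultimately show ?thesis
      using powers[OF n] x unfolding power_embedded_def by (auto dest!: spec[of _ "\<lambda>m j. projl (x j)"])
  qed
  show summing: "power_map n \<in> summing n ?K ?K"
    using power_map_cont_poly pow by (auto simp: summing_iff[OF n])
  have "N ?K ?K (power_map n) \<le> 1"
  proof (rule N_least[OF K])
    interpret XK: banach_module "X ?K" by (rule sequence_classD(1)[OF X K])
    fix x assume x: "x \<in> carrier (X ?K)" "vnorm (X ?K) x \<le> 1"
    then have "vnorm (X ?K) x ^ n \<le> 1"
      using XK.vnorm_nonneg by (intro power_le_one) auto
    with pow[OF x(1)] show "vnorm (Y ?K) (\<lambda>j. power_map n (x j)) \<le> 1"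
      by linarith
  qed
  moreover have "1 \<le> N ?K ?K (power_map n)"
  proof -
    define e :: "nat \<Rightarrow> 'k + 'a" where "e = scalar_seq (\<lambda>i. if i = 0 then 1 else 0)"
    have e_first: "e = first_seq ?K (Inl 1)"
      by (auto simp: e_def scalar_seq_def first_seq_def)
    have e: "e \<in> carrier (X ?K)"
      unfolding e_first by (rule first_seq_in[OF X K]) simp
    \<comment> \<open>Needs \<open>0 ^ n = 0\<close>, hence positive degree.\<close>
    have "(\<lambda>j. power_map n (e j)) = e"
      using n by (auto simp: e_first first_seq_def power_map_def)
    moreover have "vnorm (X ?K) e = 1" "vnorm (Y ?K) e = 1"
      using X Y by (auto simp: sequence_class_def e_def)
    ultimately show ?thesis
      using vnorm_induced_le[OF n K K summing e] by simp
  qed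
  ultimately show "N ?K ?K (power_map n) = 1" by simp
qed

lemma finite_type_summing:
  assumes n: "n \<ge> 1" and E: "banach_module E" and F: "banach_module F"
  shows "finite_type_polys n E F \<subseteq> summing n E F"
proof
  let ?K = "scalar_space :: ('k, 'a) bspace"
  have K: "banach_module ?K"
    by (rule banach_module_scalar_space)
  interpret F: banach_module F by fact
  have elementary: "(\<lambda>x\<in>carrier E. projl (\<phi> x) ^ n \<odot>\<^bsub>F\<^esub> b) \<in> summing n E F"
    if \<phi>: "\<phi> \<in> bounded_ops E ?K" and b: "b \<in> carrier F" for \<phi> b
  proof -
    have \<phi>1: "\<phi> \<in> cont_polys 1 E ?K"
      using \<phi> bounded_ops_subset_cont_polys[OF banach_normed[OF E] banach_normed[OF K]] by blast
    \<comment> \<open>An elementary term factors through the scalars, with the power map as the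
      summing polynomial between the functional and the line; the functional contributes the degree
      1.\<close>
    have "compose (carrier E) (line_map F b) (compose (carrier E) (power_map n) \<phi>) \<in> summing (1 * n) E F"
      by (rule summing_hyper_ideal(1)[OF n order_refl K K E F power_map_summing(1)[OF n] \<phi>1
            line_map(1)[OF F.normed_module_axioms b]])
    also have "compose (carrier E) (line_map F b) (compose (carrier E) (power_map n) \<phi>) =
        (\<lambda>x\<in>carrier E. projl (\<phi> x) ^ n \<odot>\<^bsub>F\<^esub> b)"
      using cont_polysD(1)[OF \<phi>1] by (auto simp: compose_def line_map_def power_map_def intro!: restrict_ext)
    finally show ?thesis
      by (simp only: mult_1)
  qed
  fix P assume "P \<in> finite_type_polys n E F"
  then obtain m c \<phi> b where P: "P = (\<lambda>x\<in>carrier E. \<Oplus>\<^bsub>F\<^esub>i\<in>{..<m::nat}. c i \<odot>\<^bsub>F\<^esub> (projl (\<phi> i x) ^ n \<odot>\<^bsub>F\<^esub> b i))"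
    and \<phi>: "\<And>i. i < m \<Longrightarrow> \<phi> i \<in> bounded_ops E ?K" "\<And>i. i < m \<Longrightarrow> b i \<in> carrier F"
    unfolding finite_type_polys_def by blast
  have "(\<lambda>x\<in>carrier E. \<Oplus>\<^bsub>F\<^esub>i\<in>{..<k}. c i \<odot>\<^bsub>F\<^esub> (projl (\<phi> i x) ^ n \<odot>\<^bsub>F\<^esub> b i)) \<in> summing n E F" if "k \<le> m" for k
    using that
  proof (induct k)
    case 0
    show ?case
      by (simp only: lessThan_0 F.M.finsum_empty summing_zero[OF n E F])
  next
    case (Suc k)
    let ?t = "\<lambda>i x. c i \<odot>\<^bsub>F\<^esub> (projl (\<phi> i x) ^ n \<odot>\<^bsub>F\<^esub> b i)"
    let ?e = "\<lambda>x\<in>carrier E. projl (\<phi> k x) ^ n \<odot>\<^bsub>F\<^esub> b k"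
    have "?e \<in> summing n E F"
      using Suc \<phi> by (intro elementary) auto
    moreover have "(\<lambda>x\<in>carrier E. \<Oplus>\<^bsub>F\<^esub>i\<in>{..<k}. ?t i x) \<in> summing n E F"
      by (rule Suc(1)[OF Suc_leD[OF Suc(2)]])
    ultimately have "(\<lambda>x\<in>carrier E. (\<lambda>x\<in>carrier E. c k \<odot>\<^bsub>F\<^esub> ?e x) x \<oplus>\<^bsub>F\<^esub> (\<lambda>x\<in>carrier E. \<Oplus>\<^bsub>F\<^esub>i\<in>{..<k}. ?t i x) x) \<in> summing n E F"
      by (intro summing_add[OF n E F] summing_smult[OF n E F])
    also have "(\<lambda>x\<in>carrier E. (\<lambda>x\<in>carrier E. c k \<odot>\<^bsub>F\<^esub> ?e x) x \<oplus>\<^bsub>F\<^esub> (\<lambda>x\<in>carrier E. \<Oplus>\<^bsub>F\<^esub>i\<in>{..<k}. ?t i x) x) =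
        (\<lambda>x\<in>carrier E. \<Oplus>\<^bsub>F\<^esub>i\<in>{..<Suc k}. ?t i x)"
    proof (rule restrict_ext)
      fix x assume "x \<in> carrier E"
      then show "(\<lambda>x\<in>carrier E. c k \<odot>\<^bsub>F\<^esub> ?e x) x \<oplus>\<^bsub>F\<^esub> (\<lambda>x\<in>carrier E. \<Oplus>\<^bsub>F\<^esub>i\<in>{..<k}. ?t i x) x =
          (\<Oplus>\<^bsub>F\<^esub>i\<in>{..<Suc k}. ?t i x)"
        using Suc \<phi>(2) by (simp add: lessThan_Suc Pi_def)
    qed
    finally show ?case .
  qed
  then show "P \<in> summing n E F"
    unfolding P by simp
qed

end

theorem theorem3p6:
  fixes X Y :: "('k::{real_normed_field,banach}, 'a) seq_rule"
  assumes "sequence_class X" and "polynomially_stable X"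
    and "sequence_class Y" and "linearly_stable Y"
    and "\<forall>n\<ge>1. power_embedded n X Y"
  shows "polynomial_banach_hyper_ideal (summing_polys X Y) (summing_norm X Y)"
proof -
  interpret summing_pair X Y
    using assms by unfold_locales auto
  show ?thesis
    unfolding polynomial_banach_hyper_ideal_def
  proof (intro conjI allI ballI impI)
    show "summing_polys X Y E F \<subseteq> (\<Union>n\<in>{1..}. cont_polys n E F)" for E F
      by (auto simp: summing_polys_def)
    show "summing_norm X Y scalar_space scalar_space (\<lambda>z\<in>carrier scalar_space. Inl (projl z ^ n)) = 1"
      if "n \<ge> 1" for n
      using power_map_summing(2)[OF that] by (simp add: power_map_def)
  \<comment> \<open>The component with its summing norm is rewritten as a \<open>map_space\<close>,
    the form of \<open>banach_summing\<close>; the clauses on submodules, finite type, completeness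
    and composition are then the lemmas above.\<close>
  qed (unfold poly_space_eq_map_space(2), (rule submodule_summing finite_type_summing banach_summing
      summing_hyper_ideal; assumption)+)
qed

end
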